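(* Let $\beta_1$ be the closed Bézier curve of degree $6$ with control points $(0,9,20)$, $(-15,-95,-50)$, $(40,80,-20)$, $(10,-60,58)$, $(-60,30,20)$, $(40,-60,-60)$, $(0,9,20)$, and let $K_{1,4}$ be the closed PL curve obtained from these control points by four iterations of de Casteljau subdivision with parameter $\tfrac12$. Then $\beta_1$ is ambient isotopic to $K_{1,4}$, which is a trefoil knot.
   Context: The Bézier curve of degree $n$ with control points $P_0,\dots,P_n\in\mathbb{R}^3$ is $\mathcal{C}(t)=\sum_{i=0}^n \binom{n}{i}t^i(1-t)^{n-i}P_i$, $t\in[0,1]$; curves are identified with their images. One step of de Casteljau subdivision (parameter $\tfrac12$) applied to $(Q_0,\dots,Q_n)$: put $Q_k^{(0)}=Q_k$, $Q_k^{(r)}=\tfrac12(Q_k^{(r-1)}+Q_{k+1}^{(r-1)})$, and output the left list $(Q_0^{(0)},Q_0^{(1)},\dots,Q_0^{(n)})$ and the right list $(Q_0^{(n)},Q_1^{(n-1)},\dots,Q_n^{(0)})$. Each further iteration applies this step to every list. After four iterations there are $16$ lists; the PL curve through each list is a sub-control polygon, and $K_{1,4}$ is their union. Ambient isotopy between $X,Y\subset\mathbb{R}^3$: a continuous $H:\mathbb{R}^3\times[0,1]\to\mathbb{R}^3$ with $H(\cdot,0)=\mathrm{id}$, $H(X,1)=Y$, and each $H(\cdot,t)$ a homeomorphism of $\mathbb{R}^3$ onto $\mathbb{R}^3$. A trefoil knot means a knot ambient isotopic to a standard trefoil; the paper does not specify its handedness (either one is allowed). *)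

theory Defs
  imports "HOL-Analysis.Analysis"
begin

definition bezier :: "'a::real_vector list \<Rightarrow> real \<Rightarrow> 'a" where
  "bezier P t = (\<Sum>i<length P. Bernstein (length P - 1) i t *\<^sub>R (P ! i))"

text \<open>Curves are identified with their images.\<close>

definition bezier_curve :: "'a::real_vector list \<Rightarrow> 'a set" where
  "bezier_curve P = bezier P ` {0..1}"

text \<open>\<open>casteljau Q r k\<close> is the point $Q_k^{(r)}$; it is meaningful for \<open>k + r < length Q\<close>.\<close>

fun casteljau :: "'a::real_vector list \<Rightarrow> nat \<Rightarrow> nat \<Rightarrow> 'a" where
  "casteljau Q 0 k = Q ! k"
| "casteljau Q (Suc r) k = (1 / 2) *\<^sub>R (casteljau Q r k + casteljau Q r (Suc k))"

definition left_half :: "'a::real_vector list \<Rightarrow> 'a list" where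
  "left_half Q = map (\<lambda>r. casteljau Q r 0) [0..<length Q]"

definition right_half :: "'a::real_vector list \<Rightarrow> 'a list" where
  "right_half Q = map (\<lambda>k. casteljau Q (length Q - 1 - k) k) [0..<length Q]"

definition subdivide :: "'a::real_vector list list \<Rightarrow> 'a list list" where
  "subdivide Qs = concat (map (\<lambda>Q. [left_half Q, right_half Q]) Qs)"

definition pl_curve :: "'a::real_vector list \<Rightarrow> 'a set" where
  "pl_curve Q = (\<Union>i\<in>{i. Suc i < length Q}. closed_segment (Q ! i) (Q ! Suc i))"

definition subdivided_polygon :: "'a::real_vector list \<Rightarrow> nat \<Rightarrow> 'a set" where
  "subdivided_polygon P m = (\<Union>Q\<in>set ((subdivide ^^ m) [P]). pl_curve Q)"

definition ambient_isotopic :: "'a::topological_space set \<Rightarrow> 'a set \<Rightarrow> bool" where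
  "ambient_isotopic X Y \<longleftrightarrow>
    (\<exists>H :: 'a \<times> real \<Rightarrow> 'a.
      continuous_on (UNIV \<times> {0..1}) H \<and>
      (\<forall>x. H (x, 0) = x) \<and>
      (\<lambda>x. H (x, 1)) ` X = Y \<and>
      (\<forall>t\<in>{0..1}. \<exists>g. homeomorphism UNIV UNIV (\<lambda>x. H (x, t)) g))"

definition knot :: "(real ^ 3) set \<Rightarrow> bool" where
  "knot K \<longleftrightarrow> (\<exists>\<gamma>. simple_path \<gamma> \<and> pathfinish \<gamma> = pathstart \<gamma> \<and> path_image \<gamma> = K)"

text \<open>The standard trefoil as the $(2,3)$ torus knot on the torus with radii 2 and 1:
  as \<open>t\<close> runs through one period, the curve winds twice around the z-axis and three times
  around the core circle. The sign \<open>s\<close> selects the handedness: \<open>s = 1\<close> and \<open>s = -1\<close> give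
  mirror images in the xy-plane.\<close>

definition standard_trefoil :: "real \<Rightarrow> (real ^ 3) set" where
  "standard_trefoil s =
    (\<lambda>t. vector [(2 + cos (3 * t)) * cos (2 * t),
                 (2 + cos (3 * t)) * sin (2 * t),
                 s * sin (3 * t)]) ` {0..2 * pi}"

definition trefoil_knot :: "(real ^ 3) set \<Rightarrow> bool" where
  "trefoil_knot K \<longleftrightarrow>
    knot K \<and> (\<exists>s\<in>{1, -1}. ambient_isotopic (standard_trefoil s) K)"

definition \<beta>\<^sub>1_control_points :: "(real ^ 3) list" where
  "\<beta>\<^sub>1_control_points =
    [vector [0, 9, 20], vector [-15, -95, -50], vector [40, 80, -20], vector [10, -60, 58],
     vector [-60, 30, 20], vector [40, -60, -60], vector [0, 9, 20]]"

end

theory Submission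
  imports Defs
begin

text \<open>If a map moves the points of a set by a displacement with small Lipschitz constant, McShane's
  extension theorem and Banach's fixed point theorem turn it into an ambient isotopy. Hence a
  straight-line homotopy between two closed curves is realized by an ambient isotopy once it is
  uniformly bi-Lipschitz. Cutting the curves into arcs, this follows from finitely many directions:
  one along which each pair of adjacent arcs is increasing, and one separating each pair of distant
  arcs. For the sixteen subdivided pieces of the Bezier curve both conditions can be read off from
  their control points, so the same directions serve the curve and the polygon. The trefoil is
  deformed to the polygon through four octagons, and all conditions reduce to integer arithmetic;
  the arcs of the trefoil are enclosed by Taylor's theorem.\<close>

section \<open>Ambient isotopies from small displacements\<close>

text \<open>Ambient isotopy relates sets, not parametrized curves. Between two homotopies a shape
  may therefore be cut into arcs anew, and the stages use different numbers of arcs: 24 for the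
  trefoil, 8 between octagons, 16 for the Bezier pieces. The obstacle in every stage is to keep
  different points of the moving closed curve apart uniformly in time. Adjacent arcs share an end
  point, so strict separation by a plane is impossible for them; a direction increasing along both
  arcs takes its place and bounds the distance of points from below by the distance of parameters.
  The octagons are inserted because a straight-line homotopy between dissimilar representatives of a
  knot may run through itself. The trefoil that is reached has handedness s = -1.\<close>

lemma ambient_isotopic_refl: "ambient_isotopic X X"
  unfolding ambient_isotopic_def
proof (intro exI[of _ fst] conjI ballI)
  show "\<exists>g. homeomorphism UNIV UNIV (\<lambda>x. fst (x, t)) g" for t :: real
    by (intro exI[of _ id]) (simp add: homeomorphism_def)
qed (auto intro!: continuous_intros)

lemma ambient_isotopic_trans:
  fixes X Y Z :: "'a::topological_space set"
  assumes "ambient_isotopic X Y" "ambient_isotopic Y Z"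
  shows "ambient_isotopic X Z"
proof -
  obtain H :: "'a \<times> real \<Rightarrow> 'a" where H:
      "continuous_on (UNIV \<times> {0..1}) H" "\<forall>x. H (x, 0) = x"
      "(\<lambda>x. H (x, 1)) ` X = Y" "\<forall>t\<in>{0..1}. \<exists>g. homeomorphism UNIV UNIV (\<lambda>x. H (x, t)) g"
    using assms(1) unfolding ambient_isotopic_def by blast
  obtain G :: "'a \<times> real \<Rightarrow> 'a" where G:
      "continuous_on (UNIV \<times> {0..1}) G" "\<forall>x. G (x, 0) = x"
      "(\<lambda>x. G (x, 1)) ` Y = Z" "\<forall>t\<in>{0..1}. \<exists>g. homeomorphism UNIV UNIV (\<lambda>x. G (x, t)) g"
    using assms(2) unfolding ambient_isotopic_def by blast
  \<comment> \<open>\<open>H\<close> runs during the first half of the time interval and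
    \<open>G\<close> during the second. The clamps \<open>min\<close> and \<open>max\<close> express
    both halves by one formula, so continuity is that of a single composition.\<close>
  define J where "J = (\<lambda>(x, t). G (H (x, min 1 (2 * t)), max 0 (2 * t - 1)))"
  have J: "J (x, t) = G (H (x, min 1 (2 * t)), max 0 (2 * t - 1))" for x t
    by (simp add: J_def)
  have c1: "continuous_on (UNIV \<times> {0..1}) (\<lambda>p. H (fst p, min 1 (2 * snd p)))"
    by (rule continuous_on_compose2[OF H(1)]) (auto intro!: continuous_intros)
  have "continuous_on (UNIV \<times> {0..1}) J"
    unfolding J_def case_prod_unfold
    by (rule continuous_on_compose2[OF G(1)]) (auto intro!: continuous_intros c1)
  moreover have "J (x, 0) = x" for x
    by (simp add: J H(2) G(2))
  moreover have "(\<lambda>x. J (x, 1)) ` X = Z"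
    using H(3) G(3) by (auto simp: J image_image)
  moreover have "\<exists>g. homeomorphism UNIV UNIV (\<lambda>x. J (x, t)) g" if "t \<in> {0..1}" for t
  proof -
    have "min 1 (2 * t) \<in> {0..1}" using that by auto
    then obtain h where h: "homeomorphism UNIV UNIV (\<lambda>x. H (x, min 1 (2 * t))) h"
      using H(4) by blast
    have "max 0 (2 * t - 1) \<in> {0..1}" using that by auto
    then obtain g where g: "homeomorphism UNIV UNIV (\<lambda>x. G (x, max 0 (2 * t - 1))) g"
      using G(4) by blast
    show ?thesis
      using homeomorphism_compose[OF h g] by (auto simp: J o_def)
  qed
  ultimately show ?thesis
    unfolding ambient_isotopic_def by blast
qed

text \<open>The map shrinks distances at most by the factor \<open>1 - L\<close>, so it is injective
  with a Lipschitz inverse. It hits \<open>y\<close> because the map sending \<open>x\<close> to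
  \<open>y - F x\<close> is a contraction, and its fixed point solves
  \<open>x + F x = y\<close>.\<close>

lemma homeomorphism_plus_contraction:
  fixes F :: "'a::banach \<Rightarrow> 'a"
  assumes F: "L-lipschitz_on UNIV F" and "L < 1"
  shows "\<exists>g. homeomorphism UNIV UNIV (\<lambda>x. x + F x) g"
proof -
  have L: "dist (F x) (F y) \<le> L * dist x y" for x y
    using F by (auto simp: lipschitz_on_def)
  have exp: "(1 - L) * dist x y \<le> dist (x + F x) (y + F y)" for x y
  proof -
    have "dist x y \<le> norm ((x + F x) - (y + F y)) + norm (F x - F y)"
      unfolding dist_norm
      using norm_triangle_ineq4[of "(x + F x) - (y + F y)" "F x - F y"] by (simp add: algebra_simps)
    with L[of x y] show ?thesis
      by (simp add: dist_norm algebra_simps)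
  qed
  have "\<exists>x. x + F x = y" for y
  proof -
    have "\<exists>!x\<in>UNIV. y - F x = x"
    proof (rule Banach_fix)
      show "0 \<le> L" using F by (auto simp: lipschitz_on_def)
      show "\<And>x z. dist (y - F x) (y - F z) \<le> L * dist x z"
        using L by (simp add: dist_norm norm_minus_commute)
    qed (use assms complete_UNIV in auto)
    thus ?thesis by (metis diff_add_cancel)
  qed
  then obtain g where g: "\<And>y. g y + F (g y) = y" by metis
  have inj: "x = y" if "x + F x = y + F y" for x y
    using exp[of x y] that \<open>L < 1\<close> by (simp add: mult_le_0_iff)
  have "(1 / (1 - L))-lipschitz_on UNIV g"
  proof (rule lipschitz_onI)
    fix x y
    show "dist (g x) (g y) \<le> 1 / (1 - L) * dist x y"
      using exp[of "g x" "g y"] \<open>L < 1\<close> by (simp add: g field_simps)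
  qed (use \<open>L < 1\<close> in simp)
  hence "continuous_on UNIV g" by (rule lipschitz_on_continuous_on)
  moreover have "continuous_on UNIV (\<lambda>x. x + F x)"
    by (intro continuous_intros lipschitz_on_continuous_on[OF F])
  moreover have "g (x + F x) = x" for x
    by (rule inj) (simp add: g)
  ultimately show ?thesis
    using g unfolding homeomorphism_def by (intro exI[of _ g]) (auto, (metis rangeI)+)
qed

section \<open>Extension of Lipschitz maps\<close>

lemma McShane_extension:
  fixes f :: "'a::metric_space \<Rightarrow> real"
  assumes f: "L-lipschitz_on X f"
  obtains g where "L-lipschitz_on UNIV g" "\<And>x. x \<in> X \<Longrightarrow> g x = f x"
proof (cases "X = {}")
  case True
  have "L-lipschitz_on UNIV (\<lambda>x. 0 :: real)"
    using f by (auto simp: lipschitz_on_def)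
  thus ?thesis using that[of "\<lambda>x. 0"] True by blast
next
  case False
  have L: "f x - f y \<le> L * dist x y" if "x \<in> X" "y \<in> X" for x y
  proof -
    have "dist (f x) (f y) \<le> L * dist x y" using f that by (auto simp: lipschitz_on_def)
    thus "f x - f y \<le> L * dist x y" by (simp add: dist_real_def)
  qed
  have L0: "L \<ge> 0" using f by (simp add: lipschitz_on_def)
  \<comment> \<open>The largest \<open>L\<close>-Lipschitz extension: the lower envelope of the
    cones of slope \<open>L\<close> that stand on the graph of \<open>f\<close>. It is bounded below
    because \<open>f\<close> itself is \<open>L\<close>-Lipschitz.\<close>
  define g where "g = (\<lambda>x. INF y\<in>X. f y + L * dist x y)"
  have bdd: "bdd_below ((\<lambda>y. f y + L * dist x y) ` X)" for x
  proof -
    obtain a where a: "a \<in> X" using False by auto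
    have "f a - L * dist x a \<le> f y + L * dist x y" if "y \<in> X" for y
    proof -
      have "f a - f y \<le> L * dist a y" by (rule L) fact+
      also have "\<dots> \<le> L * (dist x a + dist x y)"
        using L0 by (intro mult_left_mono) (metis dist_triangle3, auto)
      finally show ?thesis by (simp add: algebra_simps)
    qed
    thus ?thesis by (auto simp: bdd_below_def)
  qed
  have 1: "g x \<le> g z + L * dist x z" for x z
  proof -
    have "g x - L * dist x z \<le> g z"
      unfolding g_def
    proof (rule cINF_greatest[OF False])
      fix y assume y: "y \<in> X"
      have "(INF y\<in>X. f y + L * dist x y) \<le> f y + L * dist x y"
        by (rule cINF_lower[OF bdd y])
      also have "\<dots> \<le> f y + L * (dist z y + dist x z)"
        using L0 by (intro add_left_mono mult_left_mono) (metis add.commute dist_triangle, auto)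
      finally show "(INF y\<in>X. f y + L * dist x y) - L * dist x z \<le> f y + L * dist z y"
        by (simp add: algebra_simps)
    qed
    thus ?thesis by simp
  qed
  have "L-lipschitz_on UNIV g"
  proof (rule lipschitz_onI[OF _ L0])
    fix x z
    show "dist (g x) (g z) \<le> L * dist x z"
      using 1[of x z] 1[of z x] by (auto simp: dist_real_def dist_commute abs_le_iff)
  qed
  moreover have "g x = f x" if "x \<in> X" for x
  proof (rule antisym)
    show "g x \<le> f x"
      unfolding g_def using cINF_lower[OF bdd that, of x] by simp
    show "f x \<le> g x"
      unfolding g_def using L[OF that] by (intro cINF_greatest[OF False]) (simp add: algebra_simps)
  qed
  ultimately show ?thesis using that by blast
qed

text \<open>McShane's theorem is applied to each coordinate, and adding the coordinates costs a
  factor equal to the dimension. The loss is harmless: displacements are made small by shortening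
  the steps of the homotopy.\<close>

lemma Lipschitz_extension:
  fixes f :: "'a::metric_space \<Rightarrow> 'b::euclidean_space" and L :: real
  assumes f: "L-lipschitz_on X f"
  obtains g where "(DIM('b) * L)-lipschitz_on UNIV g" "\<And>x. x \<in> X \<Longrightarrow> g x = f x"
proof -
  have lip: "L-lipschitz_on X (\<lambda>x. f x \<bullet> b)" if "b \<in> Basis" for b
  proof (rule lipschitz_onI)
    show "L \<ge> 0" using f by (simp add: lipschitz_on_def)
    fix x y assume "x \<in> X" "y \<in> X"
    hence "norm (f x - f y) \<le> L * dist x y"
      using f by (auto simp: lipschitz_on_def dist_norm)
    thus "dist (f x \<bullet> b) (f y \<bullet> b) \<le> L * dist x y"
      using Basis_le_norm[OF that, of "f x - f y"] by (simp add: dist_real_def inner_diff_left)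
  qed
  have "\<exists>g. L-lipschitz_on UNIV g \<and> (\<forall>x\<in>X. g x = f x \<bullet> b)" if b: "b \<in> Basis" for b
  proof -
    obtain g where "L-lipschitz_on UNIV g" "\<And>x. x \<in> X \<Longrightarrow> g x = f x \<bullet> b"
      by (rule McShane_extension[OF lip[OF b]]) iprover
    thus ?thesis by blast
  qed
  hence "\<forall>b\<in>Basis. \<exists>g. L-lipschitz_on UNIV g \<and> (\<forall>x\<in>X. g x = f x \<bullet> b)"
    by blast
  from bchoice[OF this] obtain g where
      "\<forall>b\<in>Basis. L-lipschitz_on UNIV (g b) \<and> (\<forall>x\<in>X. g b x = f x \<bullet> b)" ..
  hence g: "\<And>b. b \<in> Basis \<Longrightarrow> L-lipschitz_on UNIV (g b)"
      "\<And>b x. b \<in> Basis \<Longrightarrow> x \<in> X \<Longrightarrow> g b x = f x \<bullet> b"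
    by blast+
  define h where "h = (\<lambda>x. \<Sum>b\<in>Basis. g b x *\<^sub>R b)"
  have "(DIM('b) * L)-lipschitz_on UNIV h"
  proof (rule lipschitz_onI)
    show "DIM('b) * L \<ge> 0" using f by (simp add: lipschitz_on_def)
    fix x y
    have "dist (h x) (h y) = norm (\<Sum>b\<in>Basis. (g b x - g b y) *\<^sub>R b)"
      by (simp add: h_def dist_norm sum_subtractf scaleR_diff_left)
    also have "\<dots> \<le> (\<Sum>b\<in>(Basis::'b set). L * dist x y)"
    proof (rule sum_norm_le)
      fix b :: 'b assume "b \<in> Basis"
      thus "norm ((g b x - g b y) *\<^sub>R b) \<le> L * dist x y"
        using g(1)[of b] by (auto simp: lipschitz_on_def dist_real_def)
    qed
    finally show "dist (h x) (h y) \<le> DIM('b) * L * dist x y" by simp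
  qed
  moreover have "h x = f x" if "x \<in> X" for x
    using that by (simp add: h_def g euclidean_representation)
  ultimately show thesis by (rule that[of h])
qed

text \<open>The displacement is known on \<open>X\<close> only. Once it is extended to
  \<open>F\<close>, adding \<open>t\<close> times \<open>F\<close> is a homeomorphism of the whole
  space for each \<open>t\<close> in [0, 1], because the factor \<open>t\<close> keeps the Lipschitz
  constant below 1.\<close>

lemma ambient_isotopic_small_displacement:
  fixes f :: "'a::euclidean_space \<Rightarrow> 'a" and L :: real
  assumes f: "L-lipschitz_on X (\<lambda>x. f x - x)" and L: "DIM('a) * L < 1"
  shows "ambient_isotopic X (f ` X)"
proof -
  obtain F where F: "(DIM('a) * L)-lipschitz_on UNIV F" "\<And>x. x \<in> X \<Longrightarrow> F x = f x - x"
    using Lipschitz_extension[OF f] by metis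
  define H where "H = (\<lambda>(x, t::real). x + t *\<^sub>R F x)"
  have "continuous_on UNIV F" by (rule lipschitz_on_continuous_on[OF F(1)])
  hence "continuous_on (UNIV \<times> {0..1}) H"
    unfolding H_def case_prod_unfold
    by (intro continuous_intros continuous_on_compose2[OF \<open>continuous_on UNIV F\<close> continuous_on_fst]) auto
  moreover have "\<exists>g. homeomorphism UNIV UNIV (\<lambda>x. H (x, t)) g" if t: "t \<in> {0..1}" for t
  proof -
    have "(DIM('a) * L)-lipschitz_on UNIV (\<lambda>x. t *\<^sub>R F x)"
    proof (rule lipschitz_onI)
      show "0 \<le> DIM('a) * L" using F(1) by (simp add: lipschitz_on_def)
      fix x y
      have "dist (t *\<^sub>R F x) (t *\<^sub>R F y) = t * dist (F x) (F y)"
        using t by (simp add: dist_norm flip: scaleR_diff_right)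
      also have "\<dots> \<le> dist (F x) (F y)"
        using t by (intro mult_left_le_one_le) auto
      also have "\<dots> \<le> DIM('a) * L * dist x y"
        using F(1) by (simp add: lipschitz_on_def)
      finally show "dist (t *\<^sub>R F x) (t *\<^sub>R F y) \<le> DIM('a) * L * dist x y" .
    qed
    from homeomorphism_plus_contraction[OF this L] show ?thesis
      by (simp add: H_def)
  qed
  moreover have "H (x, 0) = x" for x by (simp add: H_def)
  moreover have "(\<lambda>x. H (x, 1)) ` X = f ` X"
    by (rule image_cong) (auto simp: H_def F(2))
  ultimately show ?thesis unfolding ambient_isotopic_def by blast
qed

text \<open>The bound lets the homotopy be cut into finitely many steps, each of which displaces the
  intermediate curve by a map with a small Lipschitz constant.\<close>

lemma ambient_isotopic_straight_line:
  fixes \<gamma> \<delta> :: "'t \<Rightarrow> 'a::euclidean_space"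
  assumes C: "\<And>u s t. u \<in> {0..1} \<Longrightarrow> s \<in> T \<Longrightarrow> t \<in> T \<Longrightarrow>
      norm ((\<delta> s - \<gamma> s) - (\<delta> t - \<gamma> t)) \<le>
      C * norm (((1 - u) *\<^sub>R \<gamma> s + u *\<^sub>R \<delta> s) - ((1 - u) *\<^sub>R \<gamma> t + u *\<^sub>R \<delta> t))"
  shows "ambient_isotopic (\<gamma> ` T) (\<delta> ` T)"
proof -
  \<comment> \<open>The maximum with 1 makes the bound positive, so that \<open>N\<close> is
    positive and \<open>B / N\<close> is an admissible Lipschitz constant.\<close>
  define B where "B = max C 1"
  define D where "D = (\<lambda>s. \<delta> s - \<gamma> s)"
  define G where "G = (\<lambda>u s. \<gamma> s + u *\<^sub>R D s)"
  have G_eq: "G u s = (1 - u) *\<^sub>R \<gamma> s + u *\<^sub>R \<delta> s" for u s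
    by (simp add: G_def D_def algebra_simps)
  have B: "norm (D s - D t) \<le> B * norm (G u s - G u t)"
    if "u \<in> {0..1}" "s \<in> T" "t \<in> T" for u s t
  proof -
    have "norm (D s - D t) \<le> C * norm (G u s - G u t)"
      using C[OF that] by (simp add: D_def G_eq)
    also have "\<dots> \<le> B * norm (G u s - G u t)"
      by (intro mult_right_mono) (auto simp: B_def)
    finally show ?thesis .
  qed
  obtain N :: nat where N: "DIM('a) * B < N"
    using reals_Archimedean2 by blast
  have "0 < DIM('a) * B" by (simp add: B_def)
  hence N0: "N > 0" using N by (auto intro: gr0I)
  have step: "ambient_isotopic (G (j / N) ` T) (G (Suc j / N) ` T)" if "j < N" for j
  proof -
    define u where "u = j / N"
    have u: "u \<in> {0..1}" using that by (auto simp: u_def field_simps)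
    \<comment> \<open>A point may have several parameters, as the closing point of a closed curve
      does, and \<open>r\<close> picks one of them. By the bound all of them have the same
      displacement, so \<open>f\<close> does not depend on the choice.\<close>
    define r where "r = inv_into T (G u)"
    have r: "r x \<in> T" "G u (r x) = x" if "x \<in> G u ` T" for x
      using that by (auto simp: r_def inv_into_into f_inv_into_f)
    define f where "f = (\<lambda>x. x + (1 / N) *\<^sub>R D (r x))"
    have "(B / N)-lipschitz_on (G u ` T) (\<lambda>x. f x - x)"
    proof (rule lipschitz_onI)
      show "0 \<le> B / N" by (simp add: B_def)
      fix x y assume xy: "x \<in> G u ` T" "y \<in> G u ` T"
      have "norm (D (r x) - D (r y)) \<le> B * dist x y"
        using B[OF u r(1)[OF xy(1)] r(1)[OF xy(2)]] xy by (simp add: r dist_norm)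
      moreover have "(f x - x) - (f y - y) = (1 / N) *\<^sub>R (D (r x) - D (r y))"
        by (simp add: f_def scaleR_diff_right)
      ultimately show "dist (f x - x) (f y - y) \<le> B / N * dist x y"
        using N0 by (simp add: dist_norm divide_right_mono)
    qed
    moreover have "DIM('a) * (B / N) < 1" using N N0 by simp
    ultimately have "ambient_isotopic (G u ` T) (f ` G u ` T)"
      by (rule ambient_isotopic_small_displacement[where f = f])
    moreover have "f (G u s) = G (Suc j / N) s" if "s \<in> T" for s
    proof -
      have s: "G u s \<in> G u ` T" using that by blast
      have "norm (D (r (G u s)) - D s) \<le> B * norm (G u (r (G u s)) - G u s)"
        by (rule B[OF u r(1)[OF s] that])
      hence "D (r (G u s)) = D s" by (simp add: r(2)[OF s])
      thus ?thesis
        by (simp add: f_def G_def u_def add_divide_distrib algebra_simps)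
    qed
    hence "f ` G u ` T = G (Suc j / N) ` T" by (simp add: image_image)
    ultimately show ?thesis by (simp add: u_def)
  qed
  have "ambient_isotopic (G 0 ` T) (G (j / N) ` T)" if "j \<le> N" for j
    using that
  proof (induction j)
    case 0
    thus ?case by (simp add: ambient_isotopic_refl)
  next
    case (Suc j)
    thus ?case using step[of j] ambient_isotopic_trans by auto
  qed
  from this[of N] show ?thesis
    using N0 by (simp add: G_eq)
qed

section \<open>Guided closed curves\<close>

definition unit_arc :: "nat \<Rightarrow> real set" where
  "unit_arc k = {real k..real k + 1}"

text \<open>A uniform slope \<open>m\<close> instead of mere monotonicity: the displacement between
  two parameters is bounded linearly in their distance, and this has to be dominated by the distance
  of the points.\<close>

definition rises :: "'a::real_inner \<Rightarrow> (real \<Rightarrow> 'a) \<Rightarrow> nat \<Rightarrow> bool" where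
  "rises w \<gamma> k \<longleftrightarrow>
    (\<exists>m>0. \<forall>s\<in>unit_arc k. \<forall>t\<in>unit_arc k. s \<le> t \<longrightarrow> m * (t - s) \<le> w \<bullet> (\<gamma> t - \<gamma> s))"

definition below :: "'a::real_inner \<Rightarrow> (real \<Rightarrow> 'a) \<Rightarrow> nat \<Rightarrow> nat \<Rightarrow> bool" where
  "below w \<gamma> k l \<longleftrightarrow> (\<exists>m>0. \<forall>s\<in>unit_arc k. \<forall>t\<in>unit_arc l. m \<le> w \<bullet> (\<gamma> t - \<gamma> s))"

text \<open>\<open>W k k\<close> has to serve the arcs \<open>k\<close> and \<open>k + 1\<close> simultaneously; this takes care of the pairs of
  adjacent arcs. All conditions are convex in the curve, so they persist along the straight-line
  homotopy between two curves guided by the same \<open>W\<close>.\<close>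

definition guided :: "nat \<Rightarrow> (nat \<Rightarrow> nat \<Rightarrow> 'a::real_inner) \<Rightarrow> (real \<Rightarrow> 'a) \<Rightarrow> bool" where
  "guided n W \<gamma> \<longleftrightarrow> \<gamma> n = \<gamma> 0 \<and>
    (\<forall>k<n. (\<exists>C. C-lipschitz_on (unit_arc k) \<gamma>) \<and>
       rises (W k k) \<gamma> k \<and> rises (W k k) \<gamma> (Suc k mod n)) \<and>
    (\<forall>k l. Suc k < l \<longrightarrow> l < n \<longrightarrow> Suc l \<noteq> k + n \<longrightarrow> below (W k l) \<gamma> k l)"

lemma in_unit_arc:
  assumes "s \<in> {0..real n}" "n > 0"
  obtains k where "k < n" "s \<in> unit_arc k"
proof (cases "s = n")
  case True
  thus ?thesis using assms that[of "n - 1"] by (auto simp: unit_arc_def of_nat_diff)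
next
  case False
  have "real (nat \<lfloor>s\<rfloor>) \<le> s" "s < real (nat \<lfloor>s\<rfloor>) + 1"
    using assms by (auto simp: of_nat_nat)
  moreover have "real (nat \<lfloor>s\<rfloor>) < n"
    using calculation False assms by auto
  ultimately show ?thesis
    by (intro that[of "nat \<lfloor>s\<rfloor>"]) (simp_all only: unit_arc_def atLeastAtMost_iff of_nat_less_iff less_imp_le)
qed

lemma Union_unit_arcs:
  assumes "n > 0"
  shows "(\<Union>k<n. unit_arc k) = {0..real n}"
proof
  show "{0..real n} \<subseteq> (\<Union>k<n. unit_arc k)"
  proof
    fix s assume "s \<in> {0..real n}"
    then obtain k where "k < n" "s \<in> unit_arc k" using in_unit_arc[OF _ assms] by metis
    thus "s \<in> (\<Union>k<n. unit_arc k)" by auto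
  qed
qed (auto simp: unit_arc_def)

text \<open>Here \<open>d\<close> is the distance of the parameters on the circle of length \<open>n\<close> for arcs that are equal or
  adjacent, and \<open>1\<close> for all other pairs.\<close>

definition spread :: "nat \<Rightarrow> (real \<Rightarrow> 'a::real_inner) \<Rightarrow> (real \<Rightarrow> 'a) \<Rightarrow> 'a \<Rightarrow> real \<Rightarrow> real \<Rightarrow> real \<Rightarrow> real \<Rightarrow> real \<Rightarrow> bool" where
  "spread n \<gamma> \<delta> w m C d s t \<longleftrightarrow> 0 \<le> d \<and>
    (d = 0 \<longrightarrow> s = t \<or> s = 0 \<and> t = n \<or> s = n \<and> t = 0) \<and>
    norm ((\<delta> t - \<gamma> t) - (\<delta> s - \<gamma> s)) \<le> C * d \<and>
    (m * d \<le> w \<bullet> (\<gamma> t - \<gamma> s) \<and> m * d \<le> w \<bullet> (\<delta> t - \<delta> s) \<or>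
     m * d \<le> w \<bullet> (\<gamma> s - \<gamma> t) \<and> m * d \<le> w \<bullet> (\<delta> s - \<delta> t))"

lemma spread_commute: "spread n \<gamma> \<delta> w m C d s t \<longleftrightarrow> spread n \<gamma> \<delta> w m C d t s"
  unfolding spread_def norm_minus_commute[of "\<delta> t - \<gamma> t" "\<delta> s - \<gamma> s"] by auto

text \<open>One slope serves both curves, so every convex combination of them rises at that slope
  too.\<close>

lemma guided_rises:
  assumes "guided n W \<gamma>" "guided n W \<delta>" "k < n" "j = k \<or> j = Suc k mod n"
  obtains m where "m > 0"
    "\<And>s t. s \<in> unit_arc j \<Longrightarrow> t \<in> unit_arc j \<Longrightarrow> s \<le> t \<Longrightarrow>
      m * (t - s) \<le> W k k \<bullet> (\<gamma> t - \<gamma> s) \<and> m * (t - s) \<le> W k k \<bullet> (\<delta> t - \<delta> s)"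
proof -
  have "rises (W k k) \<gamma> j" "rises (W k k) \<delta> j"
    using assms by (auto simp: guided_def)
  then obtain m1 m2 where m: "m1 > 0" "m2 > 0"
     "\<forall>s\<in>unit_arc j. \<forall>t\<in>unit_arc j. s \<le> t \<longrightarrow> m1 * (t - s) \<le> W k k \<bullet> (\<gamma> t - \<gamma> s)"
     "\<forall>s\<in>unit_arc j. \<forall>t\<in>unit_arc j. s \<le> t \<longrightarrow> m2 * (t - s) \<le> W k k \<bullet> (\<delta> t - \<delta> s)"
    unfolding rises_def by blast
  show ?thesis
  proof (rule that[of "min m1 m2"])
    fix s t assume st: "s \<in> unit_arc j" "t \<in> unit_arc j" "s \<le> t"
    have "min m1 m2 * (t - s) \<le> m1 * (t - s)" "min m1 m2 * (t - s) \<le> m2 * (t - s)"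
      using st(3) by (auto intro!: mult_right_mono)
    with m(3,4) st show "min m1 m2 * (t - s) \<le> W k k \<bullet> (\<gamma> t - \<gamma> s) \<and>
        min m1 m2 * (t - s) \<le> W k k \<bullet> (\<delta> t - \<delta> s)"
      by (meson order_trans)
  qed (use m in auto)
qed

lemma guided_below:
  assumes "guided n W \<gamma>" "guided n W \<delta>" "Suc k < l" "l < n" "Suc l \<noteq> k + n"
  obtains m where "m > 0"
    "\<And>s t. s \<in> unit_arc k \<Longrightarrow> t \<in> unit_arc l \<Longrightarrow>
      m \<le> W k l \<bullet> (\<gamma> t - \<gamma> s) \<and> m \<le> W k l \<bullet> (\<delta> t - \<delta> s)"
proof -
  have "below (W k l) \<gamma> k l" "below (W k l) \<delta> k l"
    using assms by (auto simp: guided_def)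
  then obtain m1 m2 where m: "m1 > 0" "m2 > 0"
     "\<forall>s\<in>unit_arc k. \<forall>t\<in>unit_arc l. m1 \<le> W k l \<bullet> (\<gamma> t - \<gamma> s)"
     "\<forall>s\<in>unit_arc k. \<forall>t\<in>unit_arc l. m2 \<le> W k l \<bullet> (\<delta> t - \<delta> s)"
    unfolding below_def by blast
  show ?thesis
    using m by (intro that[of "min m1 m2"]) (auto simp: min.coboundedI1 min.coboundedI2)
qed

lemma guided_lipschitz:
  assumes "guided n W \<gamma>" "guided n W \<delta>" "k < n"
  obtains C where "C \<ge> 0"
    "\<And>s t. s \<in> unit_arc k \<Longrightarrow> t \<in> unit_arc k \<Longrightarrow>
      norm ((\<delta> t - \<gamma> t) - (\<delta> s - \<gamma> s)) \<le> C * \<bar>t - s\<bar>"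
proof -
  obtain A B where AB: "A-lipschitz_on (unit_arc k) \<gamma>" "B-lipschitz_on (unit_arc k) \<delta>"
    using assms unfolding guided_def by blast
  show ?thesis
  proof (rule that[of "A + B"])
    show "A + B \<ge> 0" using AB by (simp add: lipschitz_on_def)
    fix s t assume st: "s \<in> unit_arc k" "t \<in> unit_arc k"
    have "norm ((\<delta> t - \<gamma> t) - (\<delta> s - \<gamma> s)) = norm ((\<delta> t - \<delta> s) - (\<gamma> t - \<gamma> s))"
      by (simp add: algebra_simps)
    also have "\<dots> \<le> norm (\<delta> t - \<delta> s) + norm (\<gamma> t - \<gamma> s)"
      by (rule norm_triangle_ineq4)
    also have "\<dots> \<le> B * \<bar>t - s\<bar> + A * \<bar>t - s\<bar>"
      using AB st by (intro add_mono) (auto simp: lipschitz_on_def dist_norm)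
    finally show "norm ((\<delta> t - \<gamma> t) - (\<delta> s - \<gamma> s)) \<le> (A + B) * \<bar>t - s\<bar>"
      by (simp add: algebra_simps)
  qed
qed

text \<open>The parameters are compared through the common end point of the two arcs, which is \<open>p\<close> in arc
  \<open>k\<close> and \<open>q\<close> in arc \<open>l\<close>; these differ when \<open>l = n - 1\<close> and \<open>k = 0\<close>.\<close>

lemma guided_adjacent:
  assumes g: "guided n W \<gamma>" "guided n W \<delta>" and l: "l < n" "k = Suc l mod n"
  shows "\<exists>w m C. m > 0 \<and> C \<ge> 0 \<and> (\<forall>s\<in>unit_arc k. \<forall>t\<in>unit_arc l. \<exists>d. spread n \<gamma> \<delta> w m C d s t)"
proof -
  have k: "k < n" using l by simp
  obtain m1 where m1: "m1 > 0" "\<And>s t. s \<in> unit_arc l \<Longrightarrow> t \<in> unit_arc l \<Longrightarrow> s \<le> t \<Longrightarrow>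
      m1 * (t - s) \<le> W l l \<bullet> (\<gamma> t - \<gamma> s) \<and> m1 * (t - s) \<le> W l l \<bullet> (\<delta> t - \<delta> s)"
    using guided_rises[OF g l(1), of l] by auto
  obtain m2 where m2: "m2 > 0" "\<And>s t. s \<in> unit_arc k \<Longrightarrow> t \<in> unit_arc k \<Longrightarrow> s \<le> t \<Longrightarrow>
      m2 * (t - s) \<le> W l l \<bullet> (\<gamma> t - \<gamma> s) \<and> m2 * (t - s) \<le> W l l \<bullet> (\<delta> t - \<delta> s)"
    using guided_rises[OF g l(1), of k] l(2) by auto
  obtain C1 where C1: "C1 \<ge> 0" "\<And>s t. s \<in> unit_arc l \<Longrightarrow> t \<in> unit_arc l \<Longrightarrow>
      norm ((\<delta> t - \<gamma> t) - (\<delta> s - \<gamma> s)) \<le> C1 * \<bar>t - s\<bar>"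
    using guided_lipschitz[OF g l(1)] by auto
  obtain C2 where C2: "C2 \<ge> 0" "\<And>s t. s \<in> unit_arc k \<Longrightarrow> t \<in> unit_arc k \<Longrightarrow>
      norm ((\<delta> t - \<gamma> t) - (\<delta> s - \<gamma> s)) \<le> C2 * \<bar>t - s\<bar>"
    using guided_lipschitz[OF g k] by auto
  define p q where "p = real k" and "q = real l + 1"
  have pq: "p = q \<or> p = 0 \<and> q = n"
  proof (cases "Suc l = n")
    case True
    thus ?thesis using l by (auto simp: p_def q_def)
  next
    case False
    hence "Suc l < n" using l by simp
    thus ?thesis using l by (auto simp: p_def q_def)
  qed
  have eq: "\<gamma> p = \<gamma> q" "\<delta> p = \<delta> q"
    using pq g by (auto simp: guided_def)
  \<comment> \<open>Arc \<open>l\<close> precedes arc \<open>k\<close>, so \<open>W l l\<close>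
    increases from \<open>t\<close> to the common end point and from there to \<open>s\<close>. The
    two increments add up, and the second disjunct of \<open>spread\<close> results.\<close>
  have "spread n \<gamma> \<delta> (W l l) (min m1 m2) (max C1 C2) ((s - p) + (q - t)) s t"
    if s: "s \<in> unit_arc k" and t: "t \<in> unit_arc l" for s t
  proof -
    have s': "p \<le> s" "p \<in> unit_arc k" and t': "t \<le> q" "q \<in> unit_arc l"
      using s t by (auto simp: unit_arc_def p_def q_def)
    have "(\<delta> t - \<gamma> t) - (\<delta> s - \<gamma> s) =
        ((\<delta> t - \<gamma> t) - (\<delta> q - \<gamma> q)) + ((\<delta> p - \<gamma> p) - (\<delta> s - \<gamma> s))"
      by (simp add: eq)
    also have "norm \<dots> \<le>
        norm ((\<delta> t - \<gamma> t) - (\<delta> q - \<gamma> q)) + norm ((\<delta> p - \<gamma> p) - (\<delta> s - \<gamma> s))"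
      by (rule norm_triangle_ineq)
    also have "\<dots> \<le> C1 * (q - t) + C2 * (s - p)"
      using C1(2)[OF t'(2) t] C2(2)[OF s s'(2)] s' t' by (intro add_mono) auto
    also have "\<dots> \<le> max C1 C2 * (q - t) + max C1 C2 * (s - p)"
      using s' t' by (intro add_mono mult_right_mono) auto
    finally have 1: "norm ((\<delta> t - \<gamma> t) - (\<delta> s - \<gamma> s)) \<le> max C1 C2 * ((s - p) + (q - t))"
      by (simp add: algebra_simps)
    have "min m1 m2 * ((s - p) + (q - t)) \<le> m2 * (s - p) + m1 * (q - t)"
      using s' t' by (simp add: distrib_left add_mono mult_right_mono)
    moreover have "W l l \<bullet> (\<gamma> s - \<gamma> t) = W l l \<bullet> (\<gamma> s - \<gamma> p) + W l l \<bullet> (\<gamma> q - \<gamma> t)"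
        "W l l \<bullet> (\<delta> s - \<delta> t) = W l l \<bullet> (\<delta> s - \<delta> p) + W l l \<bullet> (\<delta> q - \<delta> t)"
      by (simp_all add: eq inner_diff_right)
    ultimately have 2: "min m1 m2 * ((s - p) + (q - t)) \<le> W l l \<bullet> (\<gamma> s - \<gamma> t)"
        "min m1 m2 * ((s - p) + (q - t)) \<le> W l l \<bullet> (\<delta> s - \<delta> t)"
      using m1(2)[OF t t'(2,1)] m2(2)[OF s'(2) s s'(1)] by linarith+
    have "s = t \<or> s = 0 \<and> t = n" if "(s - p) + (q - t) = 0"
    proof -
      have "s = p" "t = q" using that s'(1) t'(1) by linarith+
      thus ?thesis using pq by blast
    qed
    thus ?thesis
      using 1 2 s'(1) t'(1) unfolding spread_def by (intro conjI disjI2) auto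
  qed
  thus ?thesis
    using m1(1) m2(1) C1(1) C2(1) by (intro exI[of _ "W l l"] exI[of _ "min m1 m2"] exI[of _ "max C1 C2"]) auto
qed

text \<open>The gap between distant arcs is bounded below and their relative displacement is bounded
  above, so the constant \<open>d = 1\<close> suffices. The upper bound passes through the initial
  points of the two arcs.\<close>

lemma guided_far:
  assumes g: "guided n W \<gamma>" "guided n W \<delta>" and kl: "Suc k < l" "l < n" "Suc l \<noteq> k + n"
  shows "\<exists>w m C. m > 0 \<and> C \<ge> 0 \<and> (\<forall>s\<in>unit_arc k. \<forall>t\<in>unit_arc l. \<exists>d. spread n \<gamma> \<delta> w m C d s t)"
proof -
  have k: "k < n" using kl by simp
  obtain m where m: "m > 0" "\<And>s t. s \<in> unit_arc k \<Longrightarrow> t \<in> unit_arc l \<Longrightarrow>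
      m \<le> W k l \<bullet> (\<gamma> t - \<gamma> s) \<and> m \<le> W k l \<bullet> (\<delta> t - \<delta> s)"
    using guided_below[OF g kl] by auto
  obtain C1 where C1: "C1 \<ge> 0" "\<And>s t. s \<in> unit_arc l \<Longrightarrow> t \<in> unit_arc l \<Longrightarrow>
      norm ((\<delta> t - \<gamma> t) - (\<delta> s - \<gamma> s)) \<le> C1 * \<bar>t - s\<bar>"
    using guided_lipschitz[OF g kl(2)] by auto
  obtain C2 where C2: "C2 \<ge> 0" "\<And>s t. s \<in> unit_arc k \<Longrightarrow> t \<in> unit_arc k \<Longrightarrow>
      norm ((\<delta> t - \<gamma> t) - (\<delta> s - \<gamma> s)) \<le> C2 * \<bar>t - s\<bar>"
    using guided_lipschitz[OF g k] by auto
  define C where "C = C1 + norm ((\<delta> l - \<gamma> l) - (\<delta> k - \<gamma> k)) + C2"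
  have "spread n \<gamma> \<delta> (W k l) m C 1 s t" if s: "s \<in> unit_arc k" and t: "t \<in> unit_arc l" for s t
  proof -
    have arc: "real k \<in> unit_arc k" "real l \<in> unit_arc l" "\<bar>real k - s\<bar> \<le> 1" "\<bar>t - real l\<bar> \<le> 1"
      using s t by (auto simp: unit_arc_def)
    have "(\<delta> t - \<gamma> t) - (\<delta> s - \<gamma> s) = ((\<delta> t - \<gamma> t) - (\<delta> l - \<gamma> l)) +
        ((\<delta> l - \<gamma> l) - (\<delta> k - \<gamma> k)) + ((\<delta> k - \<gamma> k) - (\<delta> s - \<gamma> s))"
      by simp
    also have "norm \<dots> \<le> norm ((\<delta> t - \<gamma> t) - (\<delta> l - \<gamma> l)) +
        norm ((\<delta> l - \<gamma> l) - (\<delta> k - \<gamma> k)) + norm ((\<delta> k - \<gamma> k) - (\<delta> s - \<gamma> s))"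
      by (meson norm_add_rule_thm norm_triangle_ineq order_trans add_right_mono)
    also have "\<dots> \<le> C1 * \<bar>t - l\<bar> + norm ((\<delta> l - \<gamma> l) - (\<delta> k - \<gamma> k)) + C2 * \<bar>k - s\<bar>"
      using C1(2)[OF arc(2) t] C2(2)[OF s arc(1)] by (intro add_mono order_refl)
    also have "\<dots> \<le> C"
      unfolding C_def using arc C1(1) C2(1) by (intro add_mono order_refl mult_left_le) auto
    finally show ?thesis
      using m(2)[OF s t] by (auto simp: spread_def)
  qed
  moreover have "C \<ge> 0" by (simp add: C_def C1(1) C2(1))
  ultimately show ?thesis
    using m(1) by blast
qed

lemma guided_equal:
  assumes g: "guided n W \<gamma>" "guided n W \<delta>" and k: "k < n"
  shows "\<exists>w m C. m > 0 \<and> C \<ge> 0 \<and> (\<forall>s\<in>unit_arc k. \<forall>t\<in>unit_arc k. \<exists>d. spread n \<gamma> \<delta> w m C d s t)"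
proof -
  obtain m where m: "m > 0" "\<And>s t. s \<in> unit_arc k \<Longrightarrow> t \<in> unit_arc k \<Longrightarrow> s \<le> t \<Longrightarrow>
      m * (t - s) \<le> W k k \<bullet> (\<gamma> t - \<gamma> s) \<and> m * (t - s) \<le> W k k \<bullet> (\<delta> t - \<delta> s)"
    using guided_rises[OF g k, of k] by auto
  obtain C where C: "C \<ge> 0" "\<And>s t. s \<in> unit_arc k \<Longrightarrow> t \<in> unit_arc k \<Longrightarrow>
      norm ((\<delta> t - \<gamma> t) - (\<delta> s - \<gamma> s)) \<le> C * \<bar>t - s\<bar>"
    using guided_lipschitz[OF g k] by auto
  have "spread n \<gamma> \<delta> (W k k) m C \<bar>t - s\<bar> s t" if "s \<in> unit_arc k" "t \<in> unit_arc k" for s t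
    using m(2)[OF that] m(2)[OF that(2,1)] C(2)[OF that] unfolding spread_def by (cases "s \<le> t") auto
  thus ?thesis using m(1) C(1) by blast
qed

lemma guided_spread:
  assumes g: "guided n W \<gamma>" "guided n W \<delta>" and kl: "k < n" "l < n"
  shows "\<exists>w m C. m > 0 \<and> C \<ge> 0 \<and> (\<forall>s\<in>unit_arc k. \<forall>t\<in>unit_arc l. \<exists>d. spread n \<gamma> \<delta> w m C d s t)"
    (is "?P k l")
proof -
  have comm: "?P i j" if "?P j i" for i j
    using that by (subst spread_commute) blast
  have le: "?P i j" if ij: "i \<le> j" "j < n" for i j
  proof -
    consider "i = j" | "j = Suc i" | "Suc j = i + n" | "Suc i < j" "Suc j \<noteq> i + n"
      using ij by linarith
    thus ?thesis
    proof cases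
      case 1
      thus ?thesis using guided_equal[OF g] ij by simp
    next
      case 2
      hence "j = Suc i mod n" using ij by simp
      moreover have "i < n" using ij by simp
      ultimately have "?P j i" by (intro guided_adjacent[OF g])
      thus ?thesis by (rule comm)
    next
      case 3
      \<comment> \<open>This case forces \<open>i = 0\<close> and \<open>j = n - 1\<close>: the last
        arc runs into the first.\<close>
      hence "i = Suc j mod n" using ij by simp
      thus ?thesis using guided_adjacent[OF g ij(2)] by blast
    next
      case 4
      thus ?thesis using guided_far[OF g] ij by blast
    qed
  qed
  show ?thesis
  proof (cases "k \<le> l")
    case True
    thus ?thesis using kl(2) by (rule le)
  next
    case False
    hence "?P l k" using le[of l k] kl(1) by simp
    thus ?thesis by (rule comm)
  qed
qed

text \<open>For a pair of arcs the displacement is at most \<open>C * d\<close>, while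
  Cauchy-Schwarz bounds the distance of the moving points below by \<open>m * d / norm w\<close>.
  The quotient is a constant independent of time, and finitely many pairs of arcs give a common one,
  the sum \<open>A\<close>.\<close>

theorem guided_ambient_isotopic:
  fixes \<gamma> \<delta> :: "real \<Rightarrow> 'a::euclidean_space"
  assumes g: "guided n W \<gamma>" "guided n W \<delta>" and n: "n > 0"
  shows "ambient_isotopic (\<gamma> ` {0..real n}) (\<delta> ` {0..real n})"
proof -
  define G where "G = (\<lambda>u t. (1 - u) *\<^sub>R \<gamma> t + u *\<^sub>R \<delta> t)"
  define D where "D = (\<lambda>t. \<delta> t - \<gamma> t)"
  have "\<exists>B. \<forall>u\<in>{0..1}. \<forall>s\<in>unit_arc k. \<forall>t\<in>unit_arc l. norm (D s - D t) \<le> B * norm (G u s - G u t)"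
    if kl: "k < n" "l < n" for k l
  proof -
    obtain w m C where wmC: "m > 0" "C \<ge> 0"
        "\<And>s t. s \<in> unit_arc k \<Longrightarrow> t \<in> unit_arc l \<Longrightarrow> \<exists>d. spread n \<gamma> \<delta> w m C d s t"
      using guided_spread[OF g kl] by blast
    have "norm (D s - D t) \<le> C / m * norm w * norm (G u s - G u t)"
      if u: "u \<in> {0..1}" and st: "s \<in> unit_arc k" "t \<in> unit_arc l" for u s t
    proof -
      obtain d where d: "spread n \<gamma> \<delta> w m C d s t" using wmC(3)[OF st] by blast
      \<comment> \<open>The bounds for the two curves have the same sign by the definition of
        \<open>spread\<close>; opposite signs could cancel in the convex combination.\<close>
      have conv: "m * d \<le> (1 - u) * a + u * b" if "m * d \<le> a" "m * d \<le> b" for a b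
      proof -
        have "m * d = (1 - u) * (m * d) + u * (m * d)" by (simp add: algebra_simps)
        also have "\<dots> \<le> (1 - u) * a + u * b"
          using u that by (intro add_mono mult_left_mono) auto
        finally show ?thesis .
      qed
      have "m * d \<le> \<bar>w \<bullet> (G u s - G u t)\<bar>"
      proof -
        have "w \<bullet> (G u s - G u t) = (1 - u) * (w \<bullet> (\<gamma> s - \<gamma> t)) + u * (w \<bullet> (\<delta> s - \<delta> t))"
             "w \<bullet> (G u s - G u t) = - ((1 - u) * (w \<bullet> (\<gamma> t - \<gamma> s)) + u * (w \<bullet> (\<delta> t - \<delta> s)))"
          by (simp_all add: G_def inner_simps algebra_simps)
        moreover have "m * d \<le> (1 - u) * (w \<bullet> (\<gamma> s - \<gamma> t)) + u * (w \<bullet> (\<delta> s - \<delta> t)) \<or>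
            m * d \<le> (1 - u) * (w \<bullet> (\<gamma> t - \<gamma> s)) + u * (w \<bullet> (\<delta> t - \<delta> s))"
          using d conv unfolding spread_def by blast
        ultimately show ?thesis by linarith
      qed
      also have "\<dots> \<le> norm w * norm (G u s - G u t)" by (rule Cauchy_Schwarz_ineq2)
      finally have *: "d \<le> norm w * norm (G u s - G u t) / m"
        using wmC(1) by (simp add: field_simps)
      have "norm (D s - D t) \<le> C * d"
        using d by (simp add: spread_def D_def norm_minus_commute)
      also have "\<dots> \<le> C * (norm w * norm (G u s - G u t) / m)"
        by (rule mult_left_mono[OF * wmC(2)])
      finally show ?thesis by simp
    qed
    thus ?thesis by blast
  qed
  hence "\<exists>B. \<forall>k<n. \<forall>l<n. \<forall>u\<in>{0..1}. \<forall>s\<in>unit_arc k. \<forall>t\<in>unit_arc l.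
      norm (D s - D t) \<le> B k l * norm (G u s - G u t)"
    by metis
  then obtain B where B: "\<And>k l u s t. k < n \<Longrightarrow> l < n \<Longrightarrow> u \<in> {0..1} \<Longrightarrow> s \<in> unit_arc k \<Longrightarrow>
      t \<in> unit_arc l \<Longrightarrow> norm (D s - D t) \<le> B k l * norm (G u s - G u t)"
    by blast
  define A where "A = (\<Sum>k<n. \<Sum>l<n. \<bar>B k l\<bar>)"
  have BA: "B k l \<le> A" if "k < n" "l < n" for k l
  proof -
    have "B k l \<le> \<bar>B k l\<bar>" by simp
    also have "\<dots> \<le> (\<Sum>l<n. \<bar>B k l\<bar>)"
      using that by (intro member_le_sum) auto
    also have "\<dots> \<le> A"
      unfolding A_def using that by (intro member_le_sum[of k _ "\<lambda>k. \<Sum>l<n. \<bar>B k l\<bar>"]) (auto intro: sum_nonneg)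
    finally show ?thesis .
  qed
  show ?thesis
  proof (rule ambient_isotopic_straight_line[where C = A])
    fix u s t assume u: "u \<in> {0..1::real}" and st: "s \<in> {0..real n}" "t \<in> {0..real n}"
    obtain k l where kl: "k < n" "s \<in> unit_arc k" "l < n" "t \<in> unit_arc l"
      using in_unit_arc[OF st(1) n] in_unit_arc[OF st(2) n] by metis
    have "norm (D s - D t) \<le> B k l * norm (G u s - G u t)"
      using B u kl by blast
    also have "\<dots> \<le> A * norm (G u s - G u t)"
      using BA kl by (intro mult_right_mono) auto
    finally show "norm ((\<delta> s - \<gamma> s) - (\<delta> t - \<gamma> t)) \<le>
        A * norm (((1 - u) *\<^sub>R \<gamma> s + u *\<^sub>R \<delta> s) - ((1 - u) *\<^sub>R \<gamma> t + u *\<^sub>R \<delta> t))"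
      by (simp add: D_def G_def)
  qed
qed

lemma guided_continuous_on:
  assumes g: "guided n W \<gamma>" and n: "n > 0"
  shows "continuous_on {0..real n} \<gamma>"
proof -
  have "continuous_on (\<Union>k\<in>{..<n}. unit_arc k) \<gamma>"
  proof (rule continuous_on_closed_Union)
    fix k assume "k \<in> {..<n}"
    then obtain C where "C-lipschitz_on (unit_arc k) \<gamma>"
      using g unfolding guided_def by blast
    thus "continuous_on (unit_arc k) \<gamma>" by (rule lipschitz_on_continuous_on)
  qed (auto simp: unit_arc_def)
  thus ?thesis by (simp add: Union_unit_arcs[OF n])
qed

text \<open>With the second curve equal to the first, the estimates for pairs of arcs express
  injectivity: a double point forces \<open>d = 0\<close>, which leaves only equal parameters and
  the two ends of the parameter interval.\<close>

theorem guided_knot: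
  assumes g: "guided n W \<gamma>" and n: "n > 0"
  shows "knot (\<gamma> ` {0..real n})"
proof -
  have inj: "s = t \<or> s = 0 \<and> t = n \<or> s = n \<and> t = 0"
    if st: "s \<in> {0..real n}" "t \<in> {0..real n}" "\<gamma> s = \<gamma> t" for s t
  proof -
    obtain k l where kl: "k < n" "s \<in> unit_arc k" "l < n" "t \<in> unit_arc l"
      using in_unit_arc[OF st(1) n] in_unit_arc[OF st(2) n] by metis
    obtain w m C d where "m > 0" "spread n \<gamma> \<gamma> w m C d s t"
      using guided_spread[OF g g kl(1,3)] kl by blast
    moreover from this have "d = 0"
      using st(3) by (auto simp: spread_def mult_le_0_iff)
    ultimately show ?thesis by (simp add: spread_def)
  qed
  define h where "h = (\<lambda>x. \<gamma> (real n * x))"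
  have sub: "real n * x \<in> {0..real n}" if "x \<in> {0..1}" for x
    using that n by (auto simp: mult_left_le)
  have "continuous_on {0..1} h"
    unfolding h_def
    by (rule continuous_on_compose2[OF guided_continuous_on[OF g n]]) (use sub in \<open>auto intro!: continuous_intros\<close>)
  moreover have "loop_free h"
    unfolding loop_free_def h_def
    using inj[OF sub sub] n by fastforce
  moreover have "pathfinish h = pathstart h"
    using g by (simp add: h_def pathfinish_def pathstart_def guided_def)
  moreover have "path_image h = \<gamma> ` {0..real n}"
  proof -
    have "(\<lambda>x. real n * x) ` {0..1} = {0..real n}"
      using n image_mult_atLeastAtMost[of "real n" 0 1] by simp
    thus ?thesis
      unfolding path_image_def h_def by (metis image_image)
  qed
  ultimately show ?thesis
    unfolding knot_def simple_path_def path_def by blast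
qed

section \<open>Curves with control points\<close>

text \<open>The minimum makes the end point \<open>n\<close> belong to the last piece.\<close>

definition pieces :: "nat \<Rightarrow> (nat \<Rightarrow> real \<Rightarrow> 'a) \<Rightarrow> real \<Rightarrow> 'a" where
  "pieces n f t = (let k = min (nat \<lfloor>t\<rfloor>) (n - 1) in f k (t - real k))"

definition joined :: "nat \<Rightarrow> (nat \<Rightarrow> real \<Rightarrow> 'a) \<Rightarrow> bool" where
  "joined n f \<longleftrightarrow> (\<forall>k. Suc k < n \<longrightarrow> f k 1 = f (Suc k) 0)"

lemma pieces_eq:
  assumes "joined n f" "k < n" "t \<in> unit_arc k"
  shows "pieces n f t = f k (t - k)"
proof (cases "t = real k + 1")
  case True
  hence fl: "nat \<lfloor>t\<rfloor> = Suc k" by (simp add: nat_eq_iff2)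
  show ?thesis
  proof (cases "Suc k < n")
    case True
    hence "min (nat \<lfloor>t\<rfloor>) (n - 1) = Suc k" using fl by simp
    thus ?thesis
      using assms(1) True \<open>t = real k + 1\<close> by (simp add: pieces_def joined_def)
  next
    case False
    hence "min (nat \<lfloor>t\<rfloor>) (n - 1) = k" using fl assms(2) by simp
    thus ?thesis by (simp add: pieces_def)
  qed
next
  case False
  hence "\<lfloor>t\<rfloor> = int k"
    using assms(3) by (simp add: unit_arc_def floor_eq_iff)
  hence "min (nat \<lfloor>t\<rfloor>) (n - 1) = k" using assms(2) by simp
  thus ?thesis by (simp add: pieces_def)
qed

lemma unit_arc_shift: "(\<lambda>t. t - real k) ` unit_arc k = {0..1}"
  by (simp add: unit_arc_def image_diff_atLeastAtMost)

lemma pieces_image: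
  assumes "joined n f" "n > 0"
  shows "pieces n f ` {0..real n} = (\<Union>k<n. f k ` {0..1})"
proof -
  have "pieces n f ` unit_arc k = f k ` {0..1}" if "k < n" for k
  proof -
    have "pieces n f ` unit_arc k = f k ` (\<lambda>t. t - real k) ` unit_arc k"
      unfolding image_image by (rule image_cong[OF refl pieces_eq[OF assms(1) that]])
    thus ?thesis by (simp add: unit_arc_shift)
  qed
  thus ?thesis
    unfolding Union_unit_arcs[OF assms(2), symmetric] by (simp add: image_UN)
qed

text \<open>The interface between an arc and its control points: what \<open>guided\<close> asks of
  an arc, read off from a finite list. Bezier arcs and polygonal arcs over the same \<open>Q\<close>
  both satisfy it, hence share their directions. In the last clause the arc inherits monotonicity
  along \<open>w\<close> from its control points, with a uniform slope.\<close>

definition controlled :: "'a::real_inner list \<Rightarrow> (real \<Rightarrow> 'a) \<Rightarrow> bool" where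
  "controlled Q f \<longleftrightarrow> f 0 = hd Q \<and> f 1 = last Q \<and> f ` {0..1} \<subseteq> convex hull (set Q) \<and>
    (\<exists>C. C-lipschitz_on {0..1} f) \<and>
    (\<forall>w. (\<forall>i. Suc i < length Q \<longrightarrow> 0 < w \<bullet> (Q ! Suc i - Q ! i)) \<longrightarrow>
      (\<exists>m>0. \<forall>x y. 0 \<le> x \<longrightarrow> x \<le> y \<longrightarrow> y \<le> 1 \<longrightarrow> m * (y - x) \<le> w \<bullet> (f y - f x)))"

text \<open>Finitely many positive differences have a positive minimum \<open>m\<close>. Half-spaces
  are convex, so the bound passes to the hulls, first for \<open>A\<close> with a point of
  \<open>B\<close> fixed and then for \<open>B\<close>.\<close>

lemma separated_hulls:
  fixes w :: "'a::real_inner"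
  assumes "finite A" "finite B" "A \<noteq> {}" "B \<noteq> {}" and pos: "\<And>a b. a \<in> A \<Longrightarrow> b \<in> B \<Longrightarrow> w \<bullet> a < w \<bullet> b"
  obtains m where "m > 0" "\<And>x y. x \<in> convex hull A \<Longrightarrow> y \<in> convex hull B \<Longrightarrow> m \<le> w \<bullet> (y - x)"
proof -
  define m where "m = Min ((\<lambda>(a, b). w \<bullet> b - w \<bullet> a) ` (A \<times> B))"
  have "m > 0"
    unfolding m_def using assms by (subst Min_gr_iff) auto
  have m: "m \<le> w \<bullet> b - w \<bullet> a" if "a \<in> A" "b \<in> B" for a b
    unfolding m_def using that assms by (intro Min_le) auto
  have hullA: "w \<bullet> x \<le> w \<bullet> b - m" if "x \<in> convex hull A" "b \<in> B" for x b
  proof -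
    have "convex hull A \<subseteq> {x. w \<bullet> x \<le> w \<bullet> b - m}"
      using m[OF _ that(2)] by (intro hull_minimal convex_halfspace_le) (auto simp: algebra_simps)
    thus ?thesis using that(1) by auto
  qed
  have "m \<le> w \<bullet> (y - x)" if "x \<in> convex hull A" "y \<in> convex hull B" for x y
  proof -
    have "convex hull B \<subseteq> {y. w \<bullet> y \<ge> w \<bullet> x + m}"
      using hullA[OF that(1)] by (intro hull_minimal convex_halfspace_ge) (auto simp: algebra_simps)
    thus ?thesis using that(2) by (auto simp: inner_diff_right)
  qed
  thus ?thesis using that \<open>m > 0\<close> by blast
qed

lemma controlled_guided:
  fixes f :: "nat \<Rightarrow> real \<Rightarrow> 'a::real_inner"
  assumes f: "\<And>k. k < n \<Longrightarrow> controlled (Q k) (f k)" and n: "n > 0"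
    and ne: "\<And>k. k < n \<Longrightarrow> Q k \<noteq> []"
    and join: "\<And>k. k < n \<Longrightarrow> last (Q k) = hd (Q (Suc k mod n))"
    and adj: "\<And>k j i. k < n \<Longrightarrow> j = k \<or> j = Suc k mod n \<Longrightarrow> Suc i < length (Q j) \<Longrightarrow>
      0 < W k k \<bullet> (Q j ! Suc i - Q j ! i)"
    and far: "\<And>k l a b. Suc k < l \<Longrightarrow> l < n \<Longrightarrow> Suc l \<noteq> k + n \<Longrightarrow> a \<in> set (Q k) \<Longrightarrow> b \<in> set (Q l) \<Longrightarrow>
      W k l \<bullet> a < W k l \<bullet> b"
  shows "guided n W (pieces n f) \<and> joined n f"
proof -
  have ends: "f k 0 = hd (Q k)" "f k 1 = last (Q k)" if "k < n" for k
    using f[OF that] by (auto simp: controlled_def)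
  have J: "joined n f"
    unfolding joined_def using ends join by (metis Suc_lessD mod_less)
  have eq: "pieces n f t = f k (t - k)" if "k < n" "t \<in> unit_arc k" for k t
    by (rule pieces_eq[OF J that])
  have arc: "t - k \<in> {0..1}" if "t \<in> unit_arc k" for t k
    using that by (auto simp: unit_arc_def)
  have "guided n W (pieces n f)"
    unfolding guided_def
  proof (intro conjI allI impI)
    have "pieces n f (real n) = f (n - 1) 1"
      using n eq[of "n - 1" "real n"] by (simp add: unit_arc_def of_nat_diff)
    also have "\<dots> = f 0 0"
      using n ends join[of "n - 1"] by simp
    also have "\<dots> = pieces n f 0"
      using n eq[of 0 0] by (simp add: unit_arc_def)
    finally show "pieces n f (real n) = pieces n f 0" .
  next
    fix k assume k: "k < n"
    obtain C where C: "C-lipschitz_on {0..1} (f k)"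
      using f[OF k] by (auto simp: controlled_def)
    have "C-lipschitz_on (unit_arc k) (pieces n f)"
    proof (rule lipschitz_onI)
      show "0 \<le> C" using C by (simp add: lipschitz_on_def)
      fix s t assume st: "s \<in> unit_arc k" "t \<in> unit_arc k"
      have "dist (f k (s - k)) (f k (t - k)) \<le> C * dist (s - k) (t - k)"
        using C arc st unfolding lipschitz_on_def by blast
      thus "dist (pieces n f s) (pieces n f t) \<le> C * dist s t"
        using st by (simp add: eq[OF k] dist_real_def)
    qed
    thus "\<exists>C. C-lipschitz_on (unit_arc k) (pieces n f)" by blast
    have "rises (W k k) (pieces n f) j" if j: "j = k \<or> j = Suc k mod n" for j
    proof -
      have jn: "j < n" using j k by auto
      obtain m where m: "m > 0" "\<forall>x y. 0 \<le> x \<longrightarrow> x \<le> y \<longrightarrow> y \<le> 1 \<longrightarrow> m * (y - x) \<le> W k k \<bullet> (f j y - f j x)"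
        using f[OF jn] adj[OF k j] unfolding controlled_def by blast
      have "m * (t - s) \<le> W k k \<bullet> (pieces n f t - pieces n f s)"
        if st: "s \<in> unit_arc j" "t \<in> unit_arc j" "s \<le> t" for s t
        using m(2)[rule_format, of "s - j" "t - j"] arc[OF st(1)] arc[OF st(2)] st
        by (simp add: eq[OF jn])
      thus ?thesis unfolding rises_def using m(1) by blast
    qed
    thus "rises (W k k) (pieces n f) k" "rises (W k k) (pieces n f) (Suc k mod n)" by auto
  next
    fix k l assume kl: "Suc k < l" "l < n" "Suc l \<noteq> k + n"
    have k: "k < n" using kl by simp
    obtain m where m: "m > 0" "\<And>x y. x \<in> convex hull (set (Q k)) \<Longrightarrow> y \<in> convex hull (set (Q l)) \<Longrightarrow>
        m \<le> W k l \<bullet> (y - x)"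
      using separated_hulls[of "set (Q k)" "set (Q l)" "W k l"] far[OF kl] ne[OF k] ne[OF kl(2)] by auto
    have "m \<le> W k l \<bullet> (pieces n f t - pieces n f s)" if "s \<in> unit_arc k" "t \<in> unit_arc l" for s t
    proof (rule m(2))
      show "pieces n f s \<in> convex hull (set (Q k))"
        using f[OF k] arc[OF that(1)] eq[OF k that(1)] by (auto simp: controlled_def)
      show "pieces n f t \<in> convex hull (set (Q l))"
        using f[OF kl(2)] arc[OF that(2)] eq[OF kl(2) that(2)] by (auto simp: controlled_def)
    qed
    thus "below (W k l) (pieces n f) k l"
      unfolding below_def using m(1) by blast
  qed
  thus ?thesis using J by simp
qed

subsection \<open>Polygonal lines\<close>

text \<open>A whole control polygon becomes a single arc over [0, 1], with equal shares for its
  edges, so that it can be matched with the Bezier arc of the same control points.\<close>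

definition polyline :: "'a::real_vector list \<Rightarrow> real \<Rightarrow> 'a" where
  "polyline Q x = pieces (length Q - 1) (\<lambda>i y. (1 - y) *\<^sub>R (Q ! i) + y *\<^sub>R (Q ! Suc i)) (real (length Q - 1) * x)"

lemma joined_edges: "joined n (\<lambda>i y. (1 - y) *\<^sub>R (p i) + y *\<^sub>R (p (Suc i) :: 'a::real_vector))"
  by (simp add: joined_def)

lemma polyline_image:
  assumes "length Q \<ge> 2"
  shows "polyline Q ` {0..1} = pl_curve Q"
proof -
  define n where "n = length Q - 1"
  have n: "n > 0" using assms by (simp add: n_def)
  have "polyline Q ` {0..1} = pieces n (\<lambda>i y. (1 - y) *\<^sub>R (Q ! i) + y *\<^sub>R (Q ! Suc i)) ` (\<lambda>x. real n * x) ` {0..1}"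
    by (simp add: polyline_def n_def image_image)
  also have "(\<lambda>x. real n * x) ` {0..1} = {0..real n}"
    using n image_mult_atLeastAtMost[of "real n" 0 1] by simp
  also have "pieces n (\<lambda>i y. (1 - y) *\<^sub>R (Q ! i) + y *\<^sub>R (Q ! Suc i)) ` {0..real n} =
      (\<Union>i<n. closed_segment (Q ! i) (Q ! Suc i))"
    unfolding pieces_image[OF joined_edges n] by (simp add: closed_segment_image_interval)
  also have "\<dots> = pl_curve Q"
    unfolding pl_curve_def n_def by (intro arg_cong[of _ _ Union] image_cong) auto
  finally show ?thesis .
qed

lemma mono_on_unit_arcs:
  fixes g :: "real \<Rightarrow> real"
  assumes "\<And>k. k < n \<Longrightarrow> mono_on (unit_arc k) g"
  shows "mono_on {0..real n} g"
  using assms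
proof (induction n)
  case 0
  thus ?case by (simp add: mono_on_def)
next
  case (Suc n)
  hence IH: "mono_on {0..real n} g" and A: "mono_on (unit_arc n) g" by simp_all
  show ?case
  proof (rule mono_onI)
    fix s t assume st: "s \<in> {0..real (Suc n)}" "t \<in> {0..real (Suc n)}" "s \<le> t"
    consider "t \<le> n" | "n \<le> s" | "s \<le> n" "n \<le> t" by linarith
    thus "g s \<le> g t"
    proof cases
      case 1
      thus ?thesis using st mono_onD[OF IH] by simp
    next
      case 2
      thus ?thesis using st mono_onD[OF A] by (simp add: unit_arc_def)
    next
      case 3
      have "g s \<le> g n" using st 3 by (intro mono_onD[OF IH]) auto
      also have "g n \<le> g t" using st 3 by (intro mono_onD[OF A]) (auto simp: unit_arc_def)
      finally show ?thesis .
    qed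
  qed
qed

lemma controlled_polyline:
  fixes Q :: "'a::real_inner list"
  assumes len: "length Q \<ge> 2"
  shows "controlled Q (polyline Q)"
proof -
  define n where "n = length Q - 1"
  have n: "n > 0" and lenQ: "length Q = Suc n" using len by (simp_all add: n_def)
  define g where "g = pieces n (\<lambda>i y. (1 - y) *\<^sub>R (Q ! i) + y *\<^sub>R (Q ! Suc i))"
  have polyline_eq: "polyline Q x = g (real n * x)" for x
    by (simp add: polyline_def g_def n_def)
  have g: "g t = (1 - (t - k)) *\<^sub>R (Q ! k) + (t - k) *\<^sub>R (Q ! Suc k)"
    if "k < n" "t \<in> unit_arc k" for k t
    unfolding g_def by (rule pieces_eq[OF joined_edges that])
  have diff: "g t - g s = (t - s) *\<^sub>R (Q ! Suc k - Q ! k)"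
    if "k < n" "s \<in> unit_arc k" "t \<in> unit_arc k" for k s t
    using that by (simp add: g algebra_simps)
  have sub: "real n * x \<in> {0..real n}" if "x \<in> {0..1}" for x
    using that by (auto simp: mult_left_le)
  have Q0: "Q \<noteq> []" using len by auto
  have hd: "polyline Q 0 = hd Q"
    using n g[of 0 0] Q0 by (simp add: polyline_eq unit_arc_def hd_conv_nth)
  have last: "polyline Q 1 = last Q"
    using n g[of "n - 1" "real n"] Q0 lenQ by (simp add: polyline_eq unit_arc_def last_conv_nth of_nat_diff)
  have hull: "polyline Q ` {0..1} \<subseteq> convex hull (set Q)"
  proof -
    have "closed_segment (Q ! i) (Q ! Suc i) \<subseteq> convex hull (set Q)" if "Suc i < length Q" for i
      using that by (intro closed_segment_subset_convex_hull hull_inc) auto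
    thus ?thesis
      unfolding polyline_image[OF len] pl_curve_def by blast
  qed
  have lip: "\<exists>C. C-lipschitz_on {0..1} (polyline Q)"
  proof -
    define C where "C = (\<Sum>k<n. norm (Q ! Suc k - Q ! k))"
    have C0: "C \<ge> 0" by (simp add: C_def sum_nonneg)
    have "C-lipschitz_on {0..real n} g"
    proof (rule lipschitz_on_closed_Union[where I = "{..<n}" and U = unit_arc])
      fix k assume k: "k \<in> {..<n}"
      show "C-lipschitz_on (unit_arc k) g"
      proof (rule lipschitz_onI[OF _ C0])
        fix s t assume "s \<in> unit_arc k" "t \<in> unit_arc k"
        hence "dist (g s) (g t) = \<bar>s - t\<bar> * norm (Q ! Suc k - Q ! k)"
          using k by (simp add: dist_norm diff)
        also have "\<dots> \<le> \<bar>s - t\<bar> * C"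
          unfolding C_def using k by (intro mult_left_mono member_le_sum) auto
        finally show "dist (g s) (g t) \<le> C * dist s t"
          by (simp add: dist_real_def mult.commute)
      qed
    next
      show "{0..real n} \<subseteq> (\<Union>k\<in>{..<n}. unit_arc k)"
        by (simp add: Union_unit_arcs[OF n])
    qed (use C0 in \<open>auto simp: unit_arc_def\<close>)
    hence g_lip: "dist (g s) (g t) \<le> C * dist s t" if "s \<in> {0..real n}" "t \<in> {0..real n}" for s t
      using that by (auto simp: lipschitz_on_def)
    have "(C * n)-lipschitz_on {0..1} (polyline Q)"
    proof (rule lipschitz_onI)
      fix x y :: real assume "x \<in> {0..1}" "y \<in> {0..1}"
      hence "dist (polyline Q x) (polyline Q y) \<le> C * dist (real n * x) (real n * y)"
        unfolding polyline_eq by (intro g_lip sub)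
      also have "dist (real n * x) (real n * y) = n * dist x y"
        by (simp add: dist_real_def abs_mult flip: right_diff_distrib)
      finally show "dist (polyline Q x) (polyline Q y) \<le> C * n * dist x y" by simp
    qed (use C0 in simp)
    thus ?thesis by blast
  qed
  have rise: "\<exists>m>0. \<forall>x y. 0 \<le> x \<longrightarrow> x \<le> y \<longrightarrow> y \<le> 1 \<longrightarrow> m * (y - x) \<le> w \<bullet> (polyline Q y - polyline Q x)"
    if w: "\<forall>i. Suc i < length Q \<longrightarrow> 0 < w \<bullet> (Q ! Suc i - Q ! i)" for w
  proof -
    define m where "m = Min ((\<lambda>i. w \<bullet> (Q ! Suc i - Q ! i)) ` {..<n})"
    have m0: "m > 0"
      unfolding m_def using n w lenQ by (subst Min_gr_iff) auto
    \<comment> \<open>Subtracting \<open>m * t\<close> turns a lower bound on the slope into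
      monotonicity, which can be glued across the edges.\<close>
    have "mono_on {0..real n} (\<lambda>t. w \<bullet> g t - m * t)"
    proof (rule mono_on_unit_arcs, rule mono_onI)
      fix k s t assume k: "k < n" and st: "s \<in> unit_arc k" "t \<in> unit_arc k" "s \<le> t"
      have "m \<le> w \<bullet> (Q ! Suc k - Q ! k)"
        unfolding m_def using k by (intro Min_le) auto
      hence "m * (t - s) \<le> w \<bullet> (Q ! Suc k - Q ! k) * (t - s)"
        using st by (intro mult_right_mono) auto
      also have "\<dots> = w \<bullet> (g t - g s)"
        using diff[OF k st(1,2)] by simp
      finally show "w \<bullet> g s - m * s \<le> w \<bullet> g t - m * t"
        by (simp add: inner_diff_right algebra_simps)
    qed
    hence *: "w \<bullet> g s - m * s \<le> w \<bullet> g t - m * t" if "s \<in> {0..real n}" "t \<in> {0..real n}" "s \<le> t" for s t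
      using that by (auto simp: mono_on_def)
    have "(m * n) * (y - x) \<le> w \<bullet> (polyline Q y - polyline Q x)"
      if xy: "0 \<le> x" "x \<le> y" "y \<le> 1" for x y
    proof -
      have "w \<bullet> g (real n * x) - m * (real n * x) \<le> w \<bullet> g (real n * y) - m * (real n * y)"
        using xy by (intro * sub mult_left_mono) auto
      thus ?thesis
        by (simp add: polyline_eq inner_diff_right algebra_simps)
    qed
    thus ?thesis using m0 n by (intro exI[of _ "m * n"]) auto
  qed
  show ?thesis
    unfolding controlled_def using hd last hull lip rise by blast
qed

subsection \<open>Bezier curves\<close>

text \<open>Evaluation at an arbitrary parameter, whereas \<open>casteljau\<close> is restricted to 1/2.\<close>

fun bez :: "nat \<Rightarrow> (nat \<Rightarrow> 'a::real_vector) \<Rightarrow> real \<Rightarrow> 'a" where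
  "bez 0 f t = f 0"
| "bez (Suc n) f t = (1 - t) *\<^sub>R bez n f t + t *\<^sub>R bez n (\<lambda>i. f (Suc i)) t"

text \<open>Pascal's rule for the Bernstein polynomials is the recursion of \<open>bez\<close>. It
  makes hull, monotonicity and Lipschitz bounds accessible to induction on the degree.\<close>

lemma bez_eq_sum: "bez n f t = (\<Sum>i\<le>n. Bernstein n i t *\<^sub>R f i)"
proof (induction n arbitrary: f)
  case 0
  show ?case by (simp add: Bernstein_def)
next
  case (Suc n)
  have B0: "Bernstein (Suc n) 0 t = (1 - t) * Bernstein n 0 t"
    by (simp add: Bernstein_def)
  have BS: "Bernstein (Suc n) (Suc i) t = (1 - t) * Bernstein n (Suc i) t + t * Bernstein n i t" if "i \<le> n" for i
  proof (cases "i = n")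
    case True
    thus ?thesis by (simp add: Bernstein_def)
  next
    case False
    hence "n - i = Suc (n - Suc i)" using that by simp
    thus ?thesis by (simp add: Bernstein_def algebra_simps)
  qed
  \<comment> \<open>After regrouping, the sum for degree \<open>n\<close> runs one index too far;
    the surplus term vanishes with its binomial coefficient.\<close>
  have top: "Bernstein n (Suc n) t = 0" by (simp add: Bernstein_def)
  have "(\<Sum>i\<le>Suc n. Bernstein (Suc n) i t *\<^sub>R f i) =
      ((1 - t) * Bernstein n 0 t) *\<^sub>R f 0 + (\<Sum>i\<le>n. Bernstein (Suc n) (Suc i) t *\<^sub>R f (Suc i))"
    by (simp add: sum.atMost_Suc_shift B0 del: sum.atMost_Suc)
  also have "(\<Sum>i\<le>n. Bernstein (Suc n) (Suc i) t *\<^sub>R f (Suc i)) =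
      (\<Sum>i\<le>n. ((1 - t) * Bernstein n (Suc i) t) *\<^sub>R f (Suc i)) + (\<Sum>i\<le>n. (t * Bernstein n i t) *\<^sub>R f (Suc i))"
    by (simp add: BS scaleR_add_left sum.distrib)
  also have "((1 - t) * Bernstein n 0 t) *\<^sub>R f 0 + ((\<Sum>i\<le>n. ((1 - t) * Bernstein n (Suc i) t) *\<^sub>R f (Suc i)) +
        (\<Sum>i\<le>n. (t * Bernstein n i t) *\<^sub>R f (Suc i))) =
      (\<Sum>i\<le>Suc n. ((1 - t) * Bernstein n i t) *\<^sub>R f i) + (\<Sum>i\<le>n. (t * Bernstein n i t) *\<^sub>R f (Suc i))"
    by (simp add: sum.atMost_Suc_shift del: sum.atMost_Suc)
  also have "\<dots> = bez (Suc n) f t"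
    by (simp add: Suc.IH top scaleR_sum_right)
  finally show ?case ..
qed

lemma bezier_eq_bez: "length P = Suc n \<Longrightarrow> bezier P t = bez n ((!) P) t"
  by (simp add: bezier_def bez_eq_sum lessThan_Suc_atMost)

lemma bez_cong: "(\<And>i. i \<le> n \<Longrightarrow> f i = g i) \<Longrightarrow> bez n f t = bez n g t"
  by (simp add: bez_eq_sum)

lemma bez_diff: "bez n (\<lambda>i. f i - g i) t = bez n f t - bez n g t"
  by (simp add: bez_eq_sum scaleR_diff_right sum_subtractf)

lemma bez_midpoints:
  "bez n (\<lambda>i. (1 / 2) *\<^sub>R (f i + f (Suc i))) t = (1 / 2) *\<^sub>R (bez n f t + bez n (\<lambda>i. f (Suc i)) t)"
  by (simp add: bez_eq_sum scaleR_add_right sum.distrib scaleR_sum_right mult.commute)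

lemma inner_bez: "w \<bullet> bez n f t = bez n (\<lambda>i. w \<bullet> f i) t"
  by (simp add: bez_eq_sum inner_sum_right)

lemma bez_0 [simp]: "bez n f 0 = f 0"
  by (induction n arbitrary: f) auto

lemma bez_1 [simp]: "bez n f 1 = f n"
  by (induction n arbitrary: f) auto

lemma bez_in_hull:
  assumes "t \<in> {0..1}"
  shows "bez n f t \<in> convex hull (f ` {..n})"
proof (induction n arbitrary: f)
  case 0
  show ?case by simp
next
  case (Suc n)
  have "bez n f t \<in> convex hull (f ` {..Suc n})"
    by (rule subsetD[OF hull_mono Suc.IH]) auto
  moreover have "bez n (\<lambda>i. f (Suc i)) t \<in> convex hull (f ` {..Suc n})"
    by (rule subsetD[OF hull_mono Suc.IH]) auto
  ultimately show ?case
    using assms by (simp add: convexD_alt[OF convex_convex_hull] del: atMost_Suc)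
qed

lemma bez_ge:
  fixes f :: "nat \<Rightarrow> real"
  assumes "\<And>i. i \<le> n \<Longrightarrow> m \<le> f i" "t \<in> {0..1}"
  shows "m \<le> bez n f t"
  using assms(1)
proof (induction n arbitrary: f)
  case 0
  thus ?case by simp
next
  case (Suc n)
  have "m = (1 - t) * m + t * m" by (simp add: algebra_simps)
  also have "\<dots> \<le> bez (Suc n) f t"
    using assms(2) Suc.IH[of f] Suc.IH[of "\<lambda>i. f (Suc i)"] Suc.prems
    by (auto intro!: add_mono mult_left_mono)
  finally show ?case .
qed

lemma norm_bez_le:
  assumes "\<And>i. i \<le> n \<Longrightarrow> norm (f i) \<le> M" "t \<in> {0..1}"
  shows "norm (bez n f t) \<le> M"
proof -
  have "convex hull (f ` {..n}) \<subseteq> cball 0 M"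
    using assms(1) by (intro hull_minimal) auto
  thus ?thesis using bez_in_hull[OF assms(2), of n f] by auto
qed

text \<open>A discrete product rule for the recursion of \<open>bez\<close>. The last term carries
  the differences of the control points; over \<open>n\<close> induction steps such terms accumulate
  to the factor \<open>n\<close>, as in the derivative of a Bezier curve, without any
  differentiation.\<close>

lemma bez_Suc_diff:
  "bez (Suc n) f t - bez (Suc n) f s =
    (1 - t) *\<^sub>R (bez n f t - bez n f s) + t *\<^sub>R (bez n (\<lambda>i. f (Suc i)) t - bez n (\<lambda>i. f (Suc i)) s) +
    (t - s) *\<^sub>R bez n (\<lambda>i. f (Suc i) - f i) s"
  by (simp add: bez_diff algebra_simps)

lemma bez_rises:
  fixes f :: "nat \<Rightarrow> real"
  assumes "\<And>i. i < n \<Longrightarrow> m \<le> f (Suc i) - f i" "0 \<le> s" "s \<le> t" "t \<le> 1"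
  shows "n * m * (t - s) \<le> bez n f t - bez n f s"
  using assms(1)
proof (induction n arbitrary: f)
  case 0
  show ?case by simp
next
  case (Suc n)
  have 1: "n * m * (t - s) \<le> bez n f t - bez n f s"
      "n * m * (t - s) \<le> bez n (\<lambda>i. f (Suc i)) t - bez n (\<lambda>i. f (Suc i)) s"
    using Suc.prems by (auto intro!: Suc.IH)
  have 2: "m \<le> bez n (\<lambda>i. f (Suc i) - f i) s"
    using Suc.prems assms(2-4) by (intro bez_ge) auto
  have "Suc n * m * (t - s) = (1 - t) * (n * m * (t - s)) + t * (n * m * (t - s)) + (t - s) * m"
    by (simp add: algebra_simps)
  also have "\<dots> \<le> bez (Suc n) f t - bez (Suc n) f s"
    unfolding bez_Suc_diff real_scaleR_def using 1 2 assms(2-4)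
    by (intro add_mono mult_left_mono) auto
  finally show ?case .
qed

lemma bez_lipschitz:
  assumes "\<And>i. i < n \<Longrightarrow> norm (f (Suc i) - f i) \<le> M" "s \<in> {0..1}" "t \<in> {0..1}"
  shows "norm (bez n f t - bez n f s) \<le> n * M * \<bar>t - s\<bar>"
  using assms(1)
proof (induction n arbitrary: f)
  case 0
  show ?case by simp
next
  case (Suc n)
  have 1: "norm (bez n f t - bez n f s) \<le> n * M * \<bar>t - s\<bar>"
      "norm (bez n (\<lambda>i. f (Suc i)) t - bez n (\<lambda>i. f (Suc i)) s) \<le> n * M * \<bar>t - s\<bar>"
    using Suc.prems by (auto intro!: Suc.IH)
  have 2: "norm (bez n (\<lambda>i. f (Suc i) - f i) s) \<le> M"
    using Suc.prems assms(2) by (intro norm_bez_le) auto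
  have "norm (bez (Suc n) f t - bez (Suc n) f s) \<le> norm ((1 - t) *\<^sub>R (bez n f t - bez n f s)) +
      norm (t *\<^sub>R (bez n (\<lambda>i. f (Suc i)) t - bez n (\<lambda>i. f (Suc i)) s)) +
      norm ((t - s) *\<^sub>R bez n (\<lambda>i. f (Suc i) - f i) s)"
    unfolding bez_Suc_diff by (intro norm_triangle_le add_right_mono norm_triangle_ineq)
  also have "\<dots> \<le> (1 - t) * (n * M * \<bar>t - s\<bar>) + t * (n * M * \<bar>t - s\<bar>) + \<bar>t - s\<bar> * M"
    unfolding norm_scaleR using 1 2 assms(2,3) by (intro add_mono mult_mono) auto
  also have "\<dots> = Suc n * M * \<bar>t - s\<bar>"
    by (simp add: algebra_simps)
  finally show ?case .
qed

lemma controlled_bezier: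
  fixes Q :: "'a::real_inner list"
  assumes len: "length Q \<ge> 2"
  shows "controlled Q (bezier Q)"
proof -
  define n where "n = length Q - 1"
  have n: "n > 0" and lenQ: "length Q = Suc n" using len by (simp_all add: n_def)
  have eq: "bezier Q t = bez n ((!) Q) t" for t by (rule bezier_eq_bez[OF lenQ])
  have Q0: "Q \<noteq> []" using len by auto
  have hull: "bezier Q ` {0..1} \<subseteq> convex hull (set Q)"
  proof -
    have "set Q = (!) Q ` {..n}"
      using lenQ by (auto simp: set_conv_nth)
    thus ?thesis by (auto simp: eq intro!: bez_in_hull)
  qed
  have lip: "\<exists>C. C-lipschitz_on {0..1} (bezier Q)"
  proof -
    define M where "M = (\<Sum>k<n. norm (Q ! Suc k - Q ! k))"
    have M: "norm (Q ! Suc i - Q ! i) \<le> M" if "i < n" for i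
      unfolding M_def using that by (intro member_le_sum) auto
    have "(n * M)-lipschitz_on {0..1} (bezier Q)"
    proof (rule lipschitz_onI)
      show "0 \<le> n * M" by (simp add: M_def sum_nonneg)
      fix x y :: real assume "x \<in> {0..1}" "y \<in> {0..1}"
      thus "dist (bezier Q x) (bezier Q y) \<le> n * M * dist x y"
        unfolding eq dist_norm real_norm_def by (intro bez_lipschitz M)
    qed
    thus ?thesis by blast
  qed
  have rise: "\<exists>m>0. \<forall>x y. 0 \<le> x \<longrightarrow> x \<le> y \<longrightarrow> y \<le> 1 \<longrightarrow> m * (y - x) \<le> w \<bullet> (bezier Q y - bezier Q x)"
    if w: "\<forall>i. Suc i < length Q \<longrightarrow> 0 < w \<bullet> (Q ! Suc i - Q ! i)" for w
  proof -
    define m where "m = Min ((\<lambda>i. w \<bullet> (Q ! Suc i - Q ! i)) ` {..<n})"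
    have m0: "m > 0"
      unfolding m_def using n w lenQ by (subst Min_gr_iff) auto
    have m: "m \<le> w \<bullet> (Q ! Suc i) - w \<bullet> (Q ! i)" if "i < n" for i
      unfolding m_def inner_diff_right using that by (intro Min_le) auto
    have "(n * m) * (y - x) \<le> w \<bullet> (bezier Q y - bezier Q x)" if "0 \<le> x" "x \<le> y" "y \<le> 1" for x y
      unfolding eq inner_diff_right inner_bez using that by (intro bez_rises m)
    thus ?thesis using m0 n by (intro exI[of _ "n * m"]) auto
  qed
  show ?thesis
    unfolding controlled_def using hull lip rise Q0 lenQ
    by (simp add: eq hd_conv_nth last_conv_nth)
qed

subsection \<open>Subdivision\<close>

text \<open>De Casteljau's scheme on sequences instead of lists: no index leaves the range, and
  shifted sequences and sequences of midpoints are again admissible arguments.\<close>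

fun cast :: "(nat \<Rightarrow> 'a::real_vector) \<Rightarrow> nat \<Rightarrow> nat \<Rightarrow> 'a" where
  "cast f 0 k = f k"
| "cast f (Suc r) k = (1 / 2) *\<^sub>R (cast f r k + cast f r (Suc k))"

lemma casteljau_eq_cast: "casteljau Q r k = cast ((!) Q) r k"
  by (induction r arbitrary: k) auto

text \<open>The recursion of \<open>cast\<close> removes the last averaging; this equation removes
  the first one, which leaves the scheme of the midpoints and is what the induction on the degree
  uses.\<close>

lemma cast_Suc: "cast f (Suc r) k = cast (\<lambda>i. (1 / 2) *\<^sub>R (f i + f (Suc i))) r k"
  by (induction r arbitrary: k) simp_all

lemma cast_Suc_right: "cast f r (Suc k) = cast (\<lambda>i. f (Suc i)) r k"
  by (induction r arbitrary: k) auto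

lemma cast_cong: "(\<And>i. k \<le> i \<Longrightarrow> i \<le> k + r \<Longrightarrow> f i = g i) \<Longrightarrow> cast f r k = cast g r k"
  by (induction r arbitrary: k) auto

text \<open>Without its first entry, the left list of \<open>f\<close> is the left list of the
  midpoints. The induction hypothesis applies to both parts of the recursion, and averaging the
  control points averages the curves.\<close>

lemma bez_left: "bez n (\<lambda>r. cast f r 0) t = bez n f (t / 2)"
proof (induction n arbitrary: f)
  case 0
  show ?case by simp
next
  case (Suc n)
  have "bez (Suc n) (\<lambda>r. cast f r 0) t = (1 - t) *\<^sub>R bez n f (t / 2) +
      t *\<^sub>R (1 / 2) *\<^sub>R (bez n f (t / 2) + bez n (\<lambda>i. f (Suc i)) (t / 2))"
    by (simp add: Suc.IH cast_Suc bez_midpoints del: cast.simps(2))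
  also have "\<dots> = bez (Suc n) f (t / 2)"
    by (simp add: algebra_simps flip: scaleR_add_left)
  finally show ?case .
qed

lemma bez_right: "bez n (\<lambda>k. cast f (n - k) k) t = bez n f ((1 + t) / 2)"
proof (induction n arbitrary: f)
  case 0
  show ?case by simp
next
  case (Suc n)
  let ?u = "(1 + t) / 2"
  have "bez n (\<lambda>k. cast f (Suc n - k) k) t = bez n (\<lambda>k. cast (\<lambda>i. (1 / 2) *\<^sub>R (f i + f (Suc i))) (n - k) k) t"
    by (rule bez_cong) (simp add: Suc_diff_le cast_Suc del: cast.simps(2))
  hence "bez (Suc n) (\<lambda>k. cast f (Suc n - k) k) t =
      (1 - t) *\<^sub>R (1 / 2) *\<^sub>R (bez n f ?u + bez n (\<lambda>i. f (Suc i)) ?u) + t *\<^sub>R bez n (\<lambda>i. f (Suc i)) ?u"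
    by (simp add: Suc.IH cast_Suc_right bez_midpoints)
  also have "\<dots> = ((1 - t) / 2) *\<^sub>R bez n f ?u + ((1 - t) / 2 + t) *\<^sub>R bez n (\<lambda>i. f (Suc i)) ?u"
    by (simp only: scaleR_add_right scaleR_add_left scaleR_scaleR add.assoc times_divide_eq_right mult_1_right)
  also have "\<dots> = bez (Suc n) f ?u"
  proof -
    have "(1 - t) / 2 = 1 - ?u" "(1 - t) / 2 + t = ?u" by (simp_all add: field_simps)
    thus ?thesis by (simp only: bez.simps)
  qed
  finally show ?case .
qed

lemma bezier_curve_halves:
  assumes "Q \<noteq> []"
  shows "bezier_curve (left_half Q) \<union> bezier_curve (right_half Q) = bezier_curve Q"
proof -
  obtain n where n: "length Q = Suc n" using assms by (cases Q) auto
  have left: "bezier (left_half Q) t = bezier Q (t / 2)" for t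
  proof -
    have "bezier (left_half Q) t = bez n ((!) (left_half Q)) t"
      by (rule bezier_eq_bez) (simp add: left_half_def n)
    also have "\<dots> = bez n (\<lambda>r. cast ((!) Q) r 0) t"
      by (rule bez_cong) (simp add: left_half_def n casteljau_eq_cast del: upt_Suc)
    finally show ?thesis by (simp add: bez_left bezier_eq_bez[OF n])
  qed
  have right: "bezier (right_half Q) t = bezier Q ((1 + t) / 2)" for t
  proof -
    have "bezier (right_half Q) t = bez n ((!) (right_half Q)) t"
      by (rule bezier_eq_bez) (simp add: right_half_def n)
    also have "\<dots> = bez n (\<lambda>k. cast ((!) Q) (n - k) k) t"
      by (rule bez_cong) (simp add: right_half_def n casteljau_eq_cast del: upt_Suc)
    finally show ?thesis by (simp add: bez_right bezier_eq_bez[OF n])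
  qed
  have "(\<lambda>t::real. t / 2) ` {0..1} = {0..1/2}" "(\<lambda>t::real. (1 + t) / 2) ` {0..1} = {1/2..1}"
    using image_affinity_atLeastAtMost[of "1/2::real" 0 0 1] image_affinity_atLeastAtMost[of "1/2::real" "1/2" 0 1]
    by (simp_all add: add_divide_distrib add.commute)
  hence "bezier_curve (left_half Q) = bezier Q ` {0..1/2}" "bezier_curve (right_half Q) = bezier Q ` {1/2..1}"
    using image_image[of "bezier Q" "\<lambda>t. t / 2" "{0..1}"] image_image[of "bezier Q" "\<lambda>t. (1 + t) / 2" "{0..1}"]
    by (simp_all add: bezier_curve_def left right)
  moreover have "{0..1/2} \<union> {1/2..1} = {0..1::real}" by auto
  ultimately show ?thesis by (simp add: bezier_curve_def flip: image_Un)
qed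

lemma subdivide_nonempty: "[] \<notin> set Qs \<Longrightarrow> [] \<notin> set (subdivide Qs)"
  by (auto simp: subdivide_def left_half_def right_half_def)

lemma bezier_curve_subdivide:
  assumes "[] \<notin> set Qs"
  shows "(\<Union>Q\<in>set (subdivide Qs). bezier_curve Q) = (\<Union>Q\<in>set Qs. bezier_curve Q)"
proof -
  have "(\<Union>Q\<in>set (subdivide Qs). bezier_curve Q) =
      (\<Union>Q\<in>set Qs. bezier_curve (left_half Q) \<union> bezier_curve (right_half Q))"
    by (auto simp: subdivide_def)
  also have "\<dots> = (\<Union>Q\<in>set Qs. bezier_curve Q)"
    using assms by (intro SUP_cong refl bezier_curve_halves) auto
  finally show ?thesis .
qed

lemma bezier_curve_subdivide_iter:
  assumes "P \<noteq> []"
  shows "(\<Union>Q\<in>set ((subdivide ^^ m) [P]). bezier_curve Q) = bezier_curve P"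
proof -
  have "[] \<notin> set ((subdivide ^^ m) [P]) \<and>
      (\<Union>Q\<in>set ((subdivide ^^ m) [P]). bezier_curve Q) = bezier_curve P"
    using assms by (induction m) (auto simp: subdivide_nonempty bezier_curve_subdivide)
  thus ?thesis ..
qed

section \<open>Integer vectors\<close>

type_synonym ivec = "int \<times> int \<times> int"

definition vec_of :: "ivec \<Rightarrow> real ^ 3" where
  "vec_of v = (case v of (a, b, c) \<Rightarrow> vector [of_int a, of_int b, of_int c])"

definition idot :: "ivec \<Rightarrow> ivec \<Rightarrow> int" where
  "idot u v = (case (u, v) of ((a, b, c), (x, y, z)) \<Rightarrow> a * x + b * y + c * z)"

lemma vec3_eq_iff: "(u :: real ^ 3) = v \<longleftrightarrow> u $ 1 = v $ 1 \<and> u $ 2 = v $ 2 \<and> u $ 3 = v $ 3"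
  by (simp add: vec_eq_iff forall_3)

lemma inner_vec_of: "vec_of u \<bullet> vec_of v = of_int (idot u v)"
  by (cases u; cases v) (simp add: vec_of_def idot_def inner_vec_def sum_3)

lemma vec_of_add: "vec_of (u + v) = vec_of u + vec_of v"
  by (cases u; cases v) (simp add: vec_of_def vec3_eq_iff)

lemma vec_of_diff: "vec_of (u - v) = vec_of u - vec_of v"
  by (cases u; cases v) (simp add: vec_of_def vec3_eq_iff)

section \<open>The standard trefoil\<close>

text \<open>The minus sign in the third coordinate is the handedness \<open>s = -1\<close> of
  \<open>standard_trefoil\<close>.\<close>

definition trefoil :: "real \<Rightarrow> real ^ 3" where
  "trefoil t = vector [(2 + cos (3 * t)) * cos (2 * t), (2 + cos (3 * t)) * sin (2 * t), - sin (3 * t)]"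

definition trefoil' :: "real \<Rightarrow> real ^ 3" where
  "trefoil' t = vector [- 3 * sin (3 * t) * cos (2 * t) - 2 * (2 + cos (3 * t)) * sin (2 * t),
     - 3 * sin (3 * t) * sin (2 * t) + 2 * (2 + cos (3 * t)) * cos (2 * t), - 3 * cos (3 * t)]"

definition trefoil'' :: "real \<Rightarrow> real ^ 3" where
  "trefoil'' t = vector [- (13 * cos (3 * t) + 8) * cos (2 * t) + 12 * sin (3 * t) * sin (2 * t),
     - (13 * cos (3 * t) + 8) * sin (2 * t) - 12 * sin (3 * t) * cos (2 * t), 9 * sin (3 * t)]"

lemma inner_vec3: "(w :: real ^ 3) \<bullet> vector [x, y, z] = w $ 1 * x + w $ 2 * y + w $ 3 * z"
  by (simp add: inner_vec_def sum_3)

lemma DERIV_trefoil: "((\<lambda>t. w \<bullet> trefoil t) has_real_derivative w \<bullet> trefoil' t) (at t)"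
  unfolding trefoil_def trefoil'_def inner_vec3
  by (auto intro!: derivative_eq_intros simp: algebra_simps)

lemma DERIV_trefoil': "((\<lambda>t. w \<bullet> trefoil' t) has_real_derivative w \<bullet> trefoil'' t) (at t)"
  unfolding trefoil'_def trefoil''_def inner_vec3
  by (auto intro!: derivative_eq_intros simp: algebra_simps)

text \<open>The products of cosines and sines have coefficients at most 13 in absolute value, and
  \<open>cs\<close> bounds the sum of the absolute values of the two products by 1. Together with
  the coefficient 8 this gives 21 for the first two coordinates.\<close>

lemma trefoil''_bound: "\<bar>w \<bullet> trefoil'' t\<bar> \<le> 21 * (\<bar>w $ 1\<bar> + \<bar>w $ 2\<bar>) + 9 * \<bar>w $ 3\<bar>"
proof -
  have cs: "\<bar>a * c\<bar> + \<bar>b * d\<bar> \<le> 1" if "a\<^sup>2 + b\<^sup>2 = 1" "c\<^sup>2 + d\<^sup>2 = 1" for a b c d :: real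
  proof -
    have "0 \<le> (\<bar>a\<bar> - \<bar>c\<bar>)\<^sup>2 + (\<bar>b\<bar> - \<bar>d\<bar>)\<^sup>2" by simp
    also have "\<dots> = a\<^sup>2 + b\<^sup>2 + (c\<^sup>2 + d\<^sup>2) - 2 * (\<bar>a * c\<bar> + \<bar>b * d\<bar>)"
      by (simp add: power2_diff abs_mult)
    finally show ?thesis using that by simp
  qed
  have eq: "- (13 * cos (3 * t) + 8) * cos (2 * t) + 12 * sin (3 * t) * sin (2 * t) =
        12 * (sin (3 * t) * sin (2 * t)) - 13 * (cos (3 * t) * cos (2 * t)) - 8 * cos (2 * t)"
      "- (13 * cos (3 * t) + 8) * sin (2 * t) - 12 * sin (3 * t) * cos (2 * t) =
        - 12 * (sin (3 * t) * cos (2 * t)) - 13 * (cos (3 * t) * sin (2 * t)) - 8 * sin (2 * t)"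
    by (simp_all add: algebra_simps)
  have x: "\<bar>- (13 * cos (3 * t) + 8) * cos (2 * t) + 12 * sin (3 * t) * sin (2 * t)\<bar> \<le> 21"
    unfolding eq
    using cs[OF sin_cos_squared_add2[of "3 * t"] sin_cos_squared_add2[of "2 * t"]] abs_cos_le_one[of "2 * t"]
    by linarith
  have y: "\<bar>- (13 * cos (3 * t) + 8) * sin (2 * t) - 12 * sin (3 * t) * cos (2 * t)\<bar> \<le> 21"
    unfolding eq
    using cs[OF sin_cos_squared_add2[of "3 * t"] sin_cos_squared_add[of "2 * t"]] abs_sin_le_one[of "2 * t"]
    by linarith
  have z: "\<bar>9 * sin (3 * t)\<bar> \<le> 9" by (simp add: abs_mult)
  have "\<bar>w \<bullet> trefoil'' t\<bar> \<le>
      \<bar>w $ 1\<bar> * \<bar>- (13 * cos (3 * t) + 8) * cos (2 * t) + 12 * sin (3 * t) * sin (2 * t)\<bar> +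
      \<bar>w $ 2\<bar> * \<bar>- (13 * cos (3 * t) + 8) * sin (2 * t) - 12 * sin (3 * t) * cos (2 * t)\<bar> +
      \<bar>w $ 3\<bar> * \<bar>9 * sin (3 * t)\<bar>"
    unfolding trefoil''_def inner_vec3 abs_mult[symmetric] by linarith
  also have "\<dots> \<le> \<bar>w $ 1\<bar> * 21 + \<bar>w $ 2\<bar> * 21 + \<bar>w $ 3\<bar> * 9"
    by (intro add_mono mult_left_mono x y z abs_ge_zero)
  finally show ?thesis by simp
qed

lemma trefoil_taylor:
  defines "M \<equiv> \<lambda>w :: real ^ 3. 21 * (\<bar>w $ 1\<bar> + \<bar>w $ 2\<bar>) + 9 * \<bar>w $ 3\<bar>"
  shows "\<bar>w \<bullet> trefoil' t - w \<bullet> trefoil' c\<bar> \<le> M w * \<bar>t - c\<bar>"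
    and "\<bar>w \<bullet> trefoil t - w \<bullet> trefoil c - (t - c) * (w \<bullet> trefoil' c)\<bar> \<le> M w / 2 * (t - c)\<^sup>2"
proof -
  show "\<bar>w \<bullet> trefoil' t - w \<bullet> trefoil' c\<bar> \<le> M w * \<bar>t - c\<bar>"
    using field_differentiable_bound[of UNIV "\<lambda>t. w \<bullet> trefoil' t" "\<lambda>t. w \<bullet> trefoil'' t" "M w" t c]
      DERIV_trefoil' trefoil''_bound by (simp add: M_def)
  show "\<bar>w \<bullet> trefoil t - w \<bullet> trefoil c - (t - c) * (w \<bullet> trefoil' c)\<bar> \<le> M w / 2 * (t - c)\<^sup>2"
  proof (cases "t = c")
    case False
    define D :: "nat \<Rightarrow> real \<Rightarrow> real" where "D = (\<lambda>m t. if m = 0 then w \<bullet> trefoil t else if m = 1 then w \<bullet> trefoil' t else w \<bullet> trefoil'' t)"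
    have "\<exists>u. (if t < c then t < u \<and> u < c else c < u \<and> u < t) \<and>
        w \<bullet> trefoil t = (\<Sum>m<2. D m c / fact m * (t - c) ^ m) + D 2 u / fact 2 * (t - c) ^ 2"
    proof (rule Taylor[where a = "min t c" and b = "max t c"])
      show "\<forall>m u. m < 2 \<and> min t c \<le> u \<and> u \<le> max t c \<longrightarrow> DERIV (D m) u :> D (Suc m) u"
        using DERIV_trefoil[of w] DERIV_trefoil'[of w] by (auto simp: D_def less_2_cases_iff)
    qed (use False in \<open>auto simp: D_def\<close>)
    then obtain u where "w \<bullet> trefoil t = (\<Sum>m<2. D m c / fact m * (t - c) ^ m) + D 2 u / fact 2 * (t - c)\<^sup>2"
      by blast
    hence "w \<bullet> trefoil t - w \<bullet> trefoil c - (t - c) * (w \<bullet> trefoil' c) = w \<bullet> trefoil'' u / 2 * (t - c)\<^sup>2"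
      by (simp add: D_def numeral_2_eq_2)
    also have "\<bar>\<dots>\<bar> \<le> M w / 2 * (t - c)\<^sup>2"
      unfolding abs_mult abs_power2 using trefoil''_bound[of w u]
      by (intro mult_right_mono) (auto simp: M_def)
    finally show ?thesis .
  qed simp
qed

text \<open>Hundredfold approximate values of cos and sin at the multiples of pi/6 and pi/4.\<close>

definition cos6 :: "int list" where "cos6 = [100, 87, 50, 0, -50, -87, -100, -87, -50, 0, 50, 87]"
definition sin6 :: "int list" where "sin6 = [0, 50, 87, 100, 87, 50, 0, -50, -87, -100, -87, -50]"
definition cos4 :: "int list" where "cos4 = [100, 71, 0, -71, -100, -71, 0, 71]"
definition sin4 :: "int list" where "sin4 = [0, 71, 100, 71, 0, -71, -100, -71]"

section \<open>Error bounds for the tables of cosines and sines\<close>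

lemma cos_sin_mod:
  assumes "x * real n = 2 * pi"
  shows "cos (x * real k) = cos (x * real (k mod n))" "sin (x * real k) = sin (x * real (k mod n))"
proof -
  have "real k = real (k mod n) + real n * real (k div n)"
    by (metis add.commute mult_div_mod_eq of_nat_add of_nat_mult)
  hence "x * real k = x * real (k mod n) + (x * real n) * real (k div n)"
    by (simp add: algebra_simps)
  hence eq: "x * real k = x * real (k mod n) + 2 * real (k div n) * pi"
    by (simp add: assms mult.assoc mult.commute mult.left_commute)
  show "cos (x * real k) = cos (x * real (k mod n))" "sin (x * real k) = sin (x * real (k mod n))"
    unfolding eq cos_add sin_add cos_2npi sin_2npi by simp_all
qed

lemma quarter_turn:
  "cos (x + pi / 2) = - sin x" "sin (x + pi / 2) = cos x"
  by (simp_all add: cos_add sin_add)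

lemma sqrt_bounds: "\<bar>sqrt 3 / 2 - 87 / 100\<bar> \<le> 1 / 250" "\<bar>sqrt 2 / 2 - 71 / 100\<bar> \<le> 3 / 1000"
proof -
  have "433 / 250 \<le> sqrt 3" "707 / 500 \<le> sqrt 2"
    by (rule real_le_rsqrt; simp add: power2_eq_square)+
  moreover have "sqrt 3 \<le> 1733 / 1000" "sqrt 2 \<le> 283 / 200"
    by (rule real_le_lsqrt; simp add: power2_eq_square)+
  ultimately show "\<bar>sqrt 3 / 2 - 87 / 100\<bar> \<le> 1 / 250" "\<bar>sqrt 2 / 2 - 71 / 100\<bar> \<le> 3 / 1000"
    by (auto simp: abs_le_iff)
qed

text \<open>Only the angles 0, pi/6 and pi/3 are evaluated; three steps of pi/6 make a quarter turn,
  which yields all other entries. The error comes from replacing \<open>sqrt 3 / 2\<close> by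
  0.87.\<close>

lemma cos6_sin6:
  "\<bar>cos (pi / 6 * real k) - real_of_int (cos6 ! (k mod 12)) / 100\<bar> \<le> 1 / 250"
  "\<bar>sin (pi / 6 * real k) - real_of_int (sin6 ! (k mod 12)) / 100\<bar> \<le> 1 / 250"
proof -
  define q where "q = sqrt 3 / 2"
  have q: "sqrt 3 / 2 = q" "\<bar>q - 87 / 100\<bar> \<le> 1 / 250" "\<bar>87 / 100 - q\<bar> \<le> 1 / 250"
    using sqrt_bounds(1) unfolding q_def[symmetric] by (simp_all only: abs_minus_commute)
  define C S where "C = (\<lambda>x. cos (pi / 6 * x))" and "S = (\<lambda>x. sin (pi / 6 * x))"
  have base: "C 0 = 1" "S 0 = 0" "C 1 = q" "S 1 = 1 / 2" "C 2 = 1 / 2" "S 2 = q"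
    using cos_30 sin_30 cos_60 sin_60 by (simp_all add: C_def S_def flip: q(1))
  have step: "C (x + 3) = - S x" "S (x + 3) = C x" for x
  proof -
    have "pi / 6 * (x + 3) = pi / 6 * x + pi / 2" by (simp add: field_simps)
    thus "C (x + 3) = - S x" "S (x + 3) = C x"
      by (simp_all only: C_def S_def quarter_turn)
  qed
  note v = step[of 0] step[of 1] step[of 2] step[of 3] step[of 4] step[of 5] step[of 6] step[of 7] step[of 8]
  have "set [0..<12] = {0, 1, 2, 3, 4, 5, 6, 7, 8, 9, 10, 11 :: nat}" by code_simp
  moreover have "k mod 12 \<in> set [0..<12]" by simp
  ultimately have "k mod 12 \<in> {0, 1, 2, 3, 4, 5, 6, 7, 8, 9, 10, 11}" by (simp only:)
  hence "\<bar>C (real (k mod 12)) - real_of_int (cos6 ! (k mod 12)) / 100\<bar> \<le> 1 / 250 \<and>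
      \<bar>S (real (k mod 12)) - real_of_int (sin6 ! (k mod 12)) / 100\<bar> \<le> 1 / 250"
    unfolding cos6_def sin6_def
    by (elim insertE emptyE) (simp_all add: base v[simplified] q(2,3)[simplified])
  moreover have "C (real k) = C (real (k mod 12))" "S (real k) = S (real (k mod 12))"
    unfolding C_def S_def by (rule cos_sin_mod; simp)+
  ultimately show "\<bar>cos (pi / 6 * real k) - real_of_int (cos6 ! (k mod 12)) / 100\<bar> \<le> 1 / 250"
      "\<bar>sin (pi / 6 * real k) - real_of_int (sin6 ! (k mod 12)) / 100\<bar> \<le> 1 / 250"
    by (simp_all only: C_def S_def)
qed

lemma cos4_sin4:
  "\<bar>cos (pi / 4 * real k) - real_of_int (cos4 ! (k mod 8)) / 100\<bar> \<le> 3 / 1000"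
  "\<bar>sin (pi / 4 * real k) - real_of_int (sin4 ! (k mod 8)) / 100\<bar> \<le> 3 / 1000"
proof -
  define q where "q = sqrt 2 / 2"
  have q: "sqrt 2 / 2 = q" "\<bar>q - 71 / 100\<bar> \<le> 3 / 1000" "\<bar>71 / 100 - q\<bar> \<le> 3 / 1000"
    using sqrt_bounds(2) unfolding q_def[symmetric] by (simp_all only: abs_minus_commute)
  define C S where "C = (\<lambda>x. cos (pi / 4 * x))" and "S = (\<lambda>x. sin (pi / 4 * x))"
  have base: "C 0 = 1" "S 0 = 0" "C 1 = q" "S 1 = q"
    using cos_45 sin_45 by (simp_all add: C_def S_def flip: q(1))
  have step: "C (x + 2) = - S x" "S (x + 2) = C x" for x
  proof -
    have "pi / 4 * (x + 2) = pi / 4 * x + pi / 2" by (simp add: field_simps)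
    thus "C (x + 2) = - S x" "S (x + 2) = C x"
      by (simp_all only: C_def S_def quarter_turn)
  qed
  note v = step[of 0] step[of 1] step[of 2] step[of 3] step[of 4] step[of 5]
  have "set [0..<8] = {0, 1, 2, 3, 4, 5, 6, 7 :: nat}" by code_simp
  moreover have "k mod 8 \<in> set [0..<8]" by simp
  ultimately have "k mod 8 \<in> {0, 1, 2, 3, 4, 5, 6, 7}" by (simp only:)
  hence "\<bar>C (real (k mod 8)) - real_of_int (cos4 ! (k mod 8)) / 100\<bar> \<le> 3 / 1000 \<and>
      \<bar>S (real (k mod 8)) - real_of_int (sin4 ! (k mod 8)) / 100\<bar> \<le> 3 / 1000"
    unfolding cos4_def sin4_def
    by (elim insertE emptyE) (simp_all add: base v[simplified] q(2,3)[simplified])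
  moreover have "C (real k) = C (real (k mod 8))" "S (real k) = S (real (k mod 8))"
    unfolding C_def S_def by (rule cos_sin_mod; simp)+
  ultimately show "\<bar>cos (pi / 4 * real k) - real_of_int (cos4 ! (k mod 8)) / 100\<bar> \<le> 3 / 1000"
      "\<bar>sin (pi / 4 * real k) - real_of_int (sin4 ! (k mod 8)) / 100\<bar> \<le> 3 / 1000"
    by (simp_all only: C_def S_def)
qed

text \<open>Arc \<open>j\<close> of the trefoil is centred at the parameter (\<open>j + 18\<close>) pi / 12; position and derivative there
  are approximated by integer vectors over 10000. The shift by 18 makes the vertex 0 of
  \<open>octagon4\<close> below correspond to the beginning of arc 0.\<close>

definition arc_centre :: "nat \<Rightarrow> ivec" where
  "arc_centre j = (let c6 = cos6 ! ((j + 18) mod 12); s6 = sin6 ! ((j + 18) mod 12);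
      c4 = cos4 ! ((j + 18) mod 8); s4 = sin4 ! ((j + 18) mod 8)
    in ((200 + c4) * c6, (200 + c4) * s6, - 100 * s4))"

definition arc_tangent :: "nat \<Rightarrow> ivec" where
  "arc_tangent j = (let c6 = cos6 ! ((j + 18) mod 12); s6 = sin6 ! ((j + 18) mod 12);
      c4 = cos4 ! ((j + 18) mod 8); s4 = sin4 ! ((j + 18) mod 8)
    in (- 3 * s4 * c6 - 2 * (200 + c4) * s6, - 3 * s4 * s6 + 2 * (200 + c4) * c6, - 300 * c4))"

definition arc_angle :: "nat \<Rightarrow> real" where
  "arc_angle j = pi / 12 * real (j + 18)"

lemma product_error:
  fixes a b A B :: real
  assumes "\<bar>a - A\<bar> \<le> e" "\<bar>b - B\<bar> \<le> d" "\<bar>a\<bar> \<le> p" "\<bar>b\<bar> \<le> q"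
  shows "\<bar>a * b - A * B\<bar> \<le> (p + e) * d + q * e"
proof -
  have "a * b - A * B = A * (b - B) + b * (a - A)" by (simp add: algebra_simps)
  also have "\<bar>\<dots>\<bar> \<le> \<bar>A\<bar> * \<bar>b - B\<bar> + \<bar>b\<bar> * \<bar>a - A\<bar>"
    by (metis abs_mult abs_triangle_ineq)
  also have "\<dots> \<le> (p + e) * d + q * e"
    using assms by (intro add_mono mult_mono) auto
  finally show ?thesis .
qed

text \<open>The constants are ten thousand times the propagated table errors 0.004 and 0.003. A
  product with \<open>2 + c4\<close> has error below 0.0151, a product of cosines and sines below
  0.00702, and \<open>3 * 0.00702 + 2 * 0.0151\<close> is below 0.0513.\<close>

lemma arc_approx:
  fixes w :: "real ^ 3"
  shows "\<bar>10000 * (w \<bullet> trefoil (arc_angle j)) - w \<bullet> vec_of (arc_centre j)\<bar>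
      \<le> 151 * (\<bar>w $ 1\<bar> + \<bar>w $ 2\<bar>) + 30 * \<bar>w $ 3\<bar>" (is ?centre)
    and "\<bar>10000 * (w \<bullet> trefoil' (arc_angle j)) - w \<bullet> vec_of (arc_tangent j)\<bar>
      \<le> 513 * (\<bar>w $ 1\<bar> + \<bar>w $ 2\<bar>) + 90 * \<bar>w $ 3\<bar>" (is ?tangent)
proof -
  define k where "k = j + 18"
  define c6 s6 c4 s4 where "c6 = cos (pi / 6 * real k)" and "s6 = sin (pi / 6 * real k)"
    and "c4 = cos (pi / 4 * real k)" and "s4 = sin (pi / 4 * real k)"
  have angles: "2 * arc_angle j = pi / 6 * real k" "3 * arc_angle j = pi / 4 * real k"
    by (simp_all add: arc_angle_def k_def)
  define C6 S6 C4 S4 where "C6 = real_of_int (cos6 ! (k mod 12)) / 100"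
    and "S6 = real_of_int (sin6 ! (k mod 12)) / 100"
    and "C4 = real_of_int (cos4 ! (k mod 8)) / 100"
    and "S4 = real_of_int (sin4 ! (k mod 8)) / 100"
  have e: "\<bar>c6 - C6\<bar> \<le> 1 / 250" "\<bar>s6 - S6\<bar> \<le> 1 / 250" "\<bar>c4 - C4\<bar> \<le> 3 / 1000" "\<bar>s4 - S4\<bar> \<le> 3 / 1000"
    unfolding c6_def s6_def c4_def s4_def C6_def S6_def C4_def S4_def by (rule cos6_sin6 cos4_sin4)+
  have b: "\<bar>c6\<bar> \<le> 1" "\<bar>s6\<bar> \<le> 1" "\<bar>c4\<bar> \<le> 1" "\<bar>s4\<bar> \<le> 1"
    by (simp_all add: c6_def s6_def c4_def s4_def)
  have e2: "\<bar>(2 + c4) - (2 + C4)\<bar> \<le> 3 / 1000" "\<bar>2 + c4\<bar> \<le> 3"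
    using e(3) b(3) by auto
  have p: "\<bar>(2 + c4) * c6 - (2 + C4) * C6\<bar> \<le> 151 / 10000" "\<bar>(2 + c4) * s6 - (2 + C4) * S6\<bar> \<le> 151 / 10000"
    "\<bar>s4 * c6 - S4 * C6\<bar> \<le> 702 / 100000" "\<bar>s4 * s6 - S4 * S6\<bar> \<le> 702 / 100000"
    using product_error[OF e2(1) e(1) e2(2) b(1)] product_error[OF e2(1) e(2) e2(2) b(2)]
      product_error[OF e(4) e(1) b(4) b(1)] product_error[OF e(4) e(2) b(4) b(2)] by simp_all
  have bound: "\<bar>10000 * (w $ 1 * x + w $ 2 * y + w $ 3 * z) - (w $ 1 * X + w $ 2 * Y + w $ 3 * Z)\<bar>
      \<le> M * (\<bar>w $ 1\<bar> + \<bar>w $ 2\<bar>) + N * \<bar>w $ 3\<bar>"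
    if "\<bar>10000 * x - X\<bar> \<le> M" "\<bar>10000 * y - Y\<bar> \<le> M" "\<bar>10000 * z - Z\<bar> \<le> N" for x y z X Y Z M N
  proof -
    have "\<bar>10000 * (w $ 1 * x + w $ 2 * y + w $ 3 * z) - (w $ 1 * X + w $ 2 * Y + w $ 3 * Z)\<bar> =
        \<bar>w $ 1 * (10000 * x - X) + w $ 2 * (10000 * y - Y) + w $ 3 * (10000 * z - Z)\<bar>"
      by (simp add: algebra_simps)
    also have "\<dots> \<le> \<bar>w $ 1\<bar> * \<bar>10000 * x - X\<bar> + \<bar>w $ 2\<bar> * \<bar>10000 * y - Y\<bar> + \<bar>w $ 3\<bar> * \<bar>10000 * z - Z\<bar>"
      unfolding abs_mult[symmetric] by linarith
    also have "\<dots> \<le> \<bar>w $ 1\<bar> * M + \<bar>w $ 2\<bar> * M + \<bar>w $ 3\<bar> * N"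
      using that by (intro add_mono mult_left_mono) auto
    finally show ?thesis by (simp add: algebra_simps)
  qed
  have centre: "vec_of (arc_centre j) =
      vector [10000 * ((2 + C4) * C6), 10000 * ((2 + C4) * S6), - 10000 * S4]"
    by (simp add: arc_centre_def vec_of_def Let_def C6_def S6_def C4_def S4_def k_def algebra_simps)
  have tangent: "vec_of (arc_tangent j) =
      vector [10000 * (- 3 * (S4 * C6) - 2 * ((2 + C4) * S6)), 10000 * (- 3 * (S4 * S6) + 2 * ((2 + C4) * C6)),
        - 30000 * C4]"
    by (simp add: arc_tangent_def vec_of_def Let_def C6_def S6_def C4_def S4_def k_def algebra_simps)
  show ?centre
    unfolding centre trefoil_def inner_vec3 angles c6_def[symmetric] s6_def[symmetric] c4_def[symmetric] s4_def[symmetric]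
  proof (rule bound)
    show "\<bar>10000 * ((2 + c4) * c6) - 10000 * ((2 + C4) * C6)\<bar> \<le> 151"
      "\<bar>10000 * ((2 + c4) * s6) - 10000 * ((2 + C4) * S6)\<bar> \<le> 151"
      "\<bar>10000 * - s4 - - 10000 * S4\<bar> \<le> 30"
      using p(1,2) e(4) by linarith+
  qed
  show ?tangent
    unfolding tangent trefoil'_def inner_vec3 angles c6_def[symmetric] s6_def[symmetric] c4_def[symmetric] s4_def[symmetric]
  proof (rule bound)
    have comb: "\<bar>10000 * (- 3 * u - 2 * v) - 10000 * (- 3 * U - 2 * V)\<bar> \<le> 513"
      "\<bar>10000 * (- 3 * u + 2 * v) - 10000 * (- 3 * U + 2 * V)\<bar> \<le> 513"
      if "\<bar>u - U\<bar> \<le> 702 / 100000" "\<bar>v - V\<bar> \<le> 151 / 10000" for u v U V :: real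
      using that unfolding right_diff_distrib distrib_left by linarith+
    have eq: "- 3 * s4 * c6 - 2 * (2 + c4) * s6 = - 3 * (s4 * c6) - 2 * ((2 + c4) * s6)"
      "- 3 * s4 * s6 + 2 * (2 + c4) * c6 = - 3 * (s4 * s6) + 2 * ((2 + c4) * c6)"
      by simp_all
    show "\<bar>10000 * (- 3 * s4 * c6 - 2 * (2 + c4) * s6) - 10000 * (- 3 * (S4 * C6) - 2 * ((2 + C4) * S6))\<bar> \<le> 513"
      unfolding eq by (rule comb[OF p(3,2)])
    show "\<bar>10000 * (- 3 * s4 * s6 + 2 * (2 + c4) * c6) - 10000 * (- 3 * (S4 * S6) + 2 * ((2 + C4) * C6))\<bar> \<le> 513"
      unfolding eq by (rule comb[OF p(4,1)])
    show "\<bar>10000 * (- 3 * c4) - - 30000 * C4\<bar> \<le> 90"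
      using e(3) by linarith
  qed
qed

text \<open>The offset 35/2 sends the midpoint \<open>j + 1 / 2\<close> of \<open>unit_arc j\<close>
  to \<open>arc_angle j\<close>.\<close>

definition trefoil_param :: "real \<Rightarrow> real ^ 3" where
  "trefoil_param t = trefoil (pi / 12 * (t + 35 / 2))"

lemma arc_angle_dist:
  assumes "t \<in> unit_arc j"
  shows "\<bar>pi / 12 * (t + 35 / 2) - arc_angle j\<bar> \<le> 131 / 1000"
proof -
  have "pi / 12 * (t + 35 / 2) - arc_angle j = pi / 12 * (t - j - 1 / 2)"
    by (simp add: arc_angle_def algebra_simps add_divide_distrib)
  also have "\<bar>\<dots>\<bar> = pi / 12 * \<bar>t - j - 1 / 2\<bar>" by (simp add: abs_mult)
  \<comment> \<open>The upper bound 3.144 for pi is chosen because it equals 24 times 0.131.\<close>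
  also have "\<dots> \<le> (3144 / 1000) / 12 * (1 / 2)"
  proof (intro mult_mono divide_right_mono)
    show "\<bar>t - j - 1 / 2\<bar> \<le> 1 / 2"
      using assms unfolding unit_arc_def abs_le_iff atLeastAtMost_iff by linarith
  qed (use pi_approx in auto)
  finally show ?thesis by simp
qed

text \<open>Half an arc is shorter than 131/1000. The constants add up the second order Taylor remainder and the
  rounding errors of \<open>arc_approx\<close>.\<close>

lemma trefoil_param_near:
  assumes "t \<in> unit_arc j"
  shows "\<bar>10000 * (w \<bullet> trefoil_param t) - w \<bullet> vec_of (arc_centre j)\<bar>
    \<le> 131 / 1000 * \<bar>w \<bullet> vec_of (arc_tangent j)\<bar> + 2050 * (\<bar>w $ 1\<bar> + \<bar>w $ 2\<bar>) + 820 * \<bar>w $ 3\<bar>"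
proof -
  let ?c = "arc_angle j" and ?t = "pi / 12 * (t + 35 / 2)"
  define P Z where "P = \<bar>w $ 1\<bar> + \<bar>w $ 2\<bar>" and "Z = \<bar>w $ 3\<bar>"
  have PZ: "P \<ge> 0" "Z \<ge> 0" by (simp_all add: P_def Z_def)
  have d: "\<bar>?t - ?c\<bar> \<le> 131 / 1000" by (rule arc_angle_dist[OF assms])
  hence d2: "(?t - ?c)\<^sup>2 \<le> (131 / 1000)\<^sup>2"
    by (metis abs_ge_zero power2_abs power_mono)
  have "\<bar>w \<bullet> trefoil ?t - w \<bullet> trefoil ?c - (?t - ?c) * (w \<bullet> trefoil' ?c)\<bar> \<le> (21 * P + 9 * Z) / 2 * (?t - ?c)\<^sup>2"
    using trefoil_taylor(2)[of w ?t ?c] by (simp add: P_def Z_def)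
  also have "\<dots> \<le> (21 * P + 9 * Z) / 2 * (131 / 1000)\<^sup>2"
    using PZ d2 by (intro mult_left_mono) auto
  also have "\<dots> = 1801905 / 10000000 * P + 772245 / 10000000 * Z"
    by (simp add: power2_eq_square)
  finally have 1: "\<bar>w \<bullet> trefoil ?t - w \<bullet> trefoil ?c - (?t - ?c) * (w \<bullet> trefoil' ?c)\<bar> \<le>
    1801905 / 10000000 * P + 772245 / 10000000 * Z" .
  have 2: "\<bar>(?t - ?c) * (w \<bullet> trefoil' ?c)\<bar> \<le> 131 / 1000 * \<bar>w \<bullet> trefoil' ?c\<bar>"
    unfolding abs_mult using d by (intro mult_right_mono) auto
  have 3: "\<bar>10000 * (w \<bullet> trefoil ?c) - w \<bullet> vec_of (arc_centre j)\<bar> \<le> 151 * P + 30 * Z"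
    "\<bar>10000 * (w \<bullet> trefoil' ?c) - w \<bullet> vec_of (arc_tangent j)\<bar> \<le> 513 * P + 90 * Z"
    unfolding P_def Z_def by (rule arc_approx)+
  have 4: "10000 * \<bar>w \<bullet> trefoil' ?c\<bar> \<le> \<bar>w \<bullet> vec_of (arc_tangent j)\<bar> + (513 * P + 90 * Z)"
    using 3(2) by linarith
  have "\<bar>10000 * (w \<bullet> trefoil ?t) - w \<bullet> vec_of (arc_centre j)\<bar> \<le>
      131 / 1000 * \<bar>w \<bullet> vec_of (arc_tangent j)\<bar> + 2050 * P + 820 * Z"
    using 4 PZ abs_le_D1[OF 1] abs_le_D2[OF 1] abs_le_D1[OF 2] abs_le_D2[OF 2] abs_le_D1[OF 3(1)] abs_le_D2[OF 3(1)]
    by (intro abs_leI) linarith+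
  thus ?thesis by (simp add: trefoil_param_def P_def Z_def)
qed

lemma DERIV_trefoil_param:
  "((\<lambda>t. w \<bullet> trefoil_param t) has_real_derivative pi / 12 * (w \<bullet> trefoil' (pi / 12 * (t + 35 / 2)))) (at t)"
proof -
  have "((\<lambda>t. pi / 12 * (t + 35 / 2)) has_real_derivative pi / 12) (at t)"
    by (auto intro!: derivative_eq_intros)
  from DERIV_chain2[OF DERIV_trefoil this] show ?thesis
    by (simp add: trefoil_param_def mult.commute)
qed

text \<open>The derivative at the centre of the arc is known up to rounding, and the second
  derivative limits its change over half an arc. Accordingly \<open>10000 * 21 * 0.131 + 513\<close>
  is below 28200 and \<open>10000 * 9 * 0.131 + 90\<close> is below 12100. The mean value theorem
  then passes to increments.\<close>

lemma trefoil_param_rises: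
  assumes "0 < w \<bullet> vec_of (arc_tangent j) - 28200 * (\<bar>w $ 1\<bar> + \<bar>w $ 2\<bar>) - 12100 * \<bar>w $ 3\<bar>"
  shows "rises w trefoil_param j"
proof -
  define m where "m = w \<bullet> vec_of (arc_tangent j) - 28200 * (\<bar>w $ 1\<bar> + \<bar>w $ 2\<bar>) - 12100 * \<bar>w $ 3\<bar>"
  have m: "m > 0" using assms by (simp add: m_def)
  have d: "m / 10000 \<le> w \<bullet> trefoil' (pi / 12 * (t + 35 / 2))" if "t \<in> unit_arc j" for t
  proof -
    let ?c = "arc_angle j" and ?t = "pi / 12 * (t + 35 / 2)"
    define P Z where "P = \<bar>w $ 1\<bar> + \<bar>w $ 2\<bar>" and "Z = \<bar>w $ 3\<bar>"
    have PZ: "P \<ge> 0" "Z \<ge> 0" by (simp_all add: P_def Z_def)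
    have "\<bar>w \<bullet> trefoil' ?t - w \<bullet> trefoil' ?c\<bar> \<le> (21 * P + 9 * Z) * \<bar>?t - ?c\<bar>"
      unfolding P_def Z_def by (rule trefoil_taylor(1))
    also have "\<dots> \<le> (21 * P + 9 * Z) * (131 / 1000)"
      using PZ arc_angle_dist[OF that] by (intro mult_left_mono) auto
    also have "\<dots> = 2751 / 1000 * P + 1179 / 1000 * Z" by simp
    finally have 1: "\<bar>w \<bullet> trefoil' ?t - w \<bullet> trefoil' ?c\<bar> \<le> 2751 / 1000 * P + 1179 / 1000 * Z" .
    have 2: "\<bar>10000 * (w \<bullet> trefoil' ?c) - w \<bullet> vec_of (arc_tangent j)\<bar> \<le> 513 * P + 90 * Z"
      unfolding P_def Z_def by (rule arc_approx)
    have m_eq: "m = w \<bullet> vec_of (arc_tangent j) - 28200 * P - 12100 * Z"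
      by (simp add: m_def P_def Z_def)
    have "m \<le> 10000 * (w \<bullet> trefoil' ?t)"
      using abs_le_D2[OF 1] abs_le_D2[OF 2] PZ unfolding m_eq by linarith
    thus ?thesis by simp
  qed
  have "pi / 12 * (m / 10000) * (t - s) \<le> w \<bullet> (trefoil_param t - trefoil_param s)"
    if st: "s \<in> unit_arc j" "t \<in> unit_arc j" "s \<le> t" for s t
  proof (cases "s = t")
    case False
    hence "s < t" using st by simp
    from MVT2[OF this, of "\<lambda>t. w \<bullet> trefoil_param t", OF DERIV_trefoil_param]
    obtain z where z: "s < z" "z < t" "w \<bullet> trefoil_param t - w \<bullet> trefoil_param s =
        (t - s) * (pi / 12 * (w \<bullet> trefoil' (pi / 12 * (z + 35 / 2))))" by blast
    have "z \<in> unit_arc j" using st z by (auto simp: unit_arc_def)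
    hence "(t - s) * (pi / 12 * (m / 10000)) \<le> (t - s) * (pi / 12 * (w \<bullet> trefoil' (pi / 12 * (z + 35 / 2))))"
      using st d by (intro mult_left_mono) auto
    thus ?thesis
      unfolding inner_diff_right z(3) by (simp only: mult.commute)
  qed simp
  thus ?thesis
    unfolding rises_def using m by (intro exI[of _ "pi / 12 * (m / 10000)"]) auto
qed

text \<open>Each arc lies in a slab around its centre by \<open>trefoil_param_near\<close>. Both
  slabs contribute, so the constants 2050 and 820 appear doubled.\<close>

lemma trefoil_param_below:
  assumes "0 < (w \<bullet> vec_of (arc_centre l) - 131 / 1000 * \<bar>w \<bullet> vec_of (arc_tangent l)\<bar>) -
      (w \<bullet> vec_of (arc_centre k) + 131 / 1000 * \<bar>w \<bullet> vec_of (arc_tangent k)\<bar>) -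
      4100 * (\<bar>w $ 1\<bar> + \<bar>w $ 2\<bar>) - 1640 * \<bar>w $ 3\<bar>" (is "0 < ?m")
  shows "below w trefoil_param k l"
proof -
  have "?m \<le> 10000 * (w \<bullet> (trefoil_param t - trefoil_param s))" if "s \<in> unit_arc k" "t \<in> unit_arc l" for s t
  proof -
    have comb: "l - 131 / 1000 * b - (k + 131 / 1000 * a) - 4100 * P - 1640 * Z \<le> 10000 * (y - x)"
      if "10000 * x - k \<le> 131 / 1000 * a + 2050 * P + 820 * Z"
        "- (10000 * y - l) \<le> 131 / 1000 * b + 2050 * P + 820 * Z" for x y k l a b P Z :: real
      using that unfolding right_diff_distrib by linarith
    show ?thesis
      unfolding inner_diff_right
      by (rule comb[OF abs_le_D1[OF trefoil_param_near[OF that(1)]] abs_le_D2[OF trefoil_param_near[OF that(2)]]])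
  qed
  thus ?thesis
    unfolding below_def using assms by (intro exI[of _ "?m / 10000"]) (auto simp: divide_le_eq mult.commute)
qed

text \<open>Only the existence of a constant matters, so the estimates are crude: 9 is the
  coefficient sum 3 + 4 + 2, and every entry of an axis vector is bounded by 1.\<close>

lemma trefoil_param_lipschitz: "\<exists>C. C-lipschitz_on X trefoil_param"
proof -
  have b: "\<bar>w \<bullet> trefoil' t\<bar> \<le> 9 * (\<bar>w $ 1\<bar> + \<bar>w $ 2\<bar> + \<bar>w $ 3\<bar>)" for w t
  proof -
    have 1: "\<bar>sin (3 * t) * cos (2 * t)\<bar> \<le> 1" "\<bar>sin (3 * t) * sin (2 * t)\<bar> \<le> 1"
      "\<bar>cos (3 * t) * sin (2 * t)\<bar> \<le> 1" "\<bar>cos (3 * t) * cos (2 * t)\<bar> \<le> 1"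
      by (simp_all add: abs_mult mult_le_one)
    have 2: "\<bar>sin (2 * t)\<bar> \<le> 1" "\<bar>cos (2 * t)\<bar> \<le> 1" "\<bar>cos (3 * t)\<bar> \<le> 1" by simp_all
    have eq: "- 3 * sin (3 * t) * cos (2 * t) - 2 * (2 + cos (3 * t)) * sin (2 * t) =
        - 3 * (sin (3 * t) * cos (2 * t)) - 4 * sin (2 * t) - 2 * (cos (3 * t) * sin (2 * t))"
      "- 3 * sin (3 * t) * sin (2 * t) + 2 * (2 + cos (3 * t)) * cos (2 * t) =
        - 3 * (sin (3 * t) * sin (2 * t)) + 4 * cos (2 * t) + 2 * (cos (3 * t) * cos (2 * t))"
      by (simp_all add: algebra_simps)
    have "\<bar>w \<bullet> trefoil' t\<bar> \<le>
        \<bar>w $ 1\<bar> * \<bar>- 3 * sin (3 * t) * cos (2 * t) - 2 * (2 + cos (3 * t)) * sin (2 * t)\<bar> +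
        \<bar>w $ 2\<bar> * \<bar>- 3 * sin (3 * t) * sin (2 * t) + 2 * (2 + cos (3 * t)) * cos (2 * t)\<bar> +
        \<bar>w $ 3\<bar> * \<bar>- 3 * cos (3 * t)\<bar>"
      unfolding trefoil'_def inner_vec3 abs_mult[of "w $ _", symmetric] by linarith
    also have "\<dots> \<le> \<bar>w $ 1\<bar> * 9 + \<bar>w $ 2\<bar> * 9 + \<bar>w $ 3\<bar> * 9"
    proof (intro add_mono mult_left_mono abs_ge_zero)
      have comb: "\<bar>- 3 * a - 4 * b - 2 * c\<bar> \<le> 9" "\<bar>- 3 * a + 4 * b + 2 * c\<bar> \<le> 9"
        if "\<bar>a\<bar> \<le> 1" "\<bar>b\<bar> \<le> 1" "\<bar>c\<bar> \<le> 1" for a b c :: real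
        using that by (auto simp: abs_le_iff)
      show "\<bar>- 3 * sin (3 * t) * cos (2 * t) - 2 * (2 + cos (3 * t)) * sin (2 * t)\<bar> \<le> 9"
        unfolding eq by (rule comb(1)[OF 1(1) 2(1) 1(3)])
      show "\<bar>- 3 * sin (3 * t) * sin (2 * t) + 2 * (2 + cos (3 * t)) * cos (2 * t)\<bar> \<le> 9"
        unfolding eq by (rule comb(2)[OF 1(2) 2(2) 1(4)])
      show "\<bar>- 3 * cos (3 * t)\<bar> \<le> 9" using 2 by linarith
    qed
    finally show ?thesis by simp
  qed
  have coord: "\<bar>w \<bullet> trefoil_param s - w \<bullet> trefoil_param t\<bar> \<le>
      pi / 12 * (9 * (\<bar>w $ 1\<bar> + \<bar>w $ 2\<bar> + \<bar>w $ 3\<bar>)) * \<bar>s - t\<bar>" for w s t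
    using field_differentiable_bound[of UNIV "\<lambda>t. w \<bullet> trefoil_param t"
        "\<lambda>t. pi / 12 * (w \<bullet> trefoil' (pi / 12 * (t + 35 / 2)))"
        "pi / 12 * (9 * (\<bar>w $ 1\<bar> + \<bar>w $ 2\<bar> + \<bar>w $ 3\<bar>))" s t] DERIV_trefoil_param b
    by (simp add: abs_mult)
  have "(81 * pi / 12)-lipschitz_on X trefoil_param"
  proof (rule lipschitz_onI)
    fix s t
    have "norm (trefoil_param s - trefoil_param t) \<le> (\<Sum>i\<in>UNIV. \<bar>(trefoil_param s - trefoil_param t) $ i\<bar>)"
      by (rule norm_le_l1_cart)
    also have "\<dots> \<le> (\<Sum>i\<in>(UNIV :: 3 set). pi / 12 * 27 * \<bar>s - t\<bar>)"
    proof (rule sum_mono)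
      fix i :: 3
      note coord[of "axis i 1" s t]
      also have "pi / 12 * (9 * (\<bar>(axis i 1 :: real ^ 3) $ 1\<bar> + \<bar>(axis i 1 :: real ^ 3) $ 2\<bar> + \<bar>(axis i 1 :: real ^ 3) $ 3\<bar>)) * \<bar>s - t\<bar>
          \<le> pi / 12 * (9 * (1 + 1 + 1)) * \<bar>s - t\<bar>"
        by (intro mult_right_mono mult_left_mono add_mono) (auto simp: axis_def)
      finally show "\<bar>(trefoil_param s - trefoil_param t) $ i\<bar> \<le> pi / 12 * 27 * \<bar>s - t\<bar>"
        by (simp add: inner_axis' )
    qed
    finally show "dist (trefoil_param s) (trefoil_param t) \<le> 81 * pi / 12 * dist s t"
      by (simp add: dist_norm)
  qed simp
  thus ?thesis by blast
qed

lemma trefoil_periodic: "trefoil (t + 2 * pi) = trefoil t"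
proof -
  have "cos (3 * (t + 2 * pi)) = cos (3 * t)" "sin (3 * (t + 2 * pi)) = sin (3 * t)"
    "cos (2 * (t + 2 * pi)) = cos (2 * t)" "sin (2 * (t + 2 * pi)) = sin (2 * t)"
    using cos_2npi[of 3] sin_2npi[of 3] cos_2npi[of 2] sin_2npi[of 2]
    by (simp_all add: distrib_left cos_add sin_add)
  thus ?thesis by (simp add: trefoil_def)
qed

text \<open>The 24 arcs of length pi/12 make up one period, which begins at the angle
  \<open>a\<close> instead of 0.\<close>

lemma trefoil_param_image: "trefoil_param ` {0..24} = standard_trefoil (- 1)"
proof -
  define a where "a = pi / 12 * (35 / 2)"
  have a: "0 \<le> a" "a \<le> 2 * pi" by (simp_all add: a_def)
  have std: "standard_trefoil (- 1) = trefoil ` {0..2 * pi}"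
    by (simp add: standard_trefoil_def trefoil_def)
  have "trefoil_param ` {0..24} = trefoil ` (\<lambda>t. pi / 12 * t + a) ` {0..24}"
    by (simp add: trefoil_param_def a_def image_image algebra_simps)
  also have "(\<lambda>t. pi / 12 * t + a) ` {0..24} = {a..2 * pi + a}"
    using image_affinity_atLeastAtMost[of "pi / 12" a 0 24] by simp
  also have "trefoil ` {a..2 * pi + a} = trefoil ` {0..2 * pi}"
  proof (intro subset_antisym image_subsetI)
    fix t assume t: "t \<in> {a..2 * pi + a}"
    show "trefoil t \<in> trefoil ` {0..2 * pi}"
    proof (cases "t \<le> 2 * pi")
      case True
      thus ?thesis using t a by auto
    next
      case False
      hence "t - 2 * pi \<in> {0..2 * pi}" using t a by auto
      thus ?thesis using trefoil_periodic[of "t - 2 * pi"] by (metis diff_add_cancel imageI)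
    qed
  next
    fix t assume t: "t \<in> {0..2 * pi}"
    show "trefoil t \<in> trefoil ` {a..2 * pi + a}"
    proof (cases "a \<le> t")
      case True
      thus ?thesis using t a by auto
    next
      case False
      hence "t + 2 * pi \<in> {a..2 * pi + a}" using t a by auto
      thus ?thesis using trefoil_periodic[of t] by (metis imageI)
    qed
  qed
  finally show ?thesis using std by simp
qed

lemma trefoil_param_closed: "trefoil_param 24 = trefoil_param 0"
  using trefoil_periodic[of "pi / 12 * (35 / 2)"] by (simp add: trefoil_param_def algebra_simps)

section \<open>Verifying directions by integer arithmetic\<close>

text \<open>Row \<open>k\<close> of the table starts with the direction for the pair \<open>(k, k)\<close>; the entry for \<open>(k, k + 1)\<close> is an
  unused zero vector.\<close>

definition dirs :: "ivec list list \<Rightarrow> nat \<Rightarrow> nat \<Rightarrow> real ^ 3" where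
  "dirs ws k l = vec_of (ws ! k ! (l - k))"

text \<open>The cyclic successor without a division, for use in the evaluated checks.\<close>

definition cyc_Suc :: "nat \<Rightarrow> nat \<Rightarrow> nat" where
  "cyc_Suc n k = (if Suc k = n then 0 else Suc k)"

lemma cyc_Suc: "k < n \<Longrightarrow> cyc_Suc n k = Suc k mod n"
  by (auto simp: cyc_Suc_def)

fun ascending :: "ivec \<Rightarrow> ivec list \<Rightarrow> bool" where
  "ascending w (a # b # xs) \<longleftrightarrow> 0 < idot w (b - a) \<and> ascending w (b # xs)"
| "ascending w _ \<longleftrightarrow> True"

definition all_less :: "int list \<Rightarrow> int list \<Rightarrow> bool" where
  "all_less xs ys \<longleftrightarrow> list_all (\<lambda>x. list_all (\<lambda>y. x < y) ys) xs"

text \<open>The range starts at \<open>k + 2\<close> and the disjunct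
  \<open>Suc l = k + length Qs\<close> exempts the first and the last arc: adjacent arcs cannot be
  strictly separated and are covered by the two \<open>ascending\<close> conditions.\<close>

definition hull_check :: "ivec list list \<Rightarrow> ivec list list \<Rightarrow> bool" where
  "hull_check ws Qs \<longleftrightarrow> list_all (\<lambda>k.
      2 \<le> length (Qs ! k) \<and> last (Qs ! k) = hd (Qs ! cyc_Suc (length Qs) k) \<and>
      ascending (ws ! k ! 0) (Qs ! k) \<and> ascending (ws ! k ! 0) (Qs ! cyc_Suc (length Qs) k) \<and>
      list_all (\<lambda>l. Suc l = k + length Qs \<or>
          all_less (map (idot (ws ! k ! (l - k))) (Qs ! k)) (map (idot (ws ! k ! (l - k))) (Qs ! l)))
        [Suc (Suc k)..<length Qs])
    [0..<length Qs]"

text \<open>All denominators from subdivision are collected in the single factor \<open>c\<close>. A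
  positive factor does not affect the strict inequalities, so these can be tested on the integer
  lists.\<close>

definition realize :: "real \<Rightarrow> ivec list \<Rightarrow> (real ^ 3) list" where
  "realize c Q = map (\<lambda>v. c *\<^sub>R vec_of v) Q"

lemma ascending_nth: "ascending w Q \<Longrightarrow> Suc i < length Q \<Longrightarrow> 0 < idot w (Q ! Suc i - Q ! i)"
proof (induction w Q arbitrary: i rule: ascending.induct)
  case (1 w a b xs)
  thus ?case by (cases i) auto
qed auto

text \<open>Forgetting the parametrization allows the same polygon to be handled with different
  numbers of arcs and different tables, so that isotopies can be chained at it.\<close>

definition guidable :: "nat \<Rightarrow> (nat \<Rightarrow> nat \<Rightarrow> real ^ 3) \<Rightarrow> (real ^ 3) set \<Rightarrow> bool" where
  "guidable n W S \<longleftrightarrow> n > 0 \<and> (\<exists>\<gamma>. guided n W \<gamma> \<and> \<gamma> ` {0..real n} = S)"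

lemma guidable_ambient_isotopic: "guidable n W S \<Longrightarrow> guidable n W T \<Longrightarrow> ambient_isotopic S T"
  unfolding guidable_def using guided_ambient_isotopic by blast

lemma guidable_knot: "guidable n W S \<Longrightarrow> knot S"
  unfolding guidable_def using guided_knot by blast

text \<open>The arc \<open>f Q\<close> is left open: one successful \<open>hull_check\<close> yields
  both the polygon and the Bezier curve.\<close>

lemma hull_check_guidable:
  assumes check: "hull_check ws Qs" and c: "c > 0" and ne: "Qs \<noteq> []"
    and f: "\<And>Q. Q \<in> set Qs \<Longrightarrow> length Q \<ge> 2 \<Longrightarrow> controlled (realize c Q) (f Q)"
  shows "guidable (length Qs) (dirs ws) (\<Union>Q\<in>set Qs. f Q ` {0..1})"
proof -
  let ?n = "length Qs"
  have n: "?n > 0" using ne by simp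
  have len: "2 \<le> length (Qs ! k)" and join: "last (Qs ! k) = hd (Qs ! (Suc k mod ?n))"
    and asc: "ascending (ws ! k ! 0) (Qs ! k)" "ascending (ws ! k ! 0) (Qs ! (Suc k mod ?n))" if "k < ?n" for k
    using check that by (auto simp: hull_check_def list_all_iff cyc_Suc)
  have far: "idot (ws ! k ! (l - k)) a < idot (ws ! k ! (l - k)) b"
    if "Suc k < l" "l < ?n" "Suc l \<noteq> k + ?n" "a \<in> set (Qs ! k)" "b \<in> set (Qs ! l)" for k l a b
  proof -
    have "k < ?n" using that by simp
    hence "\<forall>l\<in>{Suc (Suc k)..<?n}. Suc l = k + ?n \<or>
        all_less (map (idot (ws ! k ! (l - k))) (Qs ! k)) (map (idot (ws ! k ! (l - k))) (Qs ! l))"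
      using check by (simp add: hull_check_def list_all_iff)
    from bspec[OF this, of l] that show ?thesis
      by (simp add: all_less_def list_all_iff)
  qed
  have ne': "Qs ! k \<noteq> []" if "k < ?n" for k using len[OF that] by auto
  have "guided ?n (dirs ws) (pieces ?n (\<lambda>k. f (Qs ! k))) \<and> joined ?n (\<lambda>k. f (Qs ! k))"
  proof (rule controlled_guided[where Q = "\<lambda>k. realize c (Qs ! k)"])
    show "controlled (realize c (Qs ! k)) (f (Qs ! k))" if "k < ?n" for k
      using f len that by simp
    show "realize c (Qs ! k) \<noteq> []" if "k < ?n" for k
      using ne'[OF that] by (simp add: realize_def)
    show "last (realize c (Qs ! k)) = hd (realize c (Qs ! (Suc k mod ?n)))" if "k < ?n" for k
      using ne'[OF that] ne'[of "Suc k mod ?n"] join[OF that] n by (simp add: realize_def last_map hd_map)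
    show "0 < dirs ws k k \<bullet> (realize c (Qs ! j) ! Suc i - realize c (Qs ! j) ! i)"
      if "k < ?n" "j = k \<or> j = Suc k mod ?n" "Suc i < length (realize c (Qs ! j))" for k j i
    proof -
      have i: "Suc i < length (Qs ! j)" using that by (simp add: realize_def)
      have "0 < idot (ws ! k ! 0) (Qs ! j ! Suc i - Qs ! j ! i)"
        using asc[OF that(1)] that(2) i by (auto intro: ascending_nth)
      hence "0 < vec_of (ws ! k ! 0) \<bullet> vec_of (Qs ! j ! Suc i - Qs ! j ! i)"
        by (simp add: inner_vec_of)
      thus ?thesis
        using i c by (simp add: realize_def dirs_def vec_of_diff flip: scaleR_diff_right)
    qed
    show "dirs ws k l \<bullet> a < dirs ws k l \<bullet> b"
      if kl: "Suc k < l" "l < ?n" "Suc l \<noteq> k + ?n" and a: "a \<in> set (realize c (Qs ! k))"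
        and b: "b \<in> set (realize c (Qs ! l))" for k l a b
      using a b far[OF kl] c by (auto simp: realize_def dirs_def inner_vec_of)
  qed (use n in auto)
  moreover have "pieces ?n (\<lambda>k. f (Qs ! k)) ` {0..real ?n} = (\<Union>Q\<in>set Qs. f Q ` {0..1})"
    if "joined ?n (\<lambda>k. f (Qs ! k))"
    unfolding pieces_image[OF that n] by (auto simp: set_conv_nth)
  ultimately show ?thesis
    unfolding guidable_def using n by blast
qed

lemma hull_check_pl_curve:
  assumes "hull_check ws Qs" "c > 0" "Qs \<noteq> []"
  shows "guidable (length Qs) (dirs ws) (\<Union>Q\<in>set Qs. pl_curve (realize c Q))"
proof -
  have "length (realize c Q) \<ge> 2" if "Q \<in> set Qs" for Q
    using assms(1) that by (auto simp: hull_check_def list_all_iff realize_def set_conv_nth)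
  hence "(\<Union>Q\<in>set Qs. pl_curve (realize c Q)) = (\<Union>Q\<in>set Qs. polyline (realize c Q) ` {0..1})"
    by (simp add: polyline_image)
  thus ?thesis
    using hull_check_guidable[OF assms, of "\<lambda>Q. polyline (realize c Q)"]
    by (simp add: controlled_polyline realize_def)
qed

lemma hull_check_bezier_curve:
  assumes "hull_check ws Qs" "c > 0" "Qs \<noteq> []"
  shows "guidable (length Qs) (dirs ws) (\<Union>Q\<in>set Qs. bezier_curve (realize c Q))"
  using hull_check_guidable[OF assms, of "\<lambda>Q. bezier (realize c Q)"]
  by (simp add: controlled_bezier realize_def bezier_curve_def)

subsection \<open>Polygons\<close>

text \<open>Every edge becomes a control list of two points, so that \<open>hull_check\<close>
  treats a polygon as a curve with one arc per edge.\<close>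

fun edges :: "'a list \<Rightarrow> 'a list list" where
  "edges (a # b # xs) = [a, b] # edges (b # xs)"
| "edges _ = []"

lemma pl_curve_singleton: "pl_curve [a] = {}"
  by (simp add: pl_curve_def)

lemma pl_curve_Cons: "pl_curve (a # b # xs) = closed_segment a b \<union> pl_curve (b # xs)"
proof -
  have "{i. Suc i < length (a # b # xs)} = insert 0 (Suc ` {i. Suc i < length (b # xs)})"
    by (auto simp: image_iff gr0_conv_Suc less_Suc_eq_0_disj)
  thus ?thesis by (simp add: pl_curve_def image_image)
qed

lemma pl_curve_edges: "pl_curve (map f xs) = (\<Union>Q\<in>set (edges xs). pl_curve (map f Q))"
  by (induction xs rule: edges.induct) (auto simp: pl_curve_Cons pl_curve_singleton, auto simp: pl_curve_def)

definition scale :: "int \<Rightarrow> ivec \<Rightarrow> ivec" where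
  "scale c v = (case v of (x, y, z) \<Rightarrow> (c * x, c * y, c * z))"

lemma vec_of_scale: "vec_of (scale c v) = of_int c *\<^sub>R vec_of v"
  by (cases v) (simp add: vec_of_def scale_def vec3_eq_iff)

text \<open>The equation says that \<open>b\<close> divides the segment from \<open>a\<close> to
  \<open>c\<close> in the ratio \<open>j : 1\<close>. The refined octagons cut an edge into at most
  four equal parts; as inner vertices are removed from the left, the ratios 1, 2 and 3 occur in
  turn.\<close>

definition between :: "ivec \<Rightarrow> ivec \<Rightarrow> ivec \<Rightarrow> bool" where
  "between a b c \<longleftrightarrow> list_ex (\<lambda>j. scale j (c - b) = b - a) [1, 2, 3]"

fun straighten :: "ivec list \<Rightarrow> ivec list" where
  "straighten (a # b # c # xs) =
    (if between a b c then straighten (a # c # xs) else a # straighten (b # c # xs))"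
| "straighten xs = xs"

lemma between_closed_segment:
  assumes "between a b c"
  shows "vec_of b \<in> closed_segment (vec_of a) (vec_of c)"
proof -
  obtain j :: int where j: "j > 0" "scale j (c - b) = b - a"
    using assms that[of 1] that[of 2] that[of 3] by (auto simp: between_def)
  have "real_of_int j *\<^sub>R (vec_of c - vec_of b) = vec_of b - vec_of a"
    using arg_cong[OF j(2), of vec_of] by (simp add: vec_of_scale vec_of_diff)
  hence eq: "(1 + real_of_int j) *\<^sub>R vec_of b = vec_of a + real_of_int j *\<^sub>R vec_of c"
    by (simp add: algebra_simps)
  have "vec_of b = (1 / (1 + real_of_int j)) *\<^sub>R ((1 + real_of_int j) *\<^sub>R vec_of b)"
    using j(1) by simp
  also have "\<dots> = (1 / (1 + j)) *\<^sub>R vec_of a + (j / (1 + j)) *\<^sub>R vec_of c"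
    unfolding eq by (simp add: scaleR_add_right)
  also have "1 / (1 + j) = 1 - j / (1 + j)"
    using j(1) by (simp add: field_simps)
  finally have "vec_of b = (1 - j / (1 + j)) *\<^sub>R vec_of a + (j / (1 + j)) *\<^sub>R vec_of c" .
  thus ?thesis
    using j(1) unfolding in_segment by (intro exI[of _ "j / (1 + j)"]) (auto simp: divide_le_eq)
qed

lemma pl_curve_straighten: "pl_curve (map vec_of (straighten xs)) = pl_curve (map vec_of xs)"
proof (induction xs rule: straighten.induct)
  case (1 a b c xs)
  have hd: "\<exists>zs. straighten (y # ys) = y # zs" for y ys
    by (induction "y # ys" arbitrary: y ys rule: straighten.induct) auto
  show ?case
  proof (cases "between a b c")
    case True
    have "closed_segment (vec_of a) (vec_of c) =
        closed_segment (vec_of a) (vec_of b) \<union> closed_segment (vec_of b) (vec_of c)"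
      using Un_closed_segment[OF between_closed_segment[OF True]] by simp
    thus ?thesis
      using 1(1)[OF True] True by (simp add: pl_curve_Cons Un_assoc)
  next
    case False
    obtain zs where zs: "straighten (b # c # xs) = b # zs" using hd by blast
    show ?thesis
      using 1(2)[OF False] False by (simp add: zs pl_curve_Cons)
  qed
qed auto

lemma hull_check_polygon:
  assumes "hull_check ws (edges xs)" "edges xs \<noteq> []"
  shows "guidable (length (edges xs)) (dirs ws) (pl_curve (map vec_of xs))"
  using hull_check_pl_curve[OF assms(1) zero_less_one assms(2)]
  by (simp add: pl_curve_edges[of vec_of xs] realize_def)

subsection \<open>Subdivision of integer control polygons\<close>

fun mids :: "ivec list \<Rightarrow> ivec list" where
  "mids (a # b # xs) = (a + b) # mids (b # xs)"
| "mids _ = []"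

text \<open>Since \<open>mids\<close> forms sums instead of midpoints, row \<open>r\<close> of the
  scheme carries the factor \<open>2 ^ r\<close>. Scaling by the complementary power gives all
  entries of a list of length \<open>n + 1\<close> the common factor \<open>2 ^ n\<close>, and no
  fractions arise.\<close>

fun left_ints :: "nat \<Rightarrow> ivec list \<Rightarrow> ivec list" where
  "left_ints 0 xs = []"
| "left_ints (Suc m) xs = scale (2 ^ m) (hd xs) # left_ints m (mids xs)"

fun right_ints :: "nat \<Rightarrow> ivec list \<Rightarrow> ivec list" where
  "right_ints 0 xs = []"
| "right_ints (Suc m) xs = right_ints m (mids xs) @ [scale (2 ^ m) (last xs)]"

definition subdivide_ints :: "ivec list list \<Rightarrow> ivec list list" where
  "subdivide_ints Qs = concat (map (\<lambda>Q. [left_ints (length Q) Q, right_ints (length Q) Q]) Qs)"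

definition midpoints :: "'a::real_vector list \<Rightarrow> 'a list" where
  "midpoints Q = map (\<lambda>i. (1 / 2) *\<^sub>R (Q ! i + Q ! Suc i)) [0..<length Q - 1]"

text \<open>The counterpart of \<open>cast_Suc\<close> for lists: the scheme without its first row
  is the scheme of the midpoints, in agreement with the recursion of \<open>left_ints\<close> and
  \<open>right_ints\<close> over \<open>mids\<close>.\<close>

lemma casteljau_midpoints:
  assumes "k + Suc r < length Q"
  shows "casteljau Q (Suc r) k = casteljau (midpoints Q) r k"
  unfolding casteljau_eq_cast cast_Suc
proof (rule cast_cong)
  fix i assume "i \<le> k + r"
  hence "i < length Q - 1" using assms by simp
  thus "(1 / 2) *\<^sub>R (Q ! i + Q ! Suc i) = midpoints Q ! i" by (simp add: midpoints_def)
qed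

lemma left_half_midpoints:
  assumes "length Q = Suc (Suc n)"
  shows "left_half Q = hd Q # left_half (midpoints Q)"
proof -
  have "left_half Q = casteljau Q 0 0 # map (\<lambda>r. casteljau Q (Suc r) 0) [0..<Suc n]"
    unfolding left_half_def assms by (subst upt_conv_Cons) (auto simp: map_Suc_upt[symmetric] simp del: upt_Suc casteljau.simps)
  also have "map (\<lambda>r. casteljau Q (Suc r) 0) [0..<Suc n] = left_half (midpoints Q)"
    unfolding left_half_def
    by (rule map_cong) (use assms in \<open>auto simp: midpoints_def casteljau_midpoints simp del: casteljau.simps upt_Suc\<close>)
  finally show ?thesis using assms by (cases Q) auto
qed

lemma right_half_midpoints:
  assumes "length Q = Suc (Suc n)"
  shows "right_half Q = right_half (midpoints Q) @ [last Q]"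
proof -
  have "right_half Q = map (\<lambda>k. casteljau Q (Suc n - k) k) [0..<Suc n] @ [casteljau Q 0 (Suc n)]"
    unfolding right_half_def assms by (subst upt_Suc_append) auto
  also have "map (\<lambda>k. casteljau Q (Suc n - k) k) [0..<Suc n] = right_half (midpoints Q)"
    unfolding right_half_def
    by (rule map_cong) (use assms in \<open>auto simp: midpoints_def casteljau_midpoints Suc_diff_le simp del: casteljau.simps upt_Suc\<close>)
  also have "casteljau Q 0 (Suc n) = last Q"
    using assms by (cases Q) (auto simp: last_conv_nth)
  finally show ?thesis .
qed

lemma length_mids: "length (mids Q) = length Q - 1"
  by (induction Q rule: mids.induct) auto

lemma nth_mids: "Suc i < length Q \<Longrightarrow> mids Q ! i = Q ! i + Q ! Suc i"
  by (induction Q arbitrary: i rule: mids.induct) (auto simp: nth_Cons split: nat.splits)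

lemma midpoints_realize: "midpoints (realize c Q) = realize (c / 2) (mids Q)"
  by (rule nth_equalityI)
    (auto simp: midpoints_def realize_def length_mids nth_mids vec_of_add scaleR_add_right)

lemma left_half_realize:
  "length Q = Suc n \<Longrightarrow> left_half (realize c Q) = realize (c / 2 ^ n) (left_ints (Suc n) Q)"
proof (induction n arbitrary: c Q)
  case 0
  then obtain x where "Q = [x]" by (auto simp: length_Suc_conv)
  thus ?case by (simp add: left_half_def realize_def vec_of_scale)
next
  case (Suc n)
  have "left_half (realize c Q) = hd (realize c Q) # left_half (realize (c / 2) (mids Q))"
    using left_half_midpoints[of "realize c Q" n] Suc.prems by (simp add: midpoints_realize) (simp add: realize_def)
  also have "left_half (realize (c / 2) (mids Q)) = realize (c / 2 ^ Suc n) (left_ints (Suc n) (mids Q))"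
    using Suc.IH[of "mids Q" "c / 2"] Suc.prems by (simp add: length_mids)
  also have "hd (realize c Q) # realize (c / 2 ^ Suc n) (left_ints (Suc n) (mids Q)) =
      realize (c / 2 ^ Suc n) (left_ints (Suc (Suc n)) Q)"
    using Suc.prems by (cases Q) (auto simp: realize_def vec_of_scale simp del: power_Suc)
  finally show ?case .
qed

lemma right_half_realize:
  "length Q = Suc n \<Longrightarrow> right_half (realize c Q) = realize (c / 2 ^ n) (right_ints (Suc n) Q)"
proof (induction n arbitrary: c Q)
  case 0
  then obtain x where "Q = [x]" by (auto simp: length_Suc_conv)
  thus ?case by (simp add: right_half_def realize_def vec_of_scale)
next
  case (Suc n)
  have "right_half (realize c Q) = right_half (realize (c / 2) (mids Q)) @ [last (realize c Q)]"
    using right_half_midpoints[of "realize c Q" n] Suc.prems by (simp add: midpoints_realize) (simp add: realize_def)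
  also have "right_half (realize (c / 2) (mids Q)) = realize (c / 2 ^ Suc n) (right_ints (Suc n) (mids Q))"
    using Suc.IH[of "mids Q" "c / 2"] Suc.prems by (simp add: length_mids)
  also have "realize (c / 2 ^ Suc n) (right_ints (Suc n) (mids Q)) @ [last (realize c Q)] =
      realize (c / 2 ^ Suc n) (right_ints (Suc (Suc n)) Q)"
  proof -
    have "Q \<noteq> []" using Suc.prems by auto
    thus ?thesis by (simp add: realize_def vec_of_scale last_map del: power_Suc)
  qed
  finally show ?case .
qed

lemma length_left_ints: "length (left_ints m Q) = m"
  by (induction m arbitrary: Q) auto

lemma length_right_ints: "length (right_ints m Q) = m"
  by (induction m arbitrary: Q) auto

lemma subdivide_realize:
  assumes "\<forall>Q\<in>set Qs. length Q = Suc n"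
  shows "subdivide (map (realize c) Qs) = map (realize (c / 2 ^ n)) (subdivide_ints Qs)"
    and "\<forall>Q\<in>set (subdivide_ints Qs). length Q = Suc n"
proof -
  have "left_half (realize c Q) = realize (c / 2 ^ n) (left_ints (length Q) Q)"
      "right_half (realize c Q) = realize (c / 2 ^ n) (right_ints (length Q) Q)" if "Q \<in> set Qs" for Q
    using assms that left_half_realize[of Q n c] right_half_realize[of Q n c] by auto
  hence "map (\<lambda>Q. [left_half Q, right_half Q]) (map (realize c) Qs) =
      map (map (realize (c / 2 ^ n))) (map (\<lambda>Q. [left_ints (length Q) Q, right_ints (length Q) Q]) Qs)"
    by simp
  thus "subdivide (map (realize c) Qs) = map (realize (c / 2 ^ n)) (subdivide_ints Qs)"
    unfolding subdivide_def subdivide_ints_def map_concat by (rule arg_cong)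
  show "\<forall>Q\<in>set (subdivide_ints Qs). length Q = Suc n"
    using assms by (auto simp: subdivide_ints_def length_left_ints length_right_ints)
qed

lemma subdivide_iter_realize:
  assumes "length P = Suc n"
  shows "(subdivide ^^ m) [realize c P] = map (realize (c / (2 ^ n) ^ m)) ((subdivide_ints ^^ m) [P])"
proof -
  have "(subdivide ^^ m) [realize c P] = map (realize (c / (2 ^ n) ^ m)) ((subdivide_ints ^^ m) [P]) \<and>
      (\<forall>Q\<in>set ((subdivide_ints ^^ m) [P]). length Q = Suc n)"
  proof (induction m)
    case 0
    show ?case using assms by simp
  next
    case (Suc m)
    let ?Qs = "(subdivide_ints ^^ m) [P]"
    have "(subdivide ^^ Suc m) [realize c P] = subdivide (map (realize (c / (2 ^ n) ^ m)) ?Qs)"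
      using Suc.IH by simp
    also have "\<dots> = map (realize (c / (2 ^ n) ^ Suc m)) (subdivide_ints ?Qs)"
      using subdivide_realize(1)[of ?Qs n] Suc.IH by (simp add: mult.commute)
    finally show ?case
      using subdivide_realize(2)[of ?Qs n] Suc.IH by simp
  qed
  thus ?thesis ..
qed

subsection \<open>The arcs of the trefoil\<close>

definition rise_check :: "ivec \<Rightarrow> ivec \<times> ivec \<Rightarrow> bool" where
  "rise_check w a = (case w of (x, y, z) \<Rightarrow>
    28200 * (\<bar>x\<bar> + \<bar>y\<bar>) + 12100 * \<bar>z\<bar> < idot w (snd a))"

text \<open>The hypothesis of \<open>trefoil_param_below\<close> multiplied by 1000, which clears
  the fraction 131/1000. The pairs consist of centre and tangent.\<close>

definition below_check :: "ivec \<Rightarrow> ivec \<times> ivec \<Rightarrow> ivec \<times> ivec \<Rightarrow> bool" where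
  "below_check w a b = (case w of (x, y, z) \<Rightarrow>
    131 * (\<bar>idot w (snd a)\<bar> + \<bar>idot w (snd b)\<bar>) + 4100000 * (\<bar>x\<bar> + \<bar>y\<bar>) + 1640000 * \<bar>z\<bar>
      < 1000 * (idot w (fst b - fst a)))"

definition trefoil_check :: "ivec list list \<Rightarrow> (ivec \<times> ivec) list \<Rightarrow> bool" where
  "trefoil_check ws as \<longleftrightarrow> list_all (\<lambda>k.
      rise_check (ws ! k ! 0) (as ! k) \<and> rise_check (ws ! k ! 0) (as ! cyc_Suc (length as) k) \<and>
      list_all (\<lambda>l. Suc l = k + length as \<or> below_check (ws ! k ! (l - k)) (as ! k) (as ! l))
        [Suc (Suc k)..<length as])
    [0..<length as]"

lemma rise_check_rises:
  assumes "rise_check w (arc_centre j, arc_tangent j)"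
  shows "rises (vec_of w) trefoil_param j"
proof (rule trefoil_param_rises)
  obtain x y z where w: "w = (x, y, z)" by (cases w)
  have "28200 * (\<bar>x\<bar> + \<bar>y\<bar>) + 12100 * \<bar>z\<bar> < idot w (arc_tangent j)"
    using assms by (simp add: rise_check_def w)
  hence "real_of_int (28200 * (\<bar>x\<bar> + \<bar>y\<bar>) + 12100 * \<bar>z\<bar>) < real_of_int (idot w (arc_tangent j))"
    by (simp only: of_int_less_iff)
  thus "0 < vec_of w \<bullet> vec_of (arc_tangent j) - 28200 * (\<bar>vec_of w $ 1\<bar> + \<bar>vec_of w $ 2\<bar>) - 12100 * \<bar>vec_of w $ 3\<bar>"
    unfolding inner_vec_of by (simp add: w vec_of_def)
qed

lemma below_check_below:
  assumes "below_check w (arc_centre k, arc_tangent k) (arc_centre l, arc_tangent l)"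
  shows "below (vec_of w) trefoil_param k l"
proof (rule trefoil_param_below)
  obtain x y z where w: "w = (x, y, z)" by (cases w)
  let ?t = "\<lambda>j. idot w (arc_tangent j)"
  have "131 * (\<bar>?t k\<bar> + \<bar>?t l\<bar>) + 4100000 * (\<bar>x\<bar> + \<bar>y\<bar>) + 1640000 * \<bar>z\<bar> < 1000 * idot w (arc_centre l - arc_centre k)"
    using assms by (simp add: below_check_def w)
  hence "real_of_int (131 * (\<bar>?t k\<bar> + \<bar>?t l\<bar>) + 4100000 * (\<bar>x\<bar> + \<bar>y\<bar>) + 1640000 * \<bar>z\<bar>) <
      real_of_int (1000 * idot w (arc_centre l - arc_centre k))"
    by (simp only: of_int_less_iff)
  moreover have "real_of_int (idot w (arc_centre l - arc_centre k)) =
      real_of_int (idot w (arc_centre l)) - real_of_int (idot w (arc_centre k))"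
    by (simp only: inner_vec_of[symmetric] vec_of_diff inner_diff_right)
  ultimately show "0 < (vec_of w \<bullet> vec_of (arc_centre l) - 131 / 1000 * \<bar>vec_of w \<bullet> vec_of (arc_tangent l)\<bar>) -
      (vec_of w \<bullet> vec_of (arc_centre k) + 131 / 1000 * \<bar>vec_of w \<bullet> vec_of (arc_tangent k)\<bar>) -
      4100 * (\<bar>vec_of w $ 1\<bar> + \<bar>vec_of w $ 2\<bar>) - 1640 * \<bar>vec_of w $ 3\<bar>"
    unfolding inner_vec_of by (simp add: w vec_of_def)
qed

lemma trefoil_check_guidable:
  assumes check: "trefoil_check ws (map (\<lambda>j. (arc_centre j, arc_tangent j)) [0..<24])"
  shows "guidable 24 (dirs ws) (standard_trefoil (- 1))"
proof -
  define as where "as = map (\<lambda>j. (arc_centre j, arc_tangent j)) [0..<24]"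
  have as: "as ! j = (arc_centre j, arc_tangent j)" if "j < 24" for j
    using that by (simp add: as_def)
  have len: "length as = 24" by (simp add: as_def)
  have rows: "rise_check (ws ! k ! 0) (as ! k) \<and> rise_check (ws ! k ! 0) (as ! cyc_Suc 24 k) \<and>
      (\<forall>l\<in>{Suc (Suc k)..<24}. Suc l = k + 24 \<or> below_check (ws ! k ! (l - k)) (as ! k) (as ! l))"
    if "k < 24" for k
    using check that unfolding as_def[symmetric] trefoil_check_def len list_all_iff by simp
  have "guided 24 (dirs ws) trefoil_param"
    unfolding guided_def
  proof (intro conjI allI impI)
    show "trefoil_param (real 24) = trefoil_param 0" using trefoil_param_closed by simp
    fix k :: nat assume k: "k < 24"
    show "\<exists>C. C-lipschitz_on (unit_arc k) trefoil_param" by (rule trefoil_param_lipschitz)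
    have "Suc k mod 24 < 24" by simp
    thus "rises (dirs ws k k) trefoil_param k" "rises (dirs ws k k) trefoil_param (Suc k mod 24)"
      using rows[OF k] k unfolding dirs_def diff_self_eq_0
      by (simp_all add: as cyc_Suc rise_check_rises)
  next
    fix k l :: nat assume kl: "Suc k < l" "l < 24" "Suc l \<noteq> k + 24"
    have "k < 24" using kl by simp
    with rows[OF this] kl have "below_check (ws ! k ! (l - k)) (as ! k) (as ! l)" by auto
    thus "below (dirs ws k l) trefoil_param k l"
      unfolding dirs_def using as[OF \<open>k < 24\<close>] as[OF kl(2)] by (simp add: below_check_below)
  qed
  thus ?thesis
    unfolding guidable_def using trefoil_param_image by (intro conjI exI[of _ trefoil_param]) auto
qed

section \<open>The certificate\<close>

definition control_ints :: "ivec list" where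
  "control_ints =
    [(0, 9, 20), (- 15, - 95, - 50), (40, 80, - 20), (10, - 60, 58), (- 60, 30, 20), (40, - 60, - 60),
    (0, 9, 20)]"

definition control_hulls :: "ivec list list" where
  "control_hulls = (subdivide_ints ^^ 4) [control_ints]"

text \<open>The octagons interpolate between an octagon inscribed in the curve and one inscribed in the trefoil;
  both were found numerically to flow to the same shape under the gradient of the minimum distance
  energy. The directions are rounded nearest-point vectors of the convex sets to be separated.\<close>

definition octagon1 :: "ivec list" where
  "octagon1 =
    [(- 36, 180, 156), (- 24, - 60, - 12), (36, - 96, - 132), (60, 0, - 72), (- 12, 24, 60),
    (- 48, - 12, 36), (- 48, - 36, - 12), (72, 12, - 24), (- 36, 180, 156)]"

definition octagon2 :: "ivec list" where
  "octagon2 =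
    [(- 95, 174, 115), (- 5, - 67, - 10), (78, - 97, - 116), (55, 19, - 65), (- 15, 21, 70),
    (- 59, - 27, 39), (- 38, - 32, - 36), (79, 9, 4), (- 95, 174, 115)]"

definition octagon3 :: "ivec list" where
  "octagon3 =
    [(- 149, 128, 8), (15, - 78, 14), (135, - 62, - 50), (41, 55, - 53), (- 39, 14, 75), (- 85, - 64, 19),
    (- 3, - 50, - 63), (84, 57, 50), (- 149, 128, 8)]"

definition octagon4 :: "ivec list" where
  "octagon4 =
    [(- 108, 48, - 63), (18, - 75, 42), (141, 0, 18), (36, 78, - 63), (- 87, 6, 63), (- 69, - 123, - 18),
    (57, - 54, - 42), (12, 120, 63), (- 108, 48, - 63)]"

text \<open>Additional vertices on the edges match the 16 arcs of the curve and the 24 arcs of the trefoil.\<close>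

definition octagon1_16 :: "ivec list" where
  "octagon1_16 =
    [(- 36, 180, 156), (- 24, - 60, - 12), (6, - 78, - 72), (36, - 96, - 132), (48, - 48, - 102),
    (60, 0, - 72), (36, 8, - 28), (12, 16, 16), (- 12, 24, 60), (- 30, 6, 48), (- 48, - 12, 36),
    (- 48, - 36, - 12), (- 18, - 24, - 15), (12, - 12, - 18), (42, 0, - 21), (72, 12, - 24),
    (- 36, 180, 156)]"

definition octagon4_24 :: "ivec list" where
  "octagon4_24 =
    [(- 108, 48, - 63), (- 66, 7, - 28), (- 24, - 34, 7), (18, - 75, 42), (59, - 50, 34), (100, - 25, 26),
    (141, 0, 18), (106, 26, - 9), (71, 52, - 36), (36, 78, - 63), (- 5, 54, - 21), (- 46, 30, 21),
    (- 87, 6, 63), (- 81, - 37, 36), (- 75, - 80, 9), (- 69, - 123, - 18), (- 27, - 100, - 26),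
    (15, - 77, - 34), (57, - 54, - 42), (42, 4, - 7), (27, 62, 28), (12, 120, 63), (- 28, 96, 21),
    (- 68, 72, - 21), (- 108, 48, - 63)]"

text \<open>One table for three curves: the Bezier curve, its subdivided polygon and the refined
  first octagon. The last row serves the corner at the base point, where the arriving direction
  (-40, 69, 80) and the departing direction (-15, -104, -70) enclose an obtuse angle; (-5, -2, 1)
  has a positive inner product with both.\<close>

definition dirs_curve :: "ivec list list" where
  "dirs_curve = [
    [(0, - 1, - 1), (0, 0, 0), (0, 0, - 1), (1, 0, - 1), (1, 0, - 1), (1, 1, - 1), (1, 0, - 1), (1, 0, 0),
     (2, - 3, 4), (- 1, - 2, 3), (- 1, 0, 0), (- 3, 1, - 2), (1, 1, - 2), (1, 1, - 1), (1, 0, 0)],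
    [(1, 0, - 1), (0, 0, 0), (1, 1, - 1), (1, 1, - 1), (1, 1, 0), (1, 1, 0), (1, 1, 1), (0, 1, 1),
     (0, 1, 1), (- 1, 1, 1), (- 1, 2, - 1), (0, 2, - 1), (1, 1, 0), (1, 1, 0), (1, 1, 0)],
    [(1, 1, 0), (0, 0, 0), (1, 1, 0), (1, 1, 0), (0, 1, 1), (0, 1, 1), (0, 1, 1), (0, 1, 1), (- 1, 1, 1),
     (0, 1, 1), (0, 1, 1), (0, 1, 1), (1, 1, 1), (1, 1, 1)],
    [(0, 1, 1), (0, 0, 0), (0, 1, 1), (0, 1, 1), (0, 1, 1), (- 1, 0, 1), (- 1, 0, 1), (- 1, 0, 1),
     (- 1, 0, 1), (- 1, 0, 1), (0, - 1, 1), (1, 0, 1), (0, 1, 1)],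
    [(0, 1, 1), (0, 0, 0), (0, 0, 1), (0, 0, 1), (0, 0, 1), (- 1, 0, 1), (- 1, 0, 1), (- 1, 0, 1),
     (- 1, - 1, 1), (0, - 1, 1), (0, - 1, 1), (0, 0, 1)],
    [(0, 0, 1), (0, 0, 0), (- 1, 0, 1), (- 1, 0, 1), (- 1, 0, 1), (- 1, 0, 0), (- 1, - 1, 0),
     (- 1, - 1, 0), (1, - 2, 1), (1, - 1, 1), (2, 0, 1)],
    [(- 1, 0, 1), (0, 0, 0), (- 1, 0, 1), (- 1, 0, 1), (- 1, - 1, 0), (- 1, - 1, 0), (- 1, - 1, 0),
     (0, - 1, 0), (1, - 1, 0), (2, 1, 0)],
    [(- 1, 0, 0), (0, 0, 0), (- 1, - 1, 0), (- 1, - 1, 0), (- 1, - 1, - 1), (0, - 1, - 1), (0, - 1, - 1),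
     (1, 0, - 1), (1, 1, 0)],
    [(- 1, - 1, 0), (0, 0, 0), (- 1, - 1, - 1), (0, - 1, - 1), (0, - 1, - 1), (1, 0, - 1), (1, 0, - 1),
     (1, 1, - 1)],
    [(0, - 1, - 1), (0, 0, 0), (0, - 1, - 1), (0, 0, - 1), (1, 0, - 1), (1, 0, - 1), (1, 1, 0)],
    [(1, 0, - 1), (0, 0, 0), (1, 0, - 1), (1, 0, - 1), (1, 0, 0), (1, 1, 0)],
    [(1, 0, - 1), (0, 0, 0), (1, 0, 0), (1, 0, 0), (1, 1, 0)],
    [(1, 0, 0), (0, 0, 0), (1, 0, 0), (1, 1, 0)],
    [(1, 1, 0), (0, 0, 0), (1, 1, 0)],
    [(1, 1, 1), (0, 0, 0)],
    [(- 5, - 2, 1), (0, 0, 0)]]"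

definition dirs_12 :: "ivec list list" where
  "dirs_12 = [
    [(0, - 1, - 1), (0, 0, 0), (1, 0, - 1), (4, - 1, 2), (0, - 2, 3), (- 4, - 2, 1), (0, 1, - 2)],
    [(0, 1, - 1), (0, 0, 0), (0, 1, 0), (0, 1, 1), (- 1, 1, 0), (0, 1, 0), (1, 1, 0)],
    [(0, 1, 1), (0, 0, 0), (- 1, 0, 1), (- 1, 0, 1), (0, 0, 1), (0, 0, 1)],
    [(- 1, 0, 0), (0, 0, 0), (- 1, - 1, 0), (1, - 3, 1), (1, 1, 0)],
    [(0, - 1, - 1), (0, 0, 0), (0, 0, - 1), (1, 1, - 1)],
    [(1, 0, - 1), (0, 0, 0), (1, 1, 0)],
    [(0, 1, 0), (0, 0, 0)],
    [(- 1, - 1, 1), (0, 0, 0)]]"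

definition dirs_23 :: "ivec list list" where
  "dirs_23 = [
    [(1, - 1, - 1), (0, 0, 0), (1, 1, - 1), (6, 2, 3), (- 1, - 2, 3), (- 4, - 3, - 1), (1, 1, - 1)],
    [(0, 1, - 1), (0, 0, 0), (0, 1, 0), (- 1, 1, 0), (- 1, 1, - 1), (0, 1, 0), (0, 1, 0)],
    [(- 1, 1, 1), (0, 0, 0), (- 1, 0, 1), (- 1, - 1, 0), (- 1, 0, 1), (0, 0, 1)],
    [(- 1, - 1, 0), (0, 0, 0), (- 1, - 1, 0), (2, - 4, 1), (2, 5, 1)],
    [(0, 0, - 1), (0, 0, 0), (1, 0, - 1), (1, 1, - 1)],
    [(1, 1, 0), (0, 0, 0), (1, 1, 0)],
    [(0, 1, 0), (0, 0, 0)],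
    [(- 1, - 1, 1), (0, 0, 0)]]"

definition dirs_34 :: "ivec list list" where
  "dirs_34 = [
    [(1, 0, 0), (0, 0, 0), (1, 1, - 1), (2, 3, 2), (- 1, - 1, 1), (- 1, - 2, - 1), (1, 1, - 1)],
    [(0, 1, - 1), (0, 0, 0), (- 1, 1, 0), (- 1, 0, 0), (- 1, 0, - 1), (- 1, 1, - 1), (0, 1, 0)],
    [(- 1, 0, 0), (0, 0, 0), (- 1, - 1, 1), (- 1, - 1, 0), (- 1, - 1, 1), (- 1, 0, 1)],
    [(0, - 1, 0), (0, 0, 0), (0, - 1, 0), (4, - 3, 2), (- 1, 4, 1)],
    [(1, 0, - 1), (0, 0, 0), (1, 1, - 1), (0, 1, - 1)],
    [(1, 1, 0), (0, 0, 0), (0, 1, 0)],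
    [(- 1, 1, 0), (0, 0, 0)],
    [(- 1, - 2, 1), (0, 0, 0)]]"

text \<open>The direction (-6, -1, 0) of row 11 is a tight compromise: it must exceed the error
  margin of the trefoil on arcs 11 and 12, and still increase along edge 12 of the octagon, where
  the increment is only 7.\<close>

definition dirs_trefoil :: "ivec list list" where
  "dirs_trefoil = [
    [(1, 0, 0), (0, 0, 0), (1, 0, 1), (1, 0, 1), (1, 0, 1), (1, 0, 1), (1, 0, 0), (1, 1, 0), (1, 1, 0),
     (1, 1, 0), (1, 1, 1), (0, 0, 1), (0, 0, 1), (0, 0, 1), (0, - 1, 1), (0, - 1, 0), (1, - 1, 0),
     (1, 0, 0), (1, 0, 0), (1, 0, 1), (1, 1, 1), (1, 1, 1), (0, 1, 0)],
    [(0, 0, 1), (0, 0, 0), (0, 0, 1), (1, 0, 1), (1, 0, 1), (1, 0, 0), (1, 1, 0), (0, 1, 0), (0, 1, 0),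
     (0, 1, 1), (0, 1, 1), (- 1, 0, 1), (- 1, - 1, 1), (0, - 1, 0), (0, - 1, 0), (1, - 1, - 1), (1, 0, 0),
     (1, 0, 0), (1, 0, 1), (1, 1, 1), (0, 1, 1), (0, 1, 0), (- 1, 1, 0)],
    [(1, 0, 1), (0, 0, 0), (1, 0, 1), (1, 0, 0), (1, 0, 0), (1, 1, 0), (0, 1, 0), (0, 1, 0), (0, 1, 0),
     (0, 1, 0), (- 1, 1, 1), (- 1, 0, 0), (- 1, - 1, 0), (0, - 1, - 1), (1, 0, - 1), (1, 0, - 1),
     (1, 1, 0), (1, 1, 0), (1, 1, 0), (0, 1, 0), (0, 1, 0), (- 1, 1, 0)],
    [(1, 0, 1), (0, 0, 0), (1, 0, 0), (1, 0, 0), (1, 1, - 1), (0, 1, - 1), (0, 1, 0), (0, 1, 0), (0, 1, 0),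
     (- 1, 1, 0), (- 1, 0, 0), (- 1, - 1, 0), (0, - 1, - 1), (0, 0, - 1), (0, 0, - 1), (1, 1, - 1),
     (0, 1, 0), (0, 1, 0), (0, 1, 0), (0, 1, 0), (- 1, 1, - 1)],
    [(1, 0, 0), (0, 0, 0), (1, 1, 0), (0, 1, - 1), (0, 1, - 1), (0, 1, - 1), (0, 1, 0), (- 1, 1, 0),
     (- 1, 1, 0), (- 1, 0, 0), (- 1, - 1, - 1), (0, 0, - 1), (0, 0, - 1), (0, 0, - 1), (0, 1, - 1),
     (0, 1, - 1), (0, 1, 0), (0, 1, 0), (0, 1, 0), (- 1, 1, - 1)],
    [(0, 1, - 1), (0, 0, 0), (0, 1, - 1), (0, 1, - 1), (- 1, 1, 0), (- 1, 1, 0), (- 1, 1, 0), (- 1, 1, 0),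
     (- 1, 0, 0), (- 1, 0, - 1), (0, 0, - 1), (- 1, 0, - 1), (- 1, 0, - 1), (- 1, 1, - 1), (- 1, 1, 0),
     (- 1, 1, 0), (- 1, 1, 0), (- 1, 1, 0), (- 1, 1, 0)],
    [(0, 1, - 1), (0, 0, 0), (- 1, 1, 0), (- 1, 0, 0), (- 1, 0, 0), (- 1, 0, 0), (- 1, 0, 0), (- 1, 0, 0),
     (- 1, - 1, 0), (- 1, - 1, - 1), (- 1, 0, - 1), (- 1, 0, - 1), (- 1, 0, 0), (- 1, 0, 0), (- 1, 0, 1),
     (- 1, 1, 1), (- 1, 1, 0), (- 1, 0, 0)],
    [(- 1, 0, 0), (0, 0, 0), (- 1, 0, 0), (- 1, 0, 0), (- 1, 0, 1), (- 1, 0, 1), (- 1, - 1, 0),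
     (- 1, - 1, 0), (- 1, - 1, 0), (- 1, - 1, 0), (- 1, - 1, 0), (- 1, - 1, 1), (- 1, 0, 1), (0, 0, 1),
     (0, 0, 1), (- 1, 0, 1), (- 1, 0, 0)],
    [(- 1, 0, 1), (0, 0, 0), (0, - 1, 1), (- 1, 0, 1), (- 1, 0, 1), (- 1, - 1, 1), (0, - 1, 0),
     (0, - 1, 0), (0, - 1, 0), (0, - 1, 0), (0, - 1, 1), (0, - 1, 1), (0, 0, 1), (0, 1, 1), (- 1, 1, 1),
     (- 1, 0, 0)],
    [(0, 0, 1), (0, 0, 0), (0, 0, 1), (- 1, 0, 1), (- 1, - 1, 1), (0, - 1, 0), (0, - 1, 0), (1, - 1, 0),
     (1, - 1, 0), (1, - 1, 0), (1, 0, 1), (1, 0, 1), (0, 1, 1), (- 1, 1, 0), (- 1, 0, 0)],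
    [(0, 0, 1), (0, 0, 0), (- 1, 0, 1), (- 1, - 1, 0), (0, - 1, 0), (0, - 1, 0), (1, - 1, 0), (1, - 1, 0),
     (1, - 1, 0), (1, 0, 0), (1, 0, 1), (0, 1, 0), (- 1, 1, 0), (- 1, 0, - 1)],
    [(- 6, - 1, 0), (0, 0, 0), (- 1, - 1, 0), (0, - 1, 0), (0, - 1, 0), (1, - 1, - 1), (1, 0, - 1),
     (1, 0, 0), (1, 0, 0), (1, 0, 0), (0, 1, 0), (0, 1, 0), (- 1, 1, - 1)],
    [(0, - 1, 0), (0, 0, 0), (0, - 1, 0), (1, - 1, - 1), (1, - 1, - 1), (1, 0, - 1), (1, 0, 0), (1, 0, 0),
     (1, 0, 0), (0, 1, 0), (0, 1, - 1), (0, 0, - 1)],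
    [(1, - 1, - 1), (0, 0, 0), (1, 0, - 1), (1, 0, - 1), (1, 0, 0), (1, 0, 0), (1, 0, 0), (1, 1, 0),
     (0, 1, 0), (0, 1, - 1), (0, 0, - 1)],
    [(1, 0, - 1), (0, 0, 0), (1, 0, 0), (1, 1, 0), (1, 1, 0), (1, 1, 0), (1, 1, 0), (0, 1, 0), (0, 1, 0),
     (0, 1, - 1)],
    [(1, 1, 0), (0, 0, 0), (0, 1, 0), (0, 1, 0), (0, 1, 1), (0, 1, 1), (0, 1, 0), (0, 1, 0), (0, 1, 0)],
    [(0, 1, 0), (0, 0, 0), (0, 1, 0), (0, 1, 1), (0, 1, 1), (0, 1, 1), (- 1, 1, 0), (- 1, 1, 0)],
    [(0, 1, 1), (0, 0, 0), (0, 0, 1), (0, 1, 1), (0, 1, 1), (- 1, 1, 0), (- 1, 0, 0)],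
    [(0, 0, 1), (0, 0, 0), (0, 1, 1), (0, 1, 0), (- 1, 1, 0), (- 1, 0, 0)],
    [(0, 1, 0), (0, 0, 0), (0, 1, 0), (- 1, 1, 0), (- 1, 0, - 1)],
    [(- 1, 1, 0), (0, 0, 0), (- 1, 0, 0), (- 1, 0, 0)],
    [(- 1, 0, - 1), (0, 0, 0), (- 1, 0, - 1)],
    [(- 1, - 1, - 1), (0, 0, 0)],
    [(0, - 1, 0), (0, 0, 0)]]"

text \<open>The values of \<open>arc_centre\<close> and \<open>arc_tangent\<close> as literals for
  the evaluation; \<open>check_trefoil\<close> confirms that they agree.\<close>

definition trefoil_arcs :: "(ivec \<times> ivec) list" where
  "trefoil_arcs = [
    ((- 20000, 0, - 10000), (30000, - 40000, 0)), ((- 11223, - 6450, - 7100), (31431, - 11796, 21300)),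
    ((- 5000, - 8700, 0), (17400, - 10000, 30000)), ((0, - 12900, 7100), (25800, - 21300, 21300)),
    ((10000, - 17400, 10000), (49800, - 6100, 0)), ((23577, - 13550, 7100), (45631, 36504, - 21300)),
    ((30000, 0, 0), (0, 60000, - 30000)), ((23577, 13550, - 7100), (- 45631, 36504, - 21300)),
    ((10000, 17400, - 10000), (- 49800, - 6100, 0)), ((0, 12900, - 7100), (- 25800, - 21300, 21300)),
    ((- 5000, 8700, 0), (- 17400, - 10000, 30000)), ((- 11223, 6450, 7100), (- 31431, - 11796, 21300)),
    ((- 20000, 0, 10000), (- 30000, - 40000, 0)), ((- 23577, - 13550, 7100), (8569, - 57804, - 21300)),
    ((- 15000, - 26100, 0), (52200, - 30000, - 30000)), ((0, - 27100, - 7100), (54200, 21300, - 21300)),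
    ((10000, - 17400, - 10000), (19800, 46100, 0)), ((11223, - 6450, - 7100), (- 5631, 33096, 21300)),
    ((10000, 0, 0), (0, 20000, 30000)), ((11223, 6450, 7100), (5631, 33096, 21300)),
    ((10000, 17400, 10000), (- 19800, 46100, 0)), ((0, 27100, 7100), (- 54200, 21300, - 21300)),
    ((- 15000, 26100, 0), (- 52200, - 30000, - 30000)),
    ((- 23577, 13550, - 7100), (- 8569, - 57804, - 21300))]"

text \<open>Each of the four rounds contributes a denominator \<open>2 ^ 6\<close>, as the degree is
  6.\<close>

lemma control_hulls_realize:
  "(subdivide ^^ 4) [\<beta>\<^sub>1_control_points] = map (realize (1 / (2 ^ 6) ^ 4)) control_hulls"
proof -
  have "\<beta>\<^sub>1_control_points = realize 1 control_ints"
    by (simp add: \<beta>\<^sub>1_control_points_def control_ints_def realize_def vec_of_def)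
  thus ?thesis
    using subdivide_iter_realize[of control_ints 6 4 1] by (simp add: control_hulls_def control_ints_def)
qed

schematic_goal check_trefoil:
  "map (\<lambda>j. (arc_centre j, arc_tangent j)) [0..<24] = trefoil_arcs \<and>
   trefoil_check dirs_trefoil trefoil_arcs \<and>
   hull_check dirs_trefoil (edges octagon4_24) \<and> length (edges octagon4_24) = ?n"
  by code_simp

\<comment> \<open>The second and third octagons occur with two tables each, as the end of one
  homotopy and the beginning of the next. The two outer ones are linked to their refinements by
  \<open>straighten\<close>.\<close>
schematic_goal check_octagons:
  "straighten octagon4_24 = octagon4 \<and>
   hull_check dirs_34 (edges octagon4) \<and> hull_check dirs_34 (edges octagon3) \<and>
   hull_check dirs_23 (edges octagon3) \<and> hull_check dirs_23 (edges octagon2) \<and>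
   hull_check dirs_12 (edges octagon2) \<and> hull_check dirs_12 (edges octagon1) \<and>
   straighten octagon1_16 = octagon1 \<and>
   length (edges octagon4) = 8 \<and> length (edges octagon3) = 8 \<and>
   length (edges octagon2) = 8 \<and> length (edges octagon1) = ?n"
  by code_simp

schematic_goal check_curve:
  "hull_check dirs_curve control_hulls \<and> hull_check dirs_curve (edges octagon1_16) \<and>
   length control_hulls = 16 \<and> length (edges octagon1_16) = ?n"
  by code_simp

lemma guidable_subdivided_polygon:
    "guidable 16 (dirs dirs_curve) (subdivided_polygon \<beta>\<^sub>1_control_points 4)"
  and guidable_bezier_curve:
    "guidable 16 (dirs dirs_curve) (bezier_curve \<beta>\<^sub>1_control_points)"
proof -
  have ne: "control_hulls \<noteq> []" using check_curve by auto
  have "guidable 16 (dirs dirs_curve) (\<Union>Q\<in>set control_hulls. pl_curve (realize (1 / (2 ^ 6) ^ 4) Q))"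
    using hull_check_pl_curve[OF _ _ ne, of dirs_curve] check_curve by simp
  thus "guidable 16 (dirs dirs_curve) (subdivided_polygon \<beta>\<^sub>1_control_points 4)"
    by (simp add: subdivided_polygon_def control_hulls_realize)
  \<comment> \<open>Subdivision leaves the Bezier curve unchanged, so the sixteen Bezier pieces
    together form the original curve.\<close>
  have "guidable 16 (dirs dirs_curve) (\<Union>Q\<in>set control_hulls. bezier_curve (realize (1 / (2 ^ 6) ^ 4) Q))"
    using hull_check_bezier_curve[OF _ _ ne, of dirs_curve] check_curve by simp
  moreover have "\<beta>\<^sub>1_control_points \<noteq> []" by (simp add: \<beta>\<^sub>1_control_points_def)
  ultimately show "guidable 16 (dirs dirs_curve) (bezier_curve \<beta>\<^sub>1_control_points)"
    by (simp add: control_hulls_realize flip: bezier_curve_subdivide_iter[of _ 4])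
qed

text \<open>The chain runs from the trefoil over the octagons 4, 3, 2 and 1 to the subdivided
  polygon. At octagon 4 the number of arcs changes from 24 to 8, at octagon 1 from 8 to 16.\<close>

lemma trefoil_isotopic_polygon:
  "ambient_isotopic (standard_trefoil (- 1)) (subdivided_polygon \<beta>\<^sub>1_control_points 4)"
proof -
  let ?O1 = "pl_curve (map vec_of octagon1)" and ?O2 = "pl_curve (map vec_of octagon2)"
    and ?O3 = "pl_curve (map vec_of octagon3)" and ?O4 = "pl_curve (map vec_of octagon4)"
  have poly: "guidable n (dirs ws) (pl_curve (map vec_of xs))"
    if "hull_check ws (edges xs)" "length (edges xs) = n" "n > 0" for ws xs n
    using hull_check_polygon[OF that(1)] that(2,3) by auto
  have "guidable 24 (dirs dirs_trefoil) (pl_curve (map vec_of octagon4_24))"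
    using check_trefoil by (intro poly) auto
  hence "guidable 24 (dirs dirs_trefoil) ?O4"
    using pl_curve_straighten[of octagon4_24] check_octagons by simp
  hence 1: "ambient_isotopic (standard_trefoil (- 1)) ?O4"
    using trefoil_check_guidable[of dirs_trefoil] check_trefoil
    by (auto intro: guidable_ambient_isotopic)
  have "guidable 8 (dirs dirs_34) ?O4" "guidable 8 (dirs dirs_34) ?O3"
      "guidable 8 (dirs dirs_23) ?O3" "guidable 8 (dirs dirs_23) ?O2"
      "guidable 8 (dirs dirs_12) ?O2" "guidable 8 (dirs dirs_12) ?O1"
    using check_octagons by (auto intro!: poly)
  hence 2: "ambient_isotopic ?O4 ?O3" "ambient_isotopic ?O3 ?O2" "ambient_isotopic ?O2 ?O1"
    by (blast intro: guidable_ambient_isotopic)+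
  have "guidable 16 (dirs dirs_curve) (pl_curve (map vec_of octagon1_16))"
    using check_curve by (intro poly) auto
  hence "guidable 16 (dirs dirs_curve) ?O1"
    using pl_curve_straighten[of octagon1_16] check_octagons by simp
  hence "ambient_isotopic ?O1 (subdivided_polygon \<beta>\<^sub>1_control_points 4)"
    using guidable_subdivided_polygon by (rule guidable_ambient_isotopic)
  with 1 2 show ?thesis
    by (blast intro: ambient_isotopic_trans)
qed

theorem corollary8p2:
  shows "ambient_isotopic (bezier_curve \<beta>\<^sub>1_control_points)
           (subdivided_polygon \<beta>\<^sub>1_control_points 4) \<and>
         trefoil_knot (subdivided_polygon \<beta>\<^sub>1_control_points 4)"
  using guidable_ambient_isotopic[OF guidable_bezier_curve guidable_subdivided_polygon]
    guidable_knot[OF guidable_subdivided_polygon] trefoil_isotopic_polygon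
  by (auto simp: trefoil_knot_def)

end
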